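(* Let $n>1$ be an integer, let $q>0$ be a real number which is not an integer, and let $k=(n+[q])/2$ if $n+[q]$ is even, $k=(n+[q]+1)/2$ if $n+[q]$ is odd, where $[q]$ is the integer part of $q$. Let $(\mathbb{R}^n,\|\cdot\|)$ be a normed (or quasi-normed, with continuous quasi-norm) space such that $\Delta^k\|x\|^q$ (in the sense of distributions, $\Delta$ the Laplace operator) is a function in $\mathbb{R}^n\setminus\{0\}$ with $(\Delta^k\|x\|^q)|_\Omega\in L_1(\Omega)$. Then: (i) $(\mathbb{R}^n,\|\cdot\|)$ embeds isometrically into $L_q$ if and only if the function $$\xi\mapsto\frac{(-1)^k}{C_{-n-q+2k}\,C_q}\int_\Omega|(\theta,\xi)|^{-n-q+2k}\,\big(\Delta^k\|\cdot\|^q\big)(\theta)\,d\theta$$ is non-negative (almost everywhere) on $\Omega$. (ii) In particular, if the function $\frac{(-1)^k}{C_{-n-q+2k}C_q}\,\Delta^k\|x\|^q$ is non-negative on $\Omega$, then $(\mathbb{R}^n,\|\cdot\|)$ embeds isometrically into $L_q$.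
   Context: $\Omega$ is the Euclidean unit sphere in $\mathbb{R}^n$ with surface measure $d\theta$; $(\theta,\xi)$ is the standard scalar product. $L_q=L_q([0,1])$ with $\|f\|=(\int_0^1|f|^q)^{1/q}$ (a quasi-norm if $q<1$), and "embeds isometrically" means there is a linear map $T:\mathbb{R}^n\to L_q$ with $\|Tx\|=\|x\|$ for all $x$. For $q>-1$ not an even integer, $$C_q=\frac{2^{q+1}\sqrt{\pi}\,\Gamma((q+1)/2)}{\Gamma(-q/2)}.$$ *)

theory Defs
  imports "HOL-Analysis.Analysis"
begin

definition quasi_norm :: "('a::real_vector \<Rightarrow> real) \<Rightarrow> bool" where
  "quasi_norm N \<longleftrightarrow>
     (\<forall>x. 0 \<le> N x) \<and> (\<forall>x. N x = 0 \<longleftrightarrow> x = 0) \<and>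
     (\<forall>c x. N (c *\<^sub>R x) = \<bar>c\<bar> * N x) \<and>
     (\<exists>C. \<forall>x y. N (x + y) \<le> C * (N x + N y))"

text \<open>Elements of \<open>L\<^sub>q([0,1])\<close> are represented by functions, so that identities between
  them (here: linearity of \<open>T\<close>) hold almost everywhere.\<close>

definition Lq_space :: "real \<Rightarrow> (real \<Rightarrow> real) set" where
  "Lq_space q = {f \<in> borel_measurable (lebesgue_on {0..1}).
                   integrable (lebesgue_on {0..1}) (\<lambda>t. \<bar>f t\<bar> powr q)}"

definition Lq_norm :: "real \<Rightarrow> (real \<Rightarrow> real) \<Rightarrow> real" where
  "Lq_norm q f = (LINT t|lebesgue_on {0..1}. \<bar>f t\<bar> powr q) powr (1 / q)"

definition embeds_isometrically_Lq :: "real \<Rightarrow> ('a::real_vector \<Rightarrow> real) \<Rightarrow> bool" where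
  "embeds_isometrically_Lq q N \<longleftrightarrow>
     (\<exists>T. (\<forall>x. T x \<in> Lq_space q) \<and>
          (\<forall>x y. AE t in lebesgue_on {0..1}. T (x + y) t = T x t + T y t) \<and>
          (\<forall>c x. AE t in lebesgue_on {0..1}. T (c *\<^sub>R x) t = c * T x t) \<and>
          (\<forall>x. Lq_norm q (T x) = N x))"

definition C_const :: "real \<Rightarrow> real" where
  "C_const q = 2 powr (q + 1) * sqrt pi * Gamma ((q + 1) / 2) / Gamma (- q / 2)"

text \<open>Surface measure of the Euclidean unit sphere, obtained from polar coordinates:
  \<open>\<sigma>(A) = n \<cdot> vol {r \<theta> | \<theta> \<in> A, 0 < r \<le> 1}\<close> for Borel \<open>A\<close>, and then completed.\<close>

definition surface_measure :: "'a::euclidean_space measure" where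
  "surface_measure = completion (scale_measure (of_nat DIM('a))
     (distr (restrict_space lborel (cball 0 1 - {0})) (restrict_space borel (sphere 0 1))
        (\<lambda>x. x /\<^sub>R norm x)))"

lemma emeasure_surface_measure:
  fixes A :: "'a::euclidean_space set"
  assumes A: "A \<in> sets borel" "A \<subseteq> sphere 0 1"
  shows "emeasure surface_measure A =
           of_nat DIM('a) * emeasure lborel {x \<in> cball 0 1 - {0}. x /\<^sub>R norm x \<in> A}"
proof -
  let ?R = "restrict_space lborel (cball 0 1 - {0}) :: 'a measure"
  let ?S = "restrict_space borel (sphere 0 1) :: 'a measure"
  let ?D = "distr ?R ?S (\<lambda>x. x /\<^sub>R norm x)"
  have m: "(\<lambda>x::'a. x /\<^sub>R norm x) \<in> ?R \<rightarrow>\<^sub>M ?S"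
    by (rule measurable_restrict_space2) (auto simp: space_restrict_space intro: measurable_restrict_space1)
  have AS: "A \<in> sets ?S"
    using A by (subst sets_restrict_space_iff) auto
  then have "A \<in> sets (scale_measure (of_nat DIM('a)) ?D)"
    by simp
  then have "emeasure surface_measure A = of_nat DIM('a) * emeasure ?D A"
    unfolding surface_measure_def by (simp del: sets_scale_measure)
  also have "emeasure ?D A = emeasure ?R ((\<lambda>x. x /\<^sub>R norm x) -` A \<inter> space ?R)"
    by (rule emeasure_distr[OF m AS])
  also have "\<dots> = emeasure lborel ((\<lambda>x. x /\<^sub>R norm x) -` A \<inter> space ?R)"
    by (rule emeasure_restrict_space) (auto simp: space_restrict_space)
  also have "(\<lambda>x. x /\<^sub>R norm x) -` A \<inter> space ?R = {x \<in> cball 0 1 - {0}. x /\<^sub>R norm x \<in> A}"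
    by (auto simp: space_restrict_space)
  finally show ?thesis .
qed

definition partial :: "'a::euclidean_space \<Rightarrow> ('a \<Rightarrow> real) \<Rightarrow> 'a \<Rightarrow> real" where
  "partial b \<phi> = (\<lambda>x. frechet_derivative \<phi> (at x) b)"

primrec C_k :: "nat \<Rightarrow> ('a::euclidean_space \<Rightarrow> real) \<Rightarrow> bool" where
  "C_k 0 \<phi> \<longleftrightarrow> continuous_on UNIV \<phi>"
| "C_k (Suc m) \<phi> \<longleftrightarrow> (\<forall>x. \<phi> differentiable at x) \<and> (\<forall>b\<in>Basis. C_k m (partial b \<phi>))"

definition laplacian :: "('a::euclidean_space \<Rightarrow> real) \<Rightarrow> 'a \<Rightarrow> real" where
  "laplacian \<phi> = (\<lambda>x. \<Sum>b\<in>Basis. partial b (partial b \<phi>) x)"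

definition test_functions :: "'a::euclidean_space set \<Rightarrow> ('a \<Rightarrow> real) set" where
  "test_functions U = {\<phi>. (\<forall>m. C_k m \<phi>) \<and>
     compact (closure {x. \<phi> x \<noteq> 0}) \<and> closure {x. \<phi> x \<noteq> 0} \<subseteq> U}"

text \<open>The distribution \<open>\<Delta>\<^sup>k u\<close> on the open set \<open>U\<close> is the (locally integrable) function \<open>f\<close>.
  No sign appears because \<open>\<Delta>\<close> is formally self-adjoint.\<close>

definition distr_laplacian_power ::
  "nat \<Rightarrow> 'a::euclidean_space set \<Rightarrow> ('a \<Rightarrow> real) \<Rightarrow> ('a \<Rightarrow> real) \<Rightarrow> bool" where
  "distr_laplacian_power k U u f \<longleftrightarrow>
     (\<forall>K. compact K \<and> K \<subseteq> U \<longrightarrow> f absolutely_integrable_on K) \<and>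
     (\<forall>\<phi>\<in>test_functions U.
        (LINT x|lebesgue. u x * (laplacian ^^ k) \<phi> x) = (LINT x|lebesgue. f x * \<phi> x))"

text \<open>The restriction of such an \<open>f\<close> to the sphere, a null set, depends on the representative of
  \<open>f\<close>.  For \<open>u = N powr q\<close> the distribution is homogeneous of degree \<open>q - 2k\<close>, and its
  restriction to the sphere is that of a representative with the following property.\<close>

definition pos_homogeneous :: "real \<Rightarrow> ('a::real_vector \<Rightarrow> real) \<Rightarrow> bool" where
  "pos_homogeneous d f \<longleftrightarrow> (\<forall>t>0. \<forall>x. x \<noteq> 0 \<longrightarrow> f (t *\<^sub>R x) = t powr d * f x)"

end

theory Submission
  imports Defs "HOL-Probability.Probability" "HOL-Real_Asymp.Real_Asymp"
begin

text \<open>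
  Put \<open>p = 2k - n - q\<close>, so \<open>-1 < p < 1\<close> and \<open>p \<noteq> 0\<close>, and let \<open>T\<^sub>r g (y) = \<integral>\<^sub>\<Omega> |(y,\<theta>)|\<^sup>r g(\<theta>) d\<theta>\<close>.
  On even functions on the sphere \<open>T\<^sub>q \<circ> \<Delta>\<^sup>k \<circ> T\<^sub>p\<close> is a constant \<open>c\<close> that has the sign of \<open>(-1)\<^sup>k / (C\<^sub>p C\<^sub>q)\<close>;
  here \<open>\<Delta>\<^sup>k\<close> acts on homogeneous functions of degree \<open>q\<close>.  No Fourier transform is needed for this: tested against
  \<open>h(|x|\<^sup>2) (b,x)\<^sup>2\<^sup>m\<close>, the hypothesis expresses the moments of \<open>f\<close> on the sphere by those of \<open>\<parallel>x\<parallel>\<^sup>q\<close>, and \<open>T\<^sub>r\<close> of the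
  monomials is a Gaussian integral.  In the basis of the (radially integrated) Hermite functions
  \<open>(b,\<nabla>)\<^sup>2\<^sup>m exp(-|x|\<^sup>2/2)\<close> both become diagonal, because these functions evolve by the heat equation.
  As even functions are determined by these moments, \<open>T\<^sub>q(T\<^sub>p f) = c \<parallel>x\<parallel>\<^sup>q\<close>, which gives an embedding if \<open>c T\<^sub>p f \<ge> 0\<close>
  (a finite measure on the sphere is an image of Lebesgue measure on \<open>[0,1]\<close>).  Conversely an embedding represents
  \<open>\<parallel>x\<parallel>\<^sup>q\<close> as \<open>T\<^sub>q \<nu>\<close> with \<open>\<nu> \<ge> 0\<close>, and then \<open>T\<^sub>p f = c \<nu>\<close> on even functions.
\<close>

section \<open>Power series identities\<close>

text \<open>The obstacle is that \<open>f\<close> is merely integrable on the sphere and its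
  Laplacian identity holds only away from the origin, so identities are first obtained for even
  moments. In Gaussian form, the moments of a homogeneous function of degree d carry the weight of
  exponent n + d, and each Laplacian lowers it by 2; after k of them it is n + q - 2k = -p. The
  coefficients prod (p - 2s) of T_p are, up to sign, the same weights at -p. This match makes both
  operators diagonal in one basis. Three factors depending on m remain: prod_{s<m} (q - 2s) from
  T_q, prod_{i<k} (q - 2i - 2m) from the Laplacians, and the weight of exponent n + p + 2m in the
  denominator from T_p. Together with (-1)^m they do not depend on m, since passing to m + 1
  multiplies numerator and denominator by n + p + 2m; the value at m = 0 enters the constant c. The
  choice of k puts p where T_p converges and where the weight at -p needs at most one step of
  analytic continuation; p nonzero avoids the pole there.\<close>

text \<open>One Laplacian in the Hermite basis: \<open>v\<close> and \<open>w\<close> play the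
  moments of a function of degree \<open>d\<close> and of its Laplacian. The first term of
  \<open>w\<close> gives \<open>A i\<close> the factor d - 2(m - i); the second shifts the index
  and, by \<open>cS\<close>, contributes -2i. The total d - 2m is independent of i, so the whole sum
  is just multiplied by it.\<close>

lemma heat_chain_step:
  fixes rho :: "real \<Rightarrow> real" and v w :: "nat \<Rightarrow> real" and \<beta> d n :: real
  assumes rho: "\<And>l. rho (n + d + 2 * real l) = (n + d - 2 + 2 * real l) * rho (n + d - 2 + 2 * real l)"
    and w: "\<And>l. w l = (n + d + 2 * real l - 2) * (d - 2 * real l) * v l + (if l = 0 then 0 else \<beta> * v (l - 1))"
  shows "(\<Sum>i\<le>m. (-\<beta>/2)^i / fact i * rho (n + (d - 2) + 2 * real (m - i)) * w (m - i))
       = (d - 2 * real m) * (\<Sum>i\<le>m. (-\<beta>/2)^i / fact i * rho (n + d + 2 * real (m - i)) * v (m - i))"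
proof -
  define c where "c i = (-\<beta>/2)^i / fact i" for i
  define A where "A i = c i * rho (n + d + 2 * real (m - i)) * v (m - i)" for i
  have cS: "\<beta> * c i = - 2 * real (Suc i) * c (Suc i)" for i
    by (simp add: c_def field_simps del: of_nat_Suc)
  have "(\<Sum>i\<le>m. c i * rho (n + (d - 2) + 2 * real (m - i)) * w (m - i))
      = (\<Sum>i\<le>m. (d - 2 * real (m - i)) * A i)
        + (\<Sum>i\<le>m. if i = m then 0 else c i * rho (n + (d - 2) + 2 * real (m - i)) * \<beta> * v (m - i - 1))"
    unfolding sum.distrib[symmetric]
  proof (rule sum.cong[OF refl])
    fix i assume i: "i \<in> {..m}"
    define L r0 r1 where "L = real (m - i)" and "r0 = rho (n + d - 2 + 2 * L)" and "r1 = rho (n + d + 2 * L)"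
    have r: "r1 = (n + d - 2 + 2 * L) * r0" "rho (n + (d - 2) + 2 * L) = r0"
      using rho[of "m - i"] by (simp_all add: L_def r0_def r1_def algebra_simps)
    have m: "m - i = 0 \<longleftrightarrow> i = m" using i by auto
    show "c i * rho (n + (d - 2) + 2 * real (m - i)) * w (m - i) = (d - 2 * real (m - i)) * A i +
        (if i = m then 0 else c i * rho (n + (d - 2) + 2 * real (m - i)) * \<beta> * v (m - i - 1))"
      unfolding w A_def L_def[symmetric] r r1_def[symmetric] m by (simp add: algebra_simps)
  qed
  also have "(\<Sum>i\<le>m. if i = m then 0 else c i * rho (n + (d - 2) + 2 * real (m - i)) * \<beta> * v (m - i - 1))
     = (\<Sum>i<m. c i * rho (n + (d - 2) + 2 * real (m - i)) * \<beta> * v (m - i - 1))"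
    by (rule sum.mono_neutral_cong_right) auto
  also have "\<dots> = (\<Sum>i<m. - 2 * real (Suc i) * A (Suc i))"
  proof (rule sum.cong[OF refl])
    fix i assume "i \<in> {..<m}"
    then have "real (m - i) = real (m - Suc i) + 1" "m - i - 1 = m - Suc i"
      by (auto simp: of_nat_diff)
    then show "c i * rho (n + (d - 2) + 2 * real (m - i)) * \<beta> * v (m - i - 1) = - 2 * real (Suc i) * A (Suc i)"
      using arg_cong[OF cS[of i], of "\<lambda>t. t * rho (n + d + 2 * real (m - Suc i)) * v (m - Suc i)"]
      by (simp add: A_def algebra_simps del: of_nat_Suc of_nat_diff)
  qed
  also have "\<dots> = (\<Sum>i\<le>m. - 2 * real i * A i)"
    by (simp add: lessThan_Suc_atMost[symmetric] sum.lessThan_Suc_shift del: sum.lessThan_Suc of_nat_Suc)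
  finally show ?thesis
    unfolding c_def[symmetric] A_def[symmetric] sum.distrib[symmetric] sum_distrib_left
    by (rule trans) (rule sum.cong, auto simp: of_nat_diff algebra_simps)
qed

text \<open>The recursion for \<open>rho\<close> is asked only along the exponents met for i < k, so
  that the last one, n + q - 2k, may lie on the continued branch of the Gaussian moments.\<close>

lemma heat_chain:
  fixes rho :: "real \<Rightarrow> real" and v :: "nat \<Rightarrow> nat \<Rightarrow> real" and \<beta> q n :: real
  assumes rho: "\<And>i l. i < k \<Longrightarrow> rho (n + q - 2 * real i + 2 * real l)
      = (n + q - 2 * real i - 2 + 2 * real l) * rho (n + q - 2 * real i - 2 + 2 * real l)"
    and v: "\<And>i l. i < k \<Longrightarrow> v (Suc i) l = (n + q - 2 * real i + 2 * real l - 2) * (q - 2 * real i - 2 * real l) * v i l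
             + (if l = 0 then 0 else \<beta> * v i (l - 1))"
  shows "(\<Sum>i\<le>m. (-\<beta>/2)^i / fact i * rho (n + q - 2 * real k + 2 * real (m - i)) * v k (m - i))
       = (\<Prod>i<k. q - 2 * real i - 2 * real m) * (\<Sum>i\<le>m. (-\<beta>/2)^i / fact i * rho (n + q + 2 * real (m - i)) * v 0 (m - i))"
  using assms
proof (induction k)
  case (Suc k)
  have "(\<Sum>i\<le>m. (-\<beta>/2)^i / fact i * rho (n + ((q - 2 * real k) - 2) + 2 * real (m - i)) * v (Suc k) (m - i))
     = (q - 2 * real k - 2 * real m) * (\<Sum>i\<le>m. (-\<beta>/2)^i / fact i * rho (n + (q - 2 * real k) + 2 * real (m - i)) * v k (m - i))"
    by (rule heat_chain_step) (use Suc.prems[of k] in \<open>auto simp: algebra_simps\<close>)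
  then show ?case
    using Suc.IH[OF Suc.prems] by (simp add: algebra_simps)
qed simp

text \<open>Kummer's transformation e^(-z) M(a; c; z) = M(c - a; c; -z) with a = (r + 1)/2, c = 1/2,
  z = X/2, stated through coefficient recurrences. The recurrence of \<open>A\<close> is the
  confluent hypergeometric equation; substituting \<open>B\<close> into the equation avoids summing
  the product series.\<close>

lemma fps_kummer:
  fixes A :: "real fps" and r :: real
  assumes A: "\<And>l. (2 * real l + 2) * (2 * real l + 1) * fps_nth A (Suc l) = (r + 1 + 2 * real l) * fps_nth A l"
  defines "B \<equiv> fps_exp (-1/2) * A"
  shows "(2 * real l + 2) * (2 * real l + 1) * fps_nth B (Suc l) = (r - 2 * real l) * fps_nth B l"
proof -
  define E :: "real fps" where "E = fps_exp (-1/2)"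
  have dE: "fps_deriv E = fps_const (-1/2) * E" by (simp add: E_def)
  have ode: "4 * fps_X * fps_deriv (fps_deriv A) + 2 * fps_deriv A = fps_const (r+1) * A + 2 * fps_X * fps_deriv A"
    (is "?L = ?R")
  proof (rule fps_ext)
    fix l
    show "fps_nth ?L l = fps_nth ?R l"
      using A[of l] by (cases l) (auto simp: algebra_simps numeral_fps_const)
  qed
  have B: "B = E * A" by (simp add: B_def E_def)
  have dB: "fps_deriv B = E * (fps_deriv A - fps_const (1/2) * A)"
    by (simp add: B dE algebra_simps flip: fps_const_neg)
  have ddB: "fps_deriv (fps_deriv B) = E * (fps_deriv (fps_deriv A) - fps_deriv A + fps_const (1/4) * A)"
  proof -
    have "fps_const (1/2) * (fps_const (1/2) * X) = fps_const (1/4::real) * X" 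
      "fps_const (1/2) * X + fps_const (1/2) * X = X" for X :: "real fps"
      by (auto simp flip: mult.assoc distrib_right)
    then show ?thesis
      unfolding dB by (simp add: dE algebra_simps flip: fps_const_neg)
  qed
  have 4: "4 * fps_const (1/4) = (1 :: real fps)" "2 * fps_const (1/2) = (1 :: real fps)"
    by (simp_all add: numeral_fps_const)
  have e1: "fps_const (r+1) = fps_const r + 1" by (metis fps_const_1_eq_1 fps_const_add)
  have "4 * fps_X * fps_deriv (fps_deriv B) + 2 * fps_deriv B
      = E * ((4 * fps_X * fps_deriv (fps_deriv A) + 2 * fps_deriv A) - 4 * fps_X * fps_deriv A
             + (4 * fps_const (1/4)) * fps_X * A - (2 * fps_const (1/2)) * A)"
    unfolding ddB unfolding dB by (simp only: algebra_simps)
  also have "\<dots> = fps_const r * (E * A) - 2 * fps_X * (E * fps_deriv A) + fps_X * (E * A)"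
    unfolding ode 4 e1 by (simp add: algebra_simps)
  also have "\<dots> = fps_const r * B - 2 * fps_X * fps_deriv B"
  proof -
    have "2 * fps_X * fps_deriv B = 2 * fps_X * (E * fps_deriv A) - (2 * fps_const (1/2)) * fps_X * (E * A)"
      unfolding dB by (simp only: algebra_simps)
    then show ?thesis unfolding 4 B by simp
  qed
  finally have "fps_nth (4 * fps_X * fps_deriv (fps_deriv B) + 2 * fps_deriv B) l = fps_nth (fps_const r * B - 2 * fps_X * fps_deriv B) l"
    by simp
  then show ?thesis
    by (cases l) (auto simp: algebra_simps numeral_fps_const)
qed

section \<open>Gaussian moments\<close>

lemma integrable_powr_exp:
  fixes a :: real assumes a: "a > 0"
  shows "set_integrable lborel {0<..} (\<lambda>s. s powr (a - 1) * exp (- s))"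
proof -
  have "(\<lambda>t. t powr (a - 1) / exp t) absolutely_integrable_on {0..}"
    using Gamma_integral_real[OF a] by (intro nonnegative_absolutely_integrable_1) auto
  then have "(\<lambda>t. t powr (a - 1) / exp t) absolutely_integrable_on {0<..}"
    by (rule set_integrable_subset) auto
  then show ?thesis
    by (auto simp: set_integrable_def integrable_completion exp_minus divide_inverse)
qed

lemma integrable_powr_gauss:
  fixes a :: real assumes a: "a > 0"
  shows "set_integrable lborel {0<..} (\<lambda>s. s powr (a - 1) * exp (- s\<^sup>2 / 2))"
  unfolding set_integrable_def
proof (rule Bochner_Integration.integrable_bound)
  show "integrable lborel (\<lambda>s. exp (1/2) * (indicator {0<..} s *\<^sub>R (s powr (a - 1) * exp (- s))))"
    using integrable_powr_exp[OF a] unfolding set_integrable_def by (rule integrable_mult_right)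
  have "exp (- s\<^sup>2 / 2) \<le> exp (1/2) * exp (- s)" for s :: real
  proof -
    have "- s\<^sup>2 / 2 \<le> 1/2 - s" using zero_le_power2[of "s - 1"] by (simp add: power2_eq_square field_simps)
    then show ?thesis by (metis exp_le_cancel_iff mult_exp_exp diff_conv_add_uminus)
  qed
  then have "s powr (a - 1) * exp (- s\<^sup>2 / 2) \<le> exp (1/2) * (s powr (a - 1) * exp (- s))" for s :: real
    using mult_left_mono[of "exp (- s\<^sup>2 / 2)" "exp (1/2) * exp (- s)" "s powr (a - 1)"] by (simp add: mult_ac)
  then show "AE s in lborel. norm (indicator {0<..} s *\<^sub>R (s powr (a - 1) * exp (- s\<^sup>2 / 2)))
      \<le> norm (exp (1/2) * (indicator {0<..} s *\<^sub>R (s powr (a - 1) * exp (- s))))"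
    by (intro AE_I2) (auto simp: indicator_def abs_mult)
qed simp

definition gauss_int :: "real \<Rightarrow> real" where
  "gauss_int a = (LINT s:{0<..}|lborel. s powr (a - 1) * exp (- s\<^sup>2 / 2))"

lemma not_AE_interval:
  fixes a b :: real
  assumes "a < b"
  shows "\<not> (AE r in lborel. r \<notin> {a<..<b})"
proof
  assume "AE r in lborel. r \<notin> {a<..<b}"
  then have "emeasure lborel {a<..<b} = 0"
    by (subst (asm) AE_iff_measurable[OF _ refl]) (auto simp: greaterThanLessThan_def greaterThan_def lessThan_def Collect_conj_eq)
  then show False using assms by simp
qed

lemma gauss_int_pos: assumes "a > 0" shows "gauss_int a > 0"
proof -
  have "gauss_int a \<noteq> 0"
  proof
    assume "gauss_int a = 0"
    then have "AE s in lborel. indicator {0<..} s *\<^sub>R (s powr (a - 1) * exp (- s\<^sup>2 / 2)) = (0::real)"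
      using integrable_powr_gauss[OF assms]
      by (subst (asm) gauss_int_def, subst (asm) set_lebesgue_integral_def, subst (asm) integral_nonneg_eq_0_iff_AE)
         (auto simp: set_integrable_def)
    then have "AE s in lborel. s \<notin> {0<..<1::real}"
      by eventually_elim (auto simp: indicator_def)
    then show False using not_AE_interval[of 0 "1"] by simp
  qed
  moreover have "gauss_int a \<ge> 0"
    unfolding gauss_int_def set_lebesgue_integral_def by (intro integral_nonneg_AE) auto
  ultimately show ?thesis by simp
qed

lemma gauss_int_rec: assumes a: "a > 0" shows "gauss_int (a + 2) = a * gauss_int a"
proof -
  let ?F = "\<lambda>s::real. s powr a * exp (- s\<^sup>2 / 2)"
  let ?f = "\<lambda>s::real. a * (s powr (a - 1) * exp (- s\<^sup>2 / 2)) - s powr (a + 2 - 1) * exp (- s\<^sup>2 / 2)"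
  have i1: "set_integrable lborel {0<..} (\<lambda>s. a * (s powr (a - 1) * exp (- s\<^sup>2 / 2)))"
    by (rule set_integrable_mult_right) (use integrable_powr_gauss[OF a] in auto)
  have i2: "set_integrable lborel {0<..} (\<lambda>s. s powr (a + 2 - 1) * exp (- s\<^sup>2 / 2))"
    by (rule integrable_powr_gauss) (use a in auto)
  have eq: "einterval 0 \<infinity> = {0<..}" by (auto simp: einterval_def)
  have "(LBINT s=0..\<infinity>. ?f s) = 0 - 0"
  proof (rule interval_integral_FTC_integrable[where F = ?F])
    fix s :: real assume "ereal s > 0"
    then have s: "s > 0" by auto
    show "(?F has_vector_derivative ?f s) (at s)"
      unfolding has_real_derivative_iff_has_vector_derivative[symmetric]
      using s by (auto intro!: derivative_eq_intros simp: powr_diff powr_add power2_eq_square field_simps)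
    show "isCont ?f s" using s by (intro continuous_intros) auto
  next
    have "((\<lambda>s::real. s powr a * exp (- s\<^sup>2 / 2)) \<longlongrightarrow> 0) (at_right 0)" using a by real_asymp
    then show "((?F \<circ> real_of_ereal) \<longlongrightarrow> 0) (at_right 0)"
      by (simp add: ereal_tendsto_simps1 flip: zero_ereal_def) (simp add: zero_ereal_def ereal_tendsto_simps1)
    have "((\<lambda>s::real. s powr a * exp (- s\<^sup>2 / 2)) \<longlongrightarrow> 0) at_top" using a by real_asymp
    then show "((?F \<circ> real_of_ereal) \<longlongrightarrow> 0) (at_left \<infinity>)"
      by (simp add: ereal_tendsto_simps1)
  next
    show "set_integrable lborel (einterval 0 \<infinity>) ?f"
      unfolding eq by (rule set_integral_diff(1)[OF i1 i2])
  qed simp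
  then have "(LINT s:{0<..}|lborel. ?f s) = 0"
    by (simp add: interval_lebesgue_integral_def eq)
  then show ?thesis
    unfolding gauss_int_def set_integral_diff(2)[OF i1 i2] by simp
qed

text \<open>The extension by one step to the left is the analytic continuation, \<open>2 powr (a/2 - 1) * Gamma (a/2)\<close>.\<close>

definition gauss_moment :: "real \<Rightarrow> real" where
  "gauss_moment a = (if a > 0 then gauss_int a else gauss_int (a + 2) / a)"

text \<open>For positive \<open>a\<close> this is integration by parts; for \<open>a\<close> between
  -2 and 0 it is the definition.\<close>

lemma gauss_moment_rec: "a > -2 \<Longrightarrow> a \<noteq> 0 \<Longrightarrow> gauss_moment (a + 2) = a * gauss_moment a"
  by (auto simp: gauss_moment_def gauss_int_rec)

lemma gauss_moment_pos: "a > 0 \<Longrightarrow> gauss_moment a > 0"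
  by (simp add: gauss_moment_def gauss_int_pos)

lemma integrable_abs_powr_gauss:
  assumes "r > -1"
  shows "integrable lborel (\<lambda>t::real. \<bar>t\<bar> powr r * exp (- t\<^sup>2 / 2))"
    and "(\<integral>t. \<bar>t\<bar> powr r * exp (- t\<^sup>2 / 2) \<partial>lborel) = 2 * gauss_moment (r + 1)"
proof -
  let ?g = "\<lambda>t::real. \<bar>t\<bar> powr r * exp (- t\<^sup>2 / 2)"
  let ?h = "\<lambda>t::real. indicator {0<..} t *\<^sub>R ?g t"
  have h: "?h = (\<lambda>t. indicator {0<..} t *\<^sub>R (t powr (r + 1 - 1) * exp (- t\<^sup>2 / 2)))"
    by (auto simp: indicator_def)
  have i: "integrable lborel ?h"
    unfolding h using integrable_powr_gauss[of "r + 1"] assms by (simp add: set_integrable_def)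
  have v: "integral\<^sup>L lborel ?h = gauss_moment (r + 1)"
    unfolding h using assms by (simp add: gauss_moment_def gauss_int_def set_lebesgue_integral_def)
  have i': "integrable lborel (\<lambda>t. ?h (- t))"
    using lborel_integrable_real_affine[OF i, of "-1" 0] by simp
  have v': "integral\<^sup>L lborel (\<lambda>t. ?h (- t)) = gauss_moment (r + 1)"
    using lborel_integral_real_affine[of "-1" ?h 0] v by simp
  have ae: "AE t in lborel. ?g t = ?h t + ?h (- t)"
    using AE_lborel_singleton[of 0] by eventually_elim (auto simp: indicator_def)
  show "integrable lborel ?g"
    using Bochner_Integration.integrable_add[OF i i'] by (rule integrable_cong_AE_imp) (use ae in auto)
  have "integral\<^sup>L lborel ?g = (\<integral>t. ?h t + ?h (- t) \<partial>lborel)"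
    by (rule integral_cong_AE) (use ae in auto)
  also have "\<dots> = gauss_moment (r + 1) + gauss_moment (r + 1)"
    using Bochner_Integration.integral_add[OF i i'] v v' by simp
  finally show "integral\<^sup>L lborel ?g = 2 * gauss_moment (r + 1)" by simp
qed

section \<open>Polar coordinates\<close>

text \<open>The surface measure before completion. Product measures and joint measurability are
  handled on Borel sets; the completion returns only in the final theorem.\<close>

definition sphere_measure :: "'a::euclidean_space measure" where
  "sphere_measure = scale_measure (of_nat DIM('a))
     (distr (restrict_space lborel (cball 0 1 - {0})) (restrict_space borel (sphere 0 1))
        (\<lambda>x. x /\<^sub>R norm x))"

lemma surface_measure_eq: "surface_measure = completion sphere_measure"
  by (simp add: surface_measure_def sphere_measure_def)

lemma sets_sphere_measure [measurable_cong]: 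
  "sets (sphere_measure :: 'a::euclidean_space measure) = sets (restrict_space borel (sphere 0 1))"
  by (simp add: sphere_measure_def)

lemma space_sphere_measure [simp]: "space (sphere_measure :: 'a::euclidean_space measure) = sphere 0 1"
  using sets_eq_imp_space_eq[OF sets_sphere_measure] by (simp add: space_restrict_space)

lemma emeasure_sphere_measure:
  fixes A :: "'a::euclidean_space set"
  assumes A: "A \<in> sets sphere_measure"
  shows "emeasure sphere_measure A =
           of_nat DIM('a) * emeasure lborel {x \<in> cball 0 1 - {0}. x /\<^sub>R norm x \<in> A}"
proof -
  have "A \<in> sets borel" "A \<subseteq> sphere 0 1"
    using A by (auto simp: sets_sphere_measure sets_restrict_space)
  from emeasure_surface_measure[OF this] show ?thesis
    using A by (simp add: surface_measure_eq)
qed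

lemma finite_measure_sphere_measure: "finite_measure (sphere_measure :: 'a::euclidean_space measure)"
proof
  have "emeasure sphere_measure (sphere 0 1 :: 'a set)
      = of_nat DIM('a) * emeasure lborel {x \<in> cball 0 1 - {0::'a}. x /\<^sub>R norm x \<in> sphere 0 1}"
    by (rule emeasure_sphere_measure) (use sets.top[of sphere_measure] in auto)
  also have "\<dots> \<le> of_nat DIM('a) * emeasure lborel (cball 0 1 :: 'a set)"
    by (intro mult_left_mono emeasure_mono) auto
  also have "\<dots> < \<infinity>"
    using emeasure_bounded_finite[OF bounded_cball] by (auto simp: ennreal_mult_less_top of_nat_less_top)
  finally show "emeasure sphere_measure (space (sphere_measure :: 'a measure)) \<noteq> \<infinity>" by simp
qed

lemma sigma_finite_sphere_measure: "sigma_finite_measure (sphere_measure :: 'a::euclidean_space measure)"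
  using finite_measure_sphere_measure by (rule finite_measure.axioms(1))

lemma borel_measurable_sphere [measurable (raw)]:
  fixes f :: "'a::euclidean_space \<Rightarrow> 'b::topological_space"
  shows "f \<in> borel_measurable borel \<Longrightarrow> f \<in> borel_measurable sphere_measure"
  by (simp add: measurable_restrict_space1 cong: measurable_cong_sets[OF sets_sphere_measure refl])

definition radial_measure :: "nat \<Rightarrow> real measure" where
  "radial_measure n = density lborel (\<lambda>r. indicator {0<..} r * ennreal (r ^ (n - 1)))"

lemma sets_radial_measure [simp, measurable_cong]: "sets (radial_measure n) = sets borel"
  by (simp add: radial_measure_def)

lemma space_radial_measure [simp]: "space (radial_measure n) = UNIV"
  by (simp add: radial_measure_def)

lemma emeasure_radial_measure_atMost:
  assumes n: "n > 0" and a: "a \<ge> 0"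
  shows "emeasure (radial_measure n) {..a} = ennreal (a ^ n / n)"
proof -
  have "emeasure (radial_measure n) {..a} = (\<integral>\<^sup>+r. ennreal (r ^ (n - 1)) * indicator {0..a} r \<partial>lborel)"
    unfolding radial_measure_def
    by (subst emeasure_density, simp, simp, rule nn_integral_cong_AE)
       (use AE_lborel_singleton[of "0::real"] in \<open>eventually_elim, auto simp: indicator_def\<close>)
  also have "\<dots> = ennreal (a ^ n / n - 0 ^ n / n)"
  proof (rule nn_integral_FTC_Icc)
    fix x :: real assume "x \<in> {0..a}"
    show "((\<lambda>x. x ^ n / n) has_real_derivative x ^ (n - 1)) (at x)"
      using n by (auto intro!: derivative_eq_intros)
  qed (use a in auto)
  finally show ?thesis using n by (simp add: zero_power)
qed

lemma emeasure_radial_measure_atMost_neg: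
  assumes a: "a < 0"
  shows "emeasure (radial_measure n) {..a} = 0"
  unfolding radial_measure_def
  by (subst emeasure_density, simp, simp, subst nn_integral_0_iff_AE)
     (use a in \<open>auto simp: indicator_def\<close>)

lemma sigma_finite_radial_measure: "n > 0 \<Longrightarrow> sigma_finite_measure (radial_measure n)"
proof (standard, intro exI conjI ballI)
  show "countable (range (\<lambda>i::nat. {..real i}))" by auto
  show "\<Union> (range (\<lambda>i::nat. {..real i})) = space (radial_measure n)"
    by (auto intro: real_arch_simple)
next
  fix A assume "n > 0" "A \<in> range (\<lambda>i::nat. {..real i})"
  then show "emeasure (radial_measure n) A \<noteq> \<infinity>"
    by (auto simp: emeasure_radial_measure_atMost)
qed auto

lemma emeasure_lborel_scaleR_image:
  fixes A :: "'a::euclidean_space set"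
  assumes A[measurable]: "A \<in> sets borel" and a: "a > 0"
  shows "emeasure lborel {x. (1/a) *\<^sub>R x \<in> A} = ennreal (a ^ DIM('a)) * emeasure lborel A"
proof -
  have m: "{x. (1/a) *\<^sub>R x \<in> A} \<in> sets borel" by measurable
  have "emeasure lborel {x. (1/a) *\<^sub>R x \<in> A}
     = emeasure (density (distr lborel borel (\<lambda>x. 0 + a *\<^sub>R x)) (\<lambda>_. \<bar>a\<bar>^DIM('a))) {x. (1/a) *\<^sub>R x \<in> A}"
    using a by (subst lborel_affine[of a 0]) auto
  also have "\<dots> = ennreal (a ^ DIM('a)) * emeasure lborel A"
    using a m by (subst emeasure_density_const) (auto simp: emeasure_distr vimage_def)
  finally show ?thesis .
qed

lemma measurable_polar:
  "(\<lambda>x::'a::euclidean_space. (norm x, x /\<^sub>R norm x))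
    \<in> restrict_space lborel (- {0}) \<rightarrow>\<^sub>M borel \<Otimes>\<^sub>M restrict_space borel (sphere 0 1)"
proof (rule measurable_Pair)
  show "(\<lambda>x. x /\<^sub>R norm x) \<in> restrict_space lborel (- {0}) \<rightarrow>\<^sub>M restrict_space borel (sphere (0::'a) 1)"
    by (rule measurable_restrict_space2) (auto simp: space_restrict_space intro: measurable_restrict_space1)
qed (auto intro: measurable_restrict_space1)

text \<open>By uniqueness of product measures it suffices to compare rectangles. For fixed
  \<open>B\<close> both sides are measures of the radial set, so half-lines suffice, and those
  reduce to the scaling of volume under dilations.\<close>

lemma distr_polar:
  "radial_measure (DIM('a)) \<Otimes>\<^sub>M sphere_measure =
   distr (restrict_space lborel (- {0})) (borel \<Otimes>\<^sub>M restrict_space borel (sphere 0 1))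
     (\<lambda>x::'a::euclidean_space. (norm x, x /\<^sub>R norm x))" (is "_ = ?N")
proof (rule pair_measure_eqI)
  let ?n = "DIM('a)"
  let ?R = "restrict_space lborel (- {0}) :: 'a measure"
  let ?S = "restrict_space borel (sphere 0 1) :: 'a measure"
  let ?T = "\<lambda>x::'a. (norm x, x /\<^sub>R norm x)"
  show "sigma_finite_measure (radial_measure ?n)" by (rule sigma_finite_radial_measure) simp
  show "sigma_finite_measure (sphere_measure :: 'a measure)" by (rule sigma_finite_sphere_measure)
  show "sets (radial_measure ?n \<Otimes>\<^sub>M (sphere_measure :: 'a measure)) = sets ?N"
    by (simp add: sets_sphere_measure cong: sets_pair_measure_cong)
  note m = measurable_polar[where 'a = 'a]
  fix A :: "real set" and B :: "'a set" assume A: "A \<in> sets (radial_measure ?n)" and B: "B \<in> sets sphere_measure"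
  have B': "B \<in> sets ?S" using B by (simp add: sets_sphere_measure)
  then have Bb: "B \<in> sets borel" "B \<subseteq> sphere 0 1" by (auto simp: sets_restrict_space)
  have N: "emeasure ?N (X \<times> B) = emeasure lborel {x. x \<noteq> 0 \<and> norm x \<in> X \<and> x /\<^sub>R norm x \<in> B}"
    if X: "X \<in> sets borel" for X
  proof -
    have "emeasure ?N (X \<times> B) = emeasure ?R (?T -` (X \<times> B) \<inter> space ?R)"
      by (rule emeasure_distr[OF m]) (use X B' in auto)
    also have "\<dots> = emeasure lborel (?T -` (X \<times> B) \<inter> space ?R)"
      by (rule emeasure_restrict_space) (auto simp: space_restrict_space)
    also have "?T -` (X \<times> B) \<inter> space ?R = {x. x \<noteq> 0 \<and> norm x \<in> X \<and> x /\<^sub>R norm x \<in> B}"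
      by (auto simp: space_restrict_space)
    finally show ?thesis .
  qed
  define C where "C = {x \<in> cball 0 1 - {0}. x /\<^sub>R norm x \<in> B}"
  have Cb: "C \<in> sets borel" unfolding C_def using Bb(1) by measurable
  have at: "emeasure ?N ({..a} \<times> B) = emeasure (radial_measure ?n) {..a} * emeasure sphere_measure B" for a
  proof (cases "a > 0")
    case True
    \<comment> \<open>The truncated cone of radius a over \<open>B\<close> is the dilate by a of
      \<open>C\<close>, whose volume defines the surface measure of \<open>B\<close> up to the
      factor n; that factor is supplied by integrating r^(n-1) up to a.\<close>
    have "{x. x \<noteq> 0 \<and> norm x \<in> {..a} \<and> x /\<^sub>R norm x \<in> B} = {x. (1/a) *\<^sub>R x \<in> C}"
      using True by (auto simp: C_def field_simps)
    then have "emeasure ?N ({..a} \<times> B) = ennreal (a ^ ?n) * emeasure lborel C"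
      using N[of "{..a}"] emeasure_lborel_scaleR_image[OF Cb True] by simp
    also have "ennreal (a ^ ?n) = ennreal (a ^ ?n / ?n) * of_nat ?n"
      using True by (simp add: ennreal_of_nat_eq_real_of_nat flip: ennreal_mult)
    finally show ?thesis
      using True emeasure_sphere_measure[OF B] by (simp add: emeasure_radial_measure_atMost C_def mult.assoc)
  next
    case False
    then have "\<not> norm x \<le> a" if "x \<noteq> 0" for x :: 'a
      using that by (smt (verit) zero_less_norm_iff)
    then have e: "{x::'a. x \<noteq> 0 \<and> norm x \<le> a \<and> x /\<^sub>R norm x \<in> B} = {}"
      by blast
    have "emeasure (radial_measure ?n) {..a} = 0"
      using False emeasure_radial_measure_atMost_neg[of a ?n] emeasure_radial_measure_atMost[of ?n 0] by (cases "a = 0") auto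
    then show ?thesis using N[of "{..a}"] e by simp
  qed
  have UB: "UNIV \<times> B \<in> sets (borel \<Otimes>\<^sub>M ?S)" using B' by auto
  have fm: "fst \<in> restrict_space ?N (UNIV \<times> B) \<rightarrow>\<^sub>M borel"
    by (rule measurable_restrict_space1) auto
  have D: "emeasure (distr (restrict_space ?N (UNIV \<times> B)) borel fst) X = emeasure ?N (X \<times> B)" if "X \<in> sets borel" for X :: "real set"
  proof -
    have sp: "space ?N = UNIV \<times> sphere 0 1" by (simp add: space_pair_measure space_restrict_space)
    have "emeasure (distr (restrict_space ?N (UNIV \<times> B)) borel fst) X = emeasure (restrict_space ?N (UNIV \<times> B)) (fst -` X \<inter> space (restrict_space ?N (UNIV \<times> B)))"
      by (rule emeasure_distr[OF fm that])
    also have "fst -` X \<inter> space (restrict_space ?N (UNIV \<times> B)) = X \<times> B"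
      using Bb(2) unfolding space_restrict_space sp by auto
    also have "emeasure (restrict_space ?N (UNIV \<times> B)) (X \<times> B) = emeasure ?N (X \<times> B)"
      by (rule emeasure_restrict_space) (use sets.Int[OF UB sets.top] Bb(2) in auto)
    finally show ?thesis .
  qed
  \<comment> \<open>Both are measures on the line that agree on the intersection-stable generator of
    half-lines and are finite on each of an exhausting sequence.\<close>
  have "distr (restrict_space ?N (UNIV \<times> B)) borel fst = scale_measure (emeasure sphere_measure B) (radial_measure ?n)"
    (is "?D = ?E")
  proof (rule measure_eqI_generator_eq[where \<Omega> = UNIV and E = "range atMost" and A = "\<lambda>i::nat. {..real i}"])
    show "emeasure ?D X = emeasure ?E X" if "X \<in> range atMost" for X
      using that at D by (auto simp: mult.commute)
    show "emeasure ?D {..real i} \<noteq> \<infinity>" for i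
      using finite_measure.emeasure_finite[OF finite_measure_sphere_measure, of B]
      by (simp add: D at emeasure_radial_measure_atMost ennreal_mult_eq_top_iff top_unique)
    show "(\<Union>i::nat. {..real i}) = UNIV" by (auto intro: real_arch_simple)
    show "Int_stable (range (atMost :: real \<Rightarrow> _))" by (auto simp: Int_stable_def)
    have "sets (borel :: real measure) = sigma_sets UNIV (range atMost)"
      by (simp add: borel_eq_atMost)
    then show "sets ?D = sigma_sets UNIV (range atMost)" "sets ?E = sigma_sets UNIV (range atMost)"
      by auto
  qed auto
  then have "emeasure ?D A = emeasure ?E A" by simp
  then show "emeasure (radial_measure ?n) A * emeasure sphere_measure B = emeasure ?N (A \<times> B)"
    using A D by (simp add: mult.commute)
qed

lemma nn_integral_polar:
  fixes F :: "'a::euclidean_space \<Rightarrow> ennreal" and G :: "real \<times> 'a \<Rightarrow> ennreal"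
  assumes [measurable]: "F \<in> borel_measurable borel" "G \<in> borel_measurable (borel \<Otimes>\<^sub>M restrict_space borel (sphere 0 1))"
    and FG: "\<And>x. x \<noteq> 0 \<Longrightarrow> F x = G (norm x, x /\<^sub>R norm x)"
  shows "(\<integral>\<^sup>+x. F x \<partial>lborel) = (\<integral>\<^sup>+z. G z \<partial>(radial_measure (DIM('a)) \<Otimes>\<^sub>M sphere_measure))"
proof -
  note m = measurable_polar[where 'a = 'a]
  have "(\<integral>\<^sup>+z. G z \<partial>(radial_measure (DIM('a)) \<Otimes>\<^sub>M sphere_measure))
     = (\<integral>\<^sup>+x. G (norm x, x /\<^sub>R norm x) \<partial>restrict_space lborel (- {0}))"
    unfolding distr_polar by (rule nn_integral_distr[OF m]) simp
  also have "\<dots> = (\<integral>\<^sup>+x. F x \<partial>restrict_space lborel (- {0}))"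
    by (rule nn_integral_cong) (auto simp: space_restrict_space FG)
  also have "\<dots> = (\<integral>\<^sup>+x. F x * indicator (- {0}) x \<partial>lborel)"
    by (rule nn_integral_restrict_space) auto
  also have "\<dots> = (\<integral>\<^sup>+x. F x \<partial>lborel)"
    by (rule nn_integral_cong_AE) (use AE_lborel_singleton[of "0::'a"] in \<open>eventually_elim, auto\<close>)
  finally show ?thesis by simp
qed

lemma integral_polar:
  fixes F :: "'a::euclidean_space \<Rightarrow> real" and G :: "real \<times> 'a \<Rightarrow> real"
  assumes [measurable]: "F \<in> borel_measurable borel" "G \<in> borel_measurable (borel \<Otimes>\<^sub>M restrict_space borel (sphere 0 1))"
    and FG: "\<And>x. x \<noteq> 0 \<Longrightarrow> F x = G (norm x, x /\<^sub>R norm x)"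
  shows "integrable lborel F \<longleftrightarrow> integrable (radial_measure (DIM('a)) \<Otimes>\<^sub>M sphere_measure) G"
    and "(\<integral>x. F x \<partial>lborel) = (\<integral>z. G z \<partial>(radial_measure (DIM('a)) \<Otimes>\<^sub>M sphere_measure))"
proof -
  let ?R = "restrict_space lborel (- {0}) :: 'a measure"
  let ?T = "\<lambda>x::'a. (norm x, x /\<^sub>R norm x)"
  note m = measurable_polar[where 'a = 'a]
  have ae: "AE x in lborel. F x = indicator (- {0}) x *\<^sub>R F x"
    using AE_lborel_singleton[of "0::'a"] by eventually_elim auto
  have "integrable (radial_measure (DIM('a)) \<Otimes>\<^sub>M sphere_measure) G \<longleftrightarrow> integrable ?R (\<lambda>x. G (?T x))"
    unfolding distr_polar by (rule integrable_distr_eq[OF m]) simp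
  also have "\<dots> \<longleftrightarrow> integrable ?R F"
    by (rule Bochner_Integration.integrable_cong) (auto simp: space_restrict_space FG)
  also have "\<dots> \<longleftrightarrow> integrable lborel (\<lambda>x. indicator (- {0}) x *\<^sub>R F x)"
    by (rule integrable_restrict_space) simp
  also have "\<dots> \<longleftrightarrow> integrable lborel F"
    by (rule integrable_cong_AE) (use ae in auto)
  finally show "integrable lborel F \<longleftrightarrow> integrable (radial_measure (DIM('a)) \<Otimes>\<^sub>M sphere_measure) G" by simp
  have "(\<integral>z. G z \<partial>(radial_measure (DIM('a)) \<Otimes>\<^sub>M sphere_measure)) = (\<integral>x. G (?T x) \<partial>?R)"
    unfolding distr_polar by (rule integral_distr[OF m]) simp
  also have "\<dots> = (\<integral>x. F x \<partial>?R)"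
    by (rule Bochner_Integration.integral_cong) (auto simp: space_restrict_space FG)
  also have "\<dots> = (\<integral>x. indicator (- {0}) x *\<^sub>R F x \<partial>lborel)"
    by (rule integral_restrict_space) simp
  also have "\<dots> = (\<integral>x. F x \<partial>lborel)"
    by (rule integral_cong_AE) (use ae in auto)
  finally show "(\<integral>x. F x \<partial>lborel) = (\<integral>z. G z \<partial>(radial_measure (DIM('a)) \<Otimes>\<^sub>M sphere_measure))" by simp
qed

lemma integral_radial_measure:
  fixes f :: "real \<Rightarrow> real"
  assumes [measurable]: "f \<in> borel_measurable borel" and n: "n > 0"
  shows "integrable (radial_measure n) f \<longleftrightarrow> set_integrable lborel {0<..} (\<lambda>r. r powr (real n - 1) * f r)"
    and "(\<integral>r. f r \<partial>radial_measure n) = (LINT r:{0<..}|lborel. r powr (real n - 1) * f r)"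
proof -
  have pw: "r powr (real n - 1) = r ^ (n - 1)" if "r > 0" for r
    using that n powr_realpow[of r "n - 1"] by (simp add: of_nat_diff Suc_leI)
  have e: "(\<lambda>r. (indicator {0<..} r * r ^ (n - 1)) *\<^sub>R f r) = (\<lambda>r. indicator {0<..} r *\<^sub>R (r powr (real n - 1) * f r))"
    by (auto simp: fun_eq_iff indicator_def pw)
  have d: "radial_measure n = density lborel (\<lambda>r. ennreal (indicator {0<..} r * r ^ (n - 1)))"
    unfolding radial_measure_def by (intro arg_cong2[where f=density] ext) (auto simp: indicator_def)
  show "integrable (radial_measure n) f \<longleftrightarrow> set_integrable lborel {0<..} (\<lambda>r. r powr (real n - 1) * f r)"
    unfolding d set_integrable_def e[symmetric] by (rule integrable_density) (auto simp: indicator_def)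
  show "(\<integral>r. f r \<partial>radial_measure n) = (LINT r:{0<..}|lborel. r powr (real n - 1) * f r)"
    unfolding d set_lebesgue_integral_def e[symmetric] by (rule integral_density) (auto simp: indicator_def)
qed

lemma (in pair_sigma_finite) integral_times:
  fixes f :: "'a \<Rightarrow> real" and g :: "'b \<Rightarrow> real"
  assumes f: "integrable M1 f" and g: "integrable M2 g"
  shows "integrable (M1 \<Otimes>\<^sub>M M2) (\<lambda>z. f (fst z) * g (snd z))"
    and "(\<integral>z. f (fst z) * g (snd z) \<partial>(M1 \<Otimes>\<^sub>M M2)) = integral\<^sup>L M1 f * integral\<^sup>L M2 g"
proof -
  have [measurable]: "f \<in> borel_measurable M1" "g \<in> borel_measurable M2" using f g by auto
  show i: "integrable (M1 \<Otimes>\<^sub>M M2) (\<lambda>z. f (fst z) * g (snd z))"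
    by (rule Fubini_integrable) (use f g in \<open>auto simp: abs_mult\<close>)
  show "(\<integral>z. f (fst z) * g (snd z) \<partial>(M1 \<Otimes>\<^sub>M M2)) = integral\<^sup>L M1 f * integral\<^sup>L M2 g"
    using integral_fst'[OF i] by simp
qed

text \<open>Since w(x) = |x|^d w(x/|x|), the integrand splits into a function of the radius times a
  function of the direction; r^d joins the Jacobian r^(n-1) in the radial weight.\<close>

lemma integral_polar_homogeneous:
  fixes w :: "'a::euclidean_space \<Rightarrow> real" and d :: real
  assumes [measurable]: "w \<in> borel_measurable borel" "h \<in> borel_measurable borel"
    and hom: "\<And>t x. t > 0 \<Longrightarrow> x \<noteq> 0 \<Longrightarrow> w (t *\<^sub>R x) = t powr d * w x"
    and w: "integrable sphere_measure w"
    and h: "set_integrable lborel {0<..} (\<lambda>r. r powr (real DIM('a) + d - 1) * h r)"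
  shows "integrable lborel (\<lambda>x. h (norm x) * w x)"
    and "(\<integral>x. h (norm x) * w x \<partial>lborel) = (LINT r:{0<..}|lborel. r powr (real DIM('a) + d - 1) * h r) * (\<integral>x. w x \<partial>sphere_measure)"
proof -
  let ?g = "\<lambda>r. r powr d * h r"
  let ?G = "\<lambda>z::real \<times> 'a. ?g (fst z) * w (snd z)"
  interpret R: sigma_finite_measure "radial_measure (DIM('a))" by (rule sigma_finite_radial_measure) simp
  interpret S: sigma_finite_measure "sphere_measure :: 'a measure" by (rule sigma_finite_sphere_measure)
  interpret P: pair_sigma_finite "radial_measure (DIM('a))" "sphere_measure :: 'a measure" ..
  have p: "r powr (real DIM('a) - 1) * ?g r = r powr (real DIM('a) + d - 1) * h r" for r
    by (simp add: powr_add[symmetric] algebra_simps flip: mult.assoc)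
  have g: "integrable (radial_measure (DIM('a))) ?g"
    by (subst integral_radial_measure(1)) (use h in \<open>auto simp: p\<close>)
  have gi: "(\<integral>r. ?g r \<partial>radial_measure (DIM('a))) = (LINT r:{0<..}|lborel. r powr (real DIM('a) + d - 1) * h r)"
    by (subst integral_radial_measure(2)) (auto simp: p)
  have [measurable]: "w \<in> borel_measurable (restrict_space borel (sphere 0 1))"
    by (rule measurable_restrict_space1) simp
  have FG: "h (norm x) * w x = ?G (norm x, x /\<^sub>R norm x)" if "x \<noteq> 0" for x
    using hom[of "norm x" "x /\<^sub>R norm x"] that by simp
  have Gm: "?G \<in> borel_measurable (borel \<Otimes>\<^sub>M restrict_space borel (sphere 0 1))" by measurable
  note pol = integral_polar[of "\<lambda>x. h (norm x) * w x" ?G, OF _ Gm FG]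
  show "integrable lborel (\<lambda>x. h (norm x) * w x)"
    by (subst pol(1)) (use P.integral_times(1)[OF g w] in auto)
  show "(\<integral>x. h (norm x) * w x \<partial>lborel) = (LINT r:{0<..}|lborel. r powr (real DIM('a) + d - 1) * h r) * (\<integral>x. w x \<partial>sphere_measure)"
    by (subst pol(2)) (use P.integral_times(2)[OF g w] gi in auto)
qed

text \<open>Fubini read backwards: integrability on the whole space gives it on almost every sphere,
  and by homogeneity one sphere is as good as another. Thus powers with negative exponent, singular
  on a great sphere, can be checked in Cartesian coordinates.\<close>

lemma integrable_sphere_homogeneous:
  fixes w :: "'a::euclidean_space \<Rightarrow> real" and d :: real
  assumes [measurable]: "w \<in> borel_measurable borel" and nn: "\<And>x. w x \<ge> 0"
    and hom: "\<And>t x. t > 0 \<Longrightarrow> x \<noteq> 0 \<Longrightarrow> w (t *\<^sub>R x) = t powr d * w x"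
    and i: "integrable lborel (\<lambda>x. exp (- (norm x)\<^sup>2 / 2) * w x)"
  shows "integrable sphere_measure w"
proof -
  let ?g = "\<lambda>r::real. r powr d * exp (- r\<^sup>2 / 2)"
  let ?G = "\<lambda>z::real \<times> 'a. ?g (fst z) * w (snd z)"
  interpret R: sigma_finite_measure "radial_measure (DIM('a))" by (rule sigma_finite_radial_measure) simp
  interpret S: sigma_finite_measure "sphere_measure :: 'a measure" by (rule sigma_finite_sphere_measure)
  interpret P: pair_sigma_finite "radial_measure (DIM('a))" "sphere_measure :: 'a measure" ..
  have [measurable]: "w \<in> borel_measurable (restrict_space borel (sphere 0 1))"
    by (rule measurable_restrict_space1) simp
  have FG: "exp (- (norm x)\<^sup>2 / 2) * w x = ?G (norm x, x /\<^sub>R norm x)" if "x \<noteq> 0" for x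
    using hom[of "norm x" "x /\<^sub>R norm x"] that by simp
  have Gm: "?G \<in> borel_measurable (borel \<Otimes>\<^sub>M restrict_space borel (sphere 0 1))" by measurable
  have "integrable (radial_measure (DIM('a)) \<Otimes>\<^sub>M sphere_measure) ?G"
    using i by (subst integral_polar(1)[of "\<lambda>x. exp (- (norm x)\<^sup>2 / 2) * w x" ?G, OF _ Gm FG, symmetric]) auto
  then have "AE r in radial_measure (DIM('a)). integrable sphere_measure (\<lambda>\<theta>. ?g r * w \<theta>)"
    using P.AE_integrable_fst[of "\<lambda>r \<theta>. ?g r * w \<theta>"] by (simp add: case_prod_unfold)
  \<comment> \<open>The constant \<open>?g r\<close> vanishes only for r = 0. If almost every radius
    were 0, the interval (0, 1) would be a Lebesgue null set.\<close>
  then consider "AE r in radial_measure (DIM('a)). r = 0" | "integrable sphere_measure w"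
    by auto
  then show ?thesis
  proof cases
    case 1
    then have "AE r in lborel. r \<notin> {0<..<1::real}"
      unfolding radial_measure_def by (subst (asm) AE_density) (auto simp: indicator_def elim!: eventually_mono)
    then show ?thesis using not_AE_interval[of 0 "1"] by simp
  qed
qed

section \<open>Gaussian integrals of zonal monomials\<close>

text \<open>Uniqueness of the translation invariant measure: with \<open>V\<close> the volume of the unit ball \<open>B\<close>,
  \<open>V \<cdot> \<integral>f(Tx)dx = \<integral>\<integral>f(Tx+y)1\<^sub>B(y) = \<integral>\<integral>f(y)1\<^sub>B(y-Tx) = V \<cdot> \<integral>f(y)dy\<close>.\<close>

lemma nn_integral_orthogonal:
  fixes T :: "'a::euclidean_space \<Rightarrow> 'a" and f :: "'a \<Rightarrow> ennreal"
  assumes T: "orthogonal_transformation T" and f [measurable]: "f \<in> borel_measurable borel"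
  shows "(\<integral>\<^sup>+x. f (T x) \<partial>lborel) = (\<integral>\<^sup>+x. f x \<partial>lborel)"
proof -
  have Tm [measurable]: "T \<in> borel \<rightarrow>\<^sub>M borel"
    using T by (intro borel_measurable_continuous_onI linear_continuous_on linear_conv_bounded_linear[THEN iffD1] orthogonal_transformation_linear)
  have lin: "linear T" using T by (rule orthogonal_transformation_linear)
  obtain S where S: "\<And>y. T (S y) = y" "\<And>y. S (T y) = y"
    using orthogonal_transformation_bij[OF T] by (metis bij_inv_eq_iff)
  have nT: "norm (T x) = norm x" for x using T by (rule orthogonal_transformation_norm)
  define g :: "'a \<Rightarrow> ennreal" where "g = indicator (ball 0 1)"
  define V where "V = (\<integral>\<^sup>+y. g y \<partial>lborel)"
  have [measurable]: "g \<in> borel_measurable borel" unfolding g_def by (intro borel_measurable_indicator) simp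
  have V: "V = emeasure lborel (ball (0::'a) 1)" unfolding V_def g_def by simp
  have tr: "(\<integral>\<^sup>+x. h (c + x) \<partial>lborel) = (\<integral>\<^sup>+x. h x \<partial>lborel)" if [measurable]: "h \<in> borel_measurable borel" for h :: "'a \<Rightarrow> ennreal" and c
    by (subst (2) lborel_distr_plus[symmetric, of c]) (simp add: nn_integral_distr)
  have g1: "g (y - T x) = g (- S y + x)" for x y
  proof -
    have "y - T x = T (S y - x)" using lin by (simp add: linear_diff S)
    then have "norm (y - T x) = norm (- S y + x)" by (simp add: nT norm_minus_commute)
    then show ?thesis by (simp add: g_def indicator_def)
  qed
  have "(\<integral>\<^sup>+x. f (T x) \<partial>lborel) * V = (\<integral>\<^sup>+y. (\<integral>\<^sup>+x. f (T x) \<partial>lborel) * g y \<partial>lborel)"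
    unfolding V_def by (simp add: nn_integral_cmult)
  also have "\<dots> = (\<integral>\<^sup>+y. (\<integral>\<^sup>+x. f (T x + y) * g y \<partial>lborel) \<partial>lborel)"
  proof (rule nn_integral_cong)
    fix y
    have "(\<integral>\<^sup>+x. f (T x) \<partial>lborel) = (\<integral>\<^sup>+x. f (T (S y + x)) \<partial>lborel)"
      by (rule tr[symmetric]) simp
    also have "\<dots> = (\<integral>\<^sup>+x. f (T x + y) \<partial>lborel)"
      using lin by (simp add: linear_add S add.commute)
    finally show "(\<integral>\<^sup>+x. f (T x) \<partial>lborel) * g y = (\<integral>\<^sup>+x. f (T x + y) * g y \<partial>lborel)"
      by (simp add: nn_integral_multc)
  qed
  also have "\<dots> = (\<integral>\<^sup>+x. (\<integral>\<^sup>+y. f (T x + y) * g y \<partial>lborel) \<partial>lborel)"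
    by (rule lborel_pair.Fubini') simp
  also have "\<dots> = (\<integral>\<^sup>+x. (\<integral>\<^sup>+y. f y * g (y - T x) \<partial>lborel) \<partial>lborel)"
  proof (rule nn_integral_cong)
    fix x show "(\<integral>\<^sup>+y. f (T x + y) * g y \<partial>lborel) = (\<integral>\<^sup>+y. f y * g (y - T x) \<partial>lborel)"
      using tr[of "\<lambda>y. f y * g (y - T x)" "T x"] by simp
  qed
  also have "\<dots> = (\<integral>\<^sup>+y. (\<integral>\<^sup>+x. f y * g (y - T x) \<partial>lborel) \<partial>lborel)"
    by (rule lborel_pair.Fubini') simp
  also have "\<dots> = (\<integral>\<^sup>+y. f y * V \<partial>lborel)"
    unfolding g1 V_def by (subst nn_integral_cmult, simp, subst tr) simp_all
  also have "\<dots> = (\<integral>\<^sup>+y. f y \<partial>lborel) * V" by (simp add: nn_integral_multc)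
  finally have "(\<integral>\<^sup>+x. f (T x) \<partial>lborel) * V = (\<integral>\<^sup>+y. f y \<partial>lborel) * V" .
  moreover have "V \<noteq> 0" "V \<noteq> top"
    unfolding V using emeasure_lborel_ball_finite[of "0::'a" 1] content_ball_pos[of 1 "0::'a"]
    by (auto simp: measure_def)
  ultimately show ?thesis by (metis ennreal_mult_cancel_left mult.commute)
qed

lemma lborel_distr_orthogonal:
  fixes T :: "'a::euclidean_space \<Rightarrow> 'a"
  assumes T: "orthogonal_transformation T"
  shows "distr lborel borel T = lborel"
proof (rule measure_eqI)
  have Tm [measurable]: "T \<in> borel \<rightarrow>\<^sub>M borel"
    using T by (intro borel_measurable_continuous_onI linear_continuous_on linear_conv_bounded_linear[THEN iffD1] orthogonal_transformation_linear)
  fix A :: "'a set" assume "A \<in> sets (distr lborel borel T)"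
  then have [measurable]: "A \<in> sets borel" by simp
  have "emeasure (distr lborel borel T) A = (\<integral>\<^sup>+x. indicator A x \<partial>distr lborel borel T)"
    by simp
  also have "\<dots> = (\<integral>\<^sup>+x. indicator A (T x) \<partial>lborel)" by (rule nn_integral_distr) auto
  also have "\<dots> = (\<integral>\<^sup>+x. indicator A x \<partial>lborel)" by (rule nn_integral_orthogonal[OF T]) simp
  finally show "emeasure (distr lborel borel T) A = emeasure lborel A" by simp
qed simp

text \<open>The reflection in the hyperplane orthogonal to a - b. Fixing that hyperplane pointwise
  is what allows a second reflection to preserve what a first one has achieved. If a = b, division
  by zero yields 0 and the map is the identity.\<close>

lemma householder:
  fixes a b :: "'a::euclidean_space"
  assumes "norm a = norm b"
  shows "\<exists>T. orthogonal_transformation T \<and> T a = b \<and> (\<forall>x. x \<bullet> (a - b) = 0 \<longrightarrow> T x = x)"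
proof (intro exI conjI allI impI)
  define v where "v = a - b"
  define T where "T x = x - (2 * (x \<bullet> v) / (v \<bullet> v)) *\<^sub>R v" for x
  have ab: "a \<bullet> a = b \<bullet> b" using assms by (simp add: dot_square_norm)
  show "orthogonal_transformation T"
    unfolding orthogonal_transformation_def
  proof
    show "linear T"
      by (rule linearI) (auto simp: T_def inner_add_left add_divide_distrib algebra_simps)
    show "\<forall>x y. T x \<bullet> T y = x \<bullet> y"
      by (cases "v = 0") (auto simp: T_def inner_diff_left inner_diff_right inner_commute power2_eq_square field_simps)
  qed
  show "T a = b"
  proof (cases "v = 0")
    case False
    then have "v \<bullet> v \<noteq> 0" by simp
    moreover have "v \<bullet> v = 2 * (a \<bullet> v)"
      using ab by (simp add: v_def inner_diff_left inner_diff_right inner_commute)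
    ultimately have "2 * (a \<bullet> v) / (v \<bullet> v) = 1" by simp
    then show ?thesis unfolding T_def by (simp only:) (simp add: v_def)
  qed (simp add: T_def v_def)
  show "T x = x" if "x \<bullet> (a - b) = 0" for x
    using that by (simp add: T_def v_def)
qed

text \<open>Two reflections: the first moves y to e, the second moves the image of w to f. The
  second fixes e because e is orthogonal to both of these vectors.\<close>

lemma orthogonal_transformation_pair_exists:
  fixes y w e f :: "'a::euclidean_space"
  assumes "norm y = 1" "norm w = 1" "y \<bullet> w = 0" "norm e = 1" "norm f = 1" "e \<bullet> f = 0"
  obtains T :: "'a \<Rightarrow> 'a" where "orthogonal_transformation T" "T y = e" "T w = f"
proof -
  obtain T1 :: "'a \<Rightarrow> 'a" where T1: "orthogonal_transformation T1" "T1 y = e"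
    using householder[of y e] assms by (metis (no_types))
  have n: "norm (T1 w) = norm f" using T1(1) assms by (simp add: orthogonal_transformation_norm)
  have o: "e \<bullet> T1 w = 0" using T1 assms by (metis orthogonal_transformation_def)
  obtain T2 :: "'a \<Rightarrow> 'a" where T2: "orthogonal_transformation T2" "T2 (T1 w) = f" "\<forall>x. x \<bullet> (T1 w - f) = 0 \<longrightarrow> T2 x = x"
    using householder[OF n] by blast
  have "T2 e = e" using o assms T2(3) by (simp add: inner_diff_right)
  then show ?thesis
    using orthogonal_transformation_compose[OF T2(1) T1(1)] T1(2) T2(2) by (intro that[of "T2 \<circ> T1"]) simp_all
qed

section \<open>Gaussian integrals in coordinates\<close>

lemma integral_lborel_prod:
  fixes f :: "'a::euclidean_space \<Rightarrow> real \<Rightarrow> real"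
  assumes f: "\<And>b. b \<in> Basis \<Longrightarrow> integrable lborel (f b)"
  shows "integrable lborel (\<lambda>x::'a. \<Prod>b\<in>Basis. f b (x \<bullet> b))"
    and "integral\<^sup>L lborel (\<lambda>x::'a. \<Prod>b\<in>Basis. f b (x \<bullet> b)) = (\<Prod>b\<in>Basis. integral\<^sup>L lborel (f b))"
proof -
  interpret product_sigma_finite "\<lambda>_::'a. lborel :: real measure" by standard
  have fm [measurable]: "f b \<in> borel_measurable borel" if "b \<in> Basis" for b
    using borel_measurable_integrable[OF f[OF that]] by simp
  have m: "(\<lambda>g::'a \<Rightarrow> real. \<Sum>b\<in>Basis. g b *\<^sub>R b) \<in> (\<Pi>\<^sub>M b\<in>Basis. lborel) \<rightarrow>\<^sub>M borel"
    by measurable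
  have g: "(\<lambda>x::'a. \<Prod>b\<in>Basis. f b (x \<bullet> b)) \<in> borel_measurable borel"
    by measurable
  have e: "(\<Prod>b\<in>Basis. f b ((\<Sum>c\<in>Basis. g c *\<^sub>R c) \<bullet> b)) = (\<Prod>b\<in>Basis. f b (g b))" for g :: "'a \<Rightarrow> real"
    by (rule prod.cong) auto
  show "integrable lborel (\<lambda>x::'a. \<Prod>b\<in>Basis. f b (x \<bullet> b))"
    unfolding lborel_eq[where 'a='a] by (subst integrable_distr_eq[OF m g]) (use product_integrable_prod[OF _ f] e in auto)
  show "integral\<^sup>L lborel (\<lambda>x::'a. \<Prod>b\<in>Basis. f b (x \<bullet> b)) = (\<Prod>b\<in>Basis. integral\<^sup>L lborel (f b))"
    unfolding lborel_eq[where 'a='a] by (subst integral_distr[OF m g]) (use product_integral_prod[OF _ f] e in auto)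
qed

lemma integral_abs_powr_power_gauss:
  assumes r: "r > -1"
  shows "integrable lborel (\<lambda>t::real. \<bar>t\<bar> powr r * t ^ k * exp (- t\<^sup>2 / 2))"
    and "(\<integral>t. \<bar>t\<bar> powr r * t ^ k * exp (- t\<^sup>2 / 2) \<partial>lborel) = (if even k then 2 * gauss_moment (r + k + 1) else 0)"
proof -
  let ?g = "\<lambda>t::real. \<bar>t\<bar> powr r * t ^ k * exp (- t\<^sup>2 / 2)"
  have i: "integrable lborel (\<lambda>t::real. \<bar>t\<bar> powr (r + k) * exp (- t\<^sup>2 / 2))"
    using r by (intro integrable_abs_powr_gauss) auto
  have e: "\<bar>t\<bar> powr r * \<bar>t\<bar> ^ k = \<bar>t\<bar> powr (r + k)" for t :: real
    by (cases "t = 0") (auto simp: powr_add powr_realpow)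
  show ig: "integrable lborel ?g"
    by (rule Bochner_Integration.integrable_bound[OF i]) (auto simp: abs_mult power_abs e)
  show "integral\<^sup>L lborel ?g = (if even k then 2 * gauss_moment (r + k + 1) else 0)"
  proof (cases "even k")
    case True
    then have "?g = (\<lambda>t. \<bar>t\<bar> powr (r + k) * exp (- t\<^sup>2 / 2))"
      by (auto simp: fun_eq_iff e[symmetric] power_even_abs)
    then show ?thesis using integrable_abs_powr_gauss(2)[of "r + k"] r True by simp
  next
    case False
    have "integral\<^sup>L lborel ?g = (\<integral>t. ?g (- t) \<partial>lborel)"
      using lborel_integral_real_affine[of "-1" ?g 0] by simp
    also have "\<dots> = - integral\<^sup>L lborel ?g" using False by (simp add: power_minus_odd)
    finally show ?thesis using False by simp
  qed
qed

lemma integral_power_gauss: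
  shows "integrable lborel (\<lambda>t::real. t ^ k * exp (- t\<^sup>2 / 2))"
    and "(\<integral>t. t ^ k * exp (- t\<^sup>2 / 2) \<partial>(lborel :: real measure)) = (if even k then 2 * gauss_moment (k + 1) else 0)"
proof -
  \<comment> \<open>\<open>0 powr 0\<close> is 0, so the integrands differ at the origin.\<close>
  have ae: "AE t::real in lborel. \<bar>t\<bar> powr 0 * t ^ k * exp (- t\<^sup>2 / 2) = t ^ k * exp (- t\<^sup>2 / 2)"
    using AE_lborel_singleton[of "0::real"] by eventually_elim auto
  show "integrable lborel (\<lambda>t::real. t ^ k * exp (- t\<^sup>2 / 2))"
    using integral_abs_powr_power_gauss(1)[of 0 k] by (rule integrable_cong_AE_imp) (use ae in auto)
  have "(\<integral>t. t ^ k * exp (- t\<^sup>2 / 2) \<partial>(lborel :: real measure)) = (\<integral>t. \<bar>t\<bar> powr 0 * t ^ k * exp (- t\<^sup>2 / 2) \<partial>lborel)"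
    by (rule integral_cong_AE) (use ae in \<open>auto elim!: eventually_mono\<close>)
  then show "(\<integral>t. t ^ k * exp (- t\<^sup>2 / 2) \<partial>(lborel :: real measure)) = (if even k then 2 * gauss_moment (k + 1) else 0)"
    using integral_abs_powr_power_gauss(2)[of 0 k] by (simp add: add.commute)
qed

text \<open>Even normal moments are (2i-1)!! times the total mass, and (2i-1)!!/(2i)! = 1/(2^i i!).
  The direction orthogonal to \<open>y\<close> thereby contributes an exponential series.\<close>

lemma gauss_moment_even: "2 * gauss_moment (2 * real i + 1) / fact (2 * i) = 2 * gauss_moment 1 * ((1/2) ^ i / fact i)"
proof (induction i)
  case (Suc i)
  have "gauss_moment (2 * real (Suc i) + 1) = (2 * real i + 1) * gauss_moment (2 * real i + 1)"
    using gauss_moment_rec[of "2 * real i + 1"] by (simp add: algebra_simps)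
  moreover have "(fact (2 * Suc i) :: real) = 2 * (real i + 1) * (2 * real i + 1) * fact (2 * i)"
    by (simp add: algebra_simps)
  ultimately have "2 * gauss_moment (2 * real (Suc i) + 1) / fact (2 * Suc i)
     = (2 * gauss_moment (2 * real i + 1) / fact (2 * i)) * (1 / (2 * (real i + 1)))"
    by (simp add: divide_simps add_nonneg_eq_0_iff)
  also have "\<dots> = 2 * gauss_moment 1 * ((1/2) ^ Suc i / fact (Suc i))"
    unfolding Suc.IH by (simp add: divide_simps)
  finally show ?case .
qed simp

lemma sum_atMost_even:
  fixes f :: "nat \<Rightarrow> 'a::comm_monoid_add"
  assumes "\<And>j. odd j \<Longrightarrow> f j = 0"
  shows "(\<Sum>j\<le>2 * m. f j) = (\<Sum>i\<le>m. f (2 * i))"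
  using assms by (induction m) auto

text \<open>A rotation carries y and w to two coordinate vectors, and the Gaussian then factors into
  one-dimensional integrals; the n - 2 remaining coordinates each contribute the total mass.\<close>

lemma integral_gauss_pair:
  fixes y w :: "'a::euclidean_space" and k l :: nat
  assumes n: "DIM('a) > 1" and r: "r > -1" and yw: "norm y = 1" "norm w = 1" "y \<bullet> w = 0"
  defines "G \<equiv> \<lambda>x. exp (- (norm x)\<^sup>2 / 2) * (\<bar>y \<bullet> x\<bar> powr r * (y \<bullet> x) ^ k * (w \<bullet> x) ^ l)"
  shows "integrable lborel G"
    and "integral\<^sup>L lborel G = (if even k then 2 * gauss_moment (r + k + 1) else 0) *
            (if even l then 2 * gauss_moment (l + 1) else 0) * (2 * gauss_moment 1) ^ (DIM('a) - 2)"
proof -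
  have "card (Basis :: 'a set) > 1" using n by simp
  then obtain e f :: "'a::euclidean_space" where ef: "e \<in> Basis" "f \<in> Basis" "e \<noteq> f"
    by (metis One_nat_def card_le_Suc0_iff_eq finite_Basis not_less)
  have "norm e = 1" "norm f = 1" "e \<bullet> f = 0" using ef by (auto simp: inner_Basis)
  then obtain T where T: "orthogonal_transformation T" "T y = e" "T w = f"
    by (rule orthogonal_transformation_pair_exists[OF yw])
  have Tm [measurable]: "T \<in> borel \<rightarrow>\<^sub>M borel"
    using T(1) by (intro borel_measurable_continuous_onI linear_continuous_on linear_conv_bounded_linear[THEN iffD1] orthogonal_transformation_linear)
  define h where "h b = (\<lambda>t::real. if b = e then \<bar>t\<bar> powr r * t ^ k * exp (- t\<^sup>2 / 2)
      else if b = f then t ^ l * exp (- t\<^sup>2 / 2) else exp (- t\<^sup>2 / 2))" for b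
  have hi: "integrable lborel (h b)" for b
    unfolding h_def using integral_abs_powr_power_gauss(1)[OF r, of k] integral_power_gauss(1)[of l] integral_power_gauss(1)[of 0]
    by (cases "b = e"; cases "b = f") simp_all
  have B: "(Basis :: 'a set) = insert e (insert f (Basis - {e, f}))" using ef by auto
  have split: "(\<Prod>b\<in>Basis. F b) = F e * (F f * (\<Prod>b\<in>Basis - {e, f}. F b))" for F :: "'a \<Rightarrow> real"
    by (subst B, subst prod.insert) (use ef in \<open>auto simp: prod.insert\<close>)
  have GT: "G x = (\<Prod>b\<in>Basis. h b (T x \<bullet> b))" for x
  proof -
    have "norm x = norm (T x)" using T(1) by (simp add: orthogonal_transformation_norm)
    then have "exp (- (norm x)\<^sup>2 / 2) = exp (- (norm (T x))\<^sup>2 / 2)" by simp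
    also have "\<dots> = exp (\<Sum>b\<in>Basis. - (T x \<bullet> b)\<^sup>2 / 2)"
      unfolding power2_norm_eq_inner by (subst euclidean_inner) (simp add: power2_eq_square sum_negf sum_divide_distrib)
    also have "\<dots> = (\<Prod>b\<in>Basis. exp (- (T x \<bullet> b)\<^sup>2 / 2))" by (rule exp_sum) simp
    finally have 1: "exp (- (norm x)\<^sup>2 / 2) = (\<Prod>b\<in>Basis. exp (- (T x \<bullet> b)\<^sup>2 / 2))" .
    have "y \<bullet> x = T x \<bullet> e" "w \<bullet> x = T x \<bullet> f"
      using T by (metis inner_commute orthogonal_transformation_def)+
    then show ?thesis
      unfolding G_def 1 split using ef by (auto simp: h_def intro!: prod.cong)
  qed
  have G: "G = (\<lambda>x. (\<lambda>x. \<Prod>b\<in>Basis. h b (x \<bullet> b)) (T x))" using GT by auto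
  have hm: "(\<lambda>x. \<Prod>b\<in>Basis. h b (x \<bullet> b)) \<in> borel_measurable (borel :: 'a measure)"
    using hi by (intro borel_measurable_prod) (auto intro!: measurable_compose[OF _ borel_measurable_integrable[OF hi, simplified]])
  note P = integral_lborel_prod[of h, OF hi]
  show "integrable lborel G"
    unfolding G by (subst integrable_distr_eq[where g = T and N = borel, symmetric])
      (use hm P(1) lborel_distr_orthogonal[OF T(1)] in auto)
  have "integral\<^sup>L lborel G = integral\<^sup>L lborel (\<lambda>x. \<Prod>b\<in>Basis. h b (x \<bullet> b))"
    unfolding G by (subst integral_distr[where g = T and N = borel, symmetric])
      (use hm lborel_distr_orthogonal[OF T(1)] in auto)
  also have "\<dots> = (\<Prod>b\<in>Basis. integral\<^sup>L lborel (h b))" by (rule P(2))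
  also have "\<dots> = integral\<^sup>L lborel (h e) * (integral\<^sup>L lborel (h f) * (\<Prod>b\<in>Basis - {e, f}. integral\<^sup>L lborel (h b)))"
    by (rule split)
  also have "(\<Prod>b\<in>Basis - {e, f}. integral\<^sup>L lborel (h b)) = (2 * gauss_moment 1) ^ (DIM('a) - 2)"
  proof -
    have "card (Basis - {e, f}) = DIM('a) - 2"
      using ef by (subst card_Diff_subset) auto
    moreover have "(\<Prod>b\<in>Basis - {e, f}. integral\<^sup>L lborel (h b)) = (\<Prod>b\<in>Basis - {e, f}. 2 * gauss_moment 1)"
      using integral_power_gauss(2)[of 0] by (intro prod.cong) (auto simp: h_def)
    ultimately show ?thesis by (simp only: prod_constant)
  qed
  finally show "integral\<^sup>L lborel G = (if even k then 2 * gauss_moment (r + k + 1) else 0) *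
            (if even l then 2 * gauss_moment (l + 1) else 0) * (2 * gauss_moment 1) ^ (DIM('a) - 2)"
    using integral_abs_powr_power_gauss(2)[OF r, of k] integral_power_gauss(2)[of l] ef by (simp add: h_def)
qed

text \<open>The factorial makes the Laplacian lower the index m by one with factor |b|^2, without
  further coefficients, and turns generating series in m into exponentials.\<close>

definition zonal :: "'a::real_inner \<Rightarrow> nat \<Rightarrow> 'a \<Rightarrow> real" where
  "zonal b m x = (b \<bullet> x) ^ (2 * m) / fact (2 * m)"

lemma orthogonal_unit_exists:
  fixes b y :: "'a::euclidean_space"
  assumes "DIM('a) > 1" "norm y = 1"
  obtains w where "norm w = 1" "y \<bullet> w = 0" "b = (b \<bullet> y) *\<^sub>R y + (b \<bullet> w) *\<^sub>R w"
proof (cases "b - (b \<bullet> y) *\<^sub>R y = 0")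
  case True
  obtain w :: 'a where "w \<noteq> 0" "orthogonal y w"
    using orthogonal_to_vector_exists[of y] assms(1) by auto
  then have "norm (w /\<^sub>R norm w) = 1" "y \<bullet> (w /\<^sub>R norm w) = 0" "b \<bullet> w = 0"
    using True by (auto simp: orthogonal_def) (metis inner_scaleR_left mult_zero_right eq_iff_diff_eq_0)
  then show ?thesis using True by (intro that[of "w /\<^sub>R norm w"]) auto
next
  case False
  define v where "v = b - (b \<bullet> y) *\<^sub>R y"
  have yy: "y \<bullet> y = 1" using assms by (simp add: dot_square_norm)
  have yv: "y \<bullet> v = 0" by (simp add: v_def inner_diff_right yy inner_commute)
  have "b \<bullet> v = v \<bullet> v" using yv by (simp add: v_def inner_diff_left inner_diff_right yy inner_commute)
  then have bv: "b \<bullet> v = (norm v)\<^sup>2" by (simp add: power2_norm_eq_inner)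
  have "norm v \<noteq> 0" using False by (simp add: v_def)
  then have "inverse (norm v) * ((norm v)\<^sup>2 * inverse (norm v)) = 1" using False
    by (simp add: power2_eq_square field_simps)
  then have "(b \<bullet> (v /\<^sub>R norm v)) *\<^sub>R (v /\<^sub>R norm v) = v"
    by (simp add: bv mult.assoc)
  then show ?thesis
    using False yv by (intro that[of "v /\<^sub>R norm v"]) (auto simp: v_def)
qed

text \<open>Splitting b along y and an orthogonal w and expanding the power gives a convolution of
  two series: an exponential from w, and a series \<open>A\<close> of moments from y. Kummer's
  transformation brings it to coefficients prod (r - 2s), with the rotation-invariant factor
  exp(|b|^2/2) left outside.\<close>

lemma integral_gauss_zonal:
  fixes y b :: "'a::euclidean_space" and m :: nat
  assumes n: "DIM('a) > 1" and r: "r > -1" and y: "norm y = 1"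
  defines "G \<equiv> \<lambda>x. exp (- (norm x)\<^sup>2 / 2) * (\<bar>y \<bullet> x\<bar> powr r * zonal b m x)"
  shows "integrable lborel G"
    and "integral\<^sup>L lborel G = (2 * gauss_moment 1) ^ (DIM('a) - 1) * (2 * gauss_moment (r + 1)) *
       (\<Sum>i\<le>m. ((norm b)\<^sup>2 / 2) ^ i / fact i * (\<Prod>s<m - i. r - 2 * real s) * zonal b (m - i) y)"
proof -
  let ?m0 = "2 * gauss_moment 1"
  obtain w where w: "norm w = 1" "y \<bullet> w = 0" and b: "b = (b \<bullet> y) *\<^sub>R y + (b \<bullet> w) *\<^sub>R w"
    using orthogonal_unit_exists[OF _ y, of b] n by auto
  define \<alpha> s where "\<alpha> = b \<bullet> y" and "s = b \<bullet> w"
  have bx: "b \<bullet> x = s * (w \<bullet> x) + \<alpha> * (y \<bullet> x)" for x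
    using arg_cong[OF b, of "\<lambda>z. z \<bullet> x"] by (simp add: \<alpha>_def s_def inner_add_left)
  have yy: "y \<bullet> y = 1" and ww: "w \<bullet> w = 1" using y w by (simp_all add: dot_square_norm)
  \<comment> \<open>This splits exp(s^2/2) as exp(|b|^2/2) exp(-\<alpha>^2/2); the second factor is
    the one that Kummer's transformation of the series in \<alpha>^2 absorbs.\<close>
  have s2: "s\<^sup>2 = (norm b)\<^sup>2 - \<alpha>\<^sup>2"
    unfolding power2_norm_eq_inner by (subst (2) b) (simp add: \<alpha>_def s_def inner_add_right power2_eq_square)
  define g where "g j x = exp (- (norm x)\<^sup>2 / 2) * (\<bar>y \<bullet> x\<bar> powr r * (y \<bullet> x) ^ (2 * m - j) * (w \<bullet> x) ^ j)" for j x
  have G: "G x = (\<Sum>j\<le>2 * m. s ^ j / fact j * (\<alpha> ^ (2 * m - j) / fact (2 * m - j)) * g j x)" for x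
  proof -
    have "zonal b m x = (\<Sum>j\<le>2 * m. s ^ j / fact j * (\<alpha> ^ (2 * m - j) / fact (2 * m - j)) * ((y \<bullet> x) ^ (2 * m - j) * (w \<bullet> x) ^ j))"
      unfolding zonal_def bx binomial_ring sum_divide_distrib
      by (rule sum.cong) (auto simp: binomial_fact power_mult_distrib field_simps)
    then show ?thesis unfolding G_def g_def by (simp add: sum_distrib_left mult_ac)
  qed
  note gp = integral_gauss_pair[OF n r y w(1) w(2)]
  have gi: "integrable lborel (g j)" for j unfolding g_def by (rule gp(1))
  have gv: "integral\<^sup>L lborel (g j) = (if even (2 * m - j) then 2 * gauss_moment (r + real (2 * m - j) + 1) else 0) *
            (if even j then 2 * gauss_moment (j + 1) else 0) * ?m0 ^ (DIM('a) - 2)" for j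
    unfolding g_def by (rule gp(2))
  show "integrable lborel G" unfolding G using gi by auto
  define A where "A l = 2 * gauss_moment (r + 2 * real l + 1) / fact (2 * l)" for l
  have "integral\<^sup>L lborel G = (\<Sum>j\<le>2 * m. s ^ j / fact j * (\<alpha> ^ (2 * m - j) / fact (2 * m - j)) * integral\<^sup>L lborel (g j))"
    unfolding G using gi by simp
  also have "\<dots> = (\<Sum>i\<le>m. s ^ (2 * i) / fact (2 * i) * (\<alpha> ^ (2 * m - 2 * i) / fact (2 * m - 2 * i)) * integral\<^sup>L lborel (g (2 * i)))"
    by (rule sum_atMost_even) (simp add: gv)
  also have "\<dots> = ?m0 ^ (DIM('a) - 1) * (\<Sum>i\<le>m. (s\<^sup>2 / 2) ^ i / fact i * (A (m - i) * (\<alpha>\<^sup>2) ^ (m - i)))"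
    unfolding sum_distrib_left
  proof (rule sum.cong[OF refl])
    fix i assume i: "i \<in> {..m}"
    have 2: "2 * m - 2 * i = 2 * (m - i)" by simp
    have c: "?m0 ^ (DIM('a) - 1) = ?m0 * ?m0 ^ (DIM('a) - 2)"
      using n by (metis One_nat_def Suc_diff_Suc numeral_2_eq_2 power_Suc)
    have "s ^ (2 * i) / fact (2 * i) * (\<alpha> ^ (2 * m - 2 * i) / fact (2 * m - 2 * i)) * integral\<^sup>L lborel (g (2 * i))
      = s ^ (2 * i) * \<alpha> ^ (2 * (m - i)) * A (m - i) * (2 * gauss_moment (2 * real i + 1) / fact (2 * i)) * ?m0 ^ (DIM('a) - 2)"
      unfolding gv A_def 2 by (simp add: mult_ac add_ac)
    also have "\<dots> = ?m0 ^ (DIM('a) - 1) * ((s\<^sup>2 / 2) ^ i / fact i * (A (m - i) * (\<alpha>\<^sup>2) ^ (m - i)))"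
      unfolding gauss_moment_even c by (simp add: power_mult power_divide)
    finally show "s ^ (2 * i) / fact (2 * i) * (\<alpha> ^ (2 * m - 2 * i) / fact (2 * m - 2 * i)) * integral\<^sup>L lborel (g (2 * i))
      = ?m0 ^ (DIM('a) - 1) * ((s\<^sup>2 / 2) ^ i / fact i * (A (m - i) * (\<alpha>\<^sup>2) ^ (m - i)))" .
  qed
  also have "(\<Sum>i\<le>m. (s\<^sup>2 / 2) ^ i / fact i * (A (m - i) * (\<alpha>\<^sup>2) ^ (m - i)))
     = fps_nth (fps_exp (s\<^sup>2 / 2) * Abs_fps (\<lambda>l. A l * (\<alpha>\<^sup>2) ^ l)) m"
    by (simp add: fps_mult_nth atLeast0AtMost)
  also have "fps_exp (s\<^sup>2 / 2) * Abs_fps (\<lambda>l. A l * (\<alpha>\<^sup>2) ^ l)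
     = fps_exp ((norm b)\<^sup>2 / 2) * (fps_exp (- \<alpha>\<^sup>2 / 2) * Abs_fps (\<lambda>l. A l * (\<alpha>\<^sup>2) ^ l))"
    unfolding s2 mult.assoc[symmetric] fps_exp_add_mult[symmetric] by (simp add: diff_divide_distrib)
  also have "fps_exp (- \<alpha>\<^sup>2 / 2) * Abs_fps (\<lambda>l. A l * (\<alpha>\<^sup>2) ^ l)
     = Abs_fps (\<lambda>l. fps_nth (fps_exp (- 1 / 2) * Abs_fps A) l * (\<alpha>\<^sup>2) ^ l)"
  proof (rule fps_ext)
    fix l
    have "(- \<alpha>\<^sup>2 / 2) ^ i = (- 1 / 2) ^ i * (\<alpha>\<^sup>2) ^ i" for i
      by (simp flip: power_mult_distrib)
    then show "fps_nth (fps_exp (- \<alpha>\<^sup>2 / 2) * Abs_fps (\<lambda>l. A l * (\<alpha>\<^sup>2) ^ l)) l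
      = fps_nth (Abs_fps (\<lambda>l. fps_nth (fps_exp (- 1 / 2) * Abs_fps A) l * (\<alpha>\<^sup>2) ^ l)) l"
      by (auto simp: fps_mult_nth sum_distrib_right intro!: sum.cong simp flip: power_add)
  qed
  also have "(\<lambda>l. fps_nth (fps_exp (- 1 / 2) * Abs_fps A) l * (\<alpha>\<^sup>2) ^ l)
     = (\<lambda>l. 2 * gauss_moment (r + 1) * ((\<Prod>s<l. r - 2 * real s) * zonal b l y))"
  proof
    fix l
    have "fps_nth (fps_exp (- 1 / 2) * Abs_fps A) l = 2 * gauss_moment (r + 1) * (\<Prod>s<l. r - 2 * real s) / fact (2 * l)"
    proof (induction l)
      case (Suc l)
      have "(2 * real j + 2) * (2 * real j + 1) * A (Suc j) = (r + 1 + 2 * real j) * A j" for j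
        using gauss_moment_rec[of "r + 2 * real j + 1"] r
        by (simp add: A_def divide_simps add_nonneg_eq_0_iff) (simp add: algebra_simps)
      then have "(2 * real l + 2) * (2 * real l + 1) * fps_nth (fps_exp (- 1 / 2) * Abs_fps A) (Suc l)
         = (r - 2 * real l) * fps_nth (fps_exp (- 1 / 2) * Abs_fps A) l"
        by (intro fps_kummer) simp
      moreover have "(2 * real l + 2) * (2 * real l + 1) \<noteq> 0" by (simp add: add_nonneg_eq_0_iff)
      ultimately have "fps_nth (fps_exp (- 1 / 2) * Abs_fps A) (Suc l)
         = (r - 2 * real l) * fps_nth (fps_exp (- 1 / 2) * Abs_fps A) l / ((2 * real l + 2) * (2 * real l + 1))"
        by (simp add: nonzero_eq_divide_eq mult.commute)
      then show ?case unfolding Suc.IH by (simp add: mult_ac algebra_simps)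
    qed (simp add: A_def)
    then show "fps_nth (fps_exp (- 1 / 2) * Abs_fps A) l * (\<alpha>\<^sup>2) ^ l = 2 * gauss_moment (r + 1) * ((\<Prod>s<l. r - 2 * real s) * zonal b l y)"
      by (simp add: zonal_def \<alpha>_def power_mult)
  qed
  finally show "integral\<^sup>L lborel G = ?m0 ^ (DIM('a) - 1) * (2 * gauss_moment (r + 1)) *
       (\<Sum>i\<le>m. ((norm b)\<^sup>2 / 2) ^ i / fact i * (\<Prod>s<m - i. r - 2 * real s) * zonal b (m - i) y)"
    by (simp add: fps_mult_nth atLeast0AtMost sum_distrib_left mult_ac)
qed

section \<open>The cosine transform\<close>

lemma measurable_sphere_fst [measurable]:
  "fst \<in> sphere_measure \<Otimes>\<^sub>M M \<rightarrow>\<^sub>M (borel :: 'a::euclidean_space measure)"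
  by (rule measurable_compose[OF measurable_fst borel_measurable_sphere]) simp

lemma measurable_sphere_snd [measurable]:
  "snd \<in> M \<Otimes>\<^sub>M sphere_measure \<rightarrow>\<^sub>M (borel :: 'a::euclidean_space measure)"
  by (rule measurable_compose[OF measurable_snd borel_measurable_sphere]) simp

lemma borel_measurable_zonal [measurable]: "zonal b m \<in> borel_measurable (borel :: 'a::euclidean_space measure)"
  unfolding zonal_def[abs_def] by measurable

lemma zonal_scaleR: "zonal b m (t *\<^sub>R x) = t ^ (2 * m) * zonal b m x"
  by (simp add: zonal_def power_mult_distrib)

lemma zonal_bound: "norm x \<le> 1 \<Longrightarrow> \<bar>zonal b m x\<bar> \<le> norm b ^ (2 * m) / fact (2 * m)"
proof -
  assume "norm x \<le> 1"
  then have "\<bar>b \<bullet> x\<bar> \<le> norm b"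
    using order_trans[OF Cauchy_Schwarz_ineq2[of b x] mult_left_le[of "norm x" "norm b"]] by simp
  then show ?thesis
    using power_mono[of "\<bar>b \<bullet> x\<bar>" "norm b" "2 * m"] by (simp add: zonal_def power_abs divide_right_mono)
qed

lemma integrable_bounded_mult:
  fixes g \<phi> :: "'a \<Rightarrow> real"
  assumes g: "integrable M g" and [measurable]: "\<phi> \<in> borel_measurable M"
    and B: "\<And>x. x \<in> space M \<Longrightarrow> \<bar>\<phi> x\<bar> \<le> B"
  shows "integrable M (\<lambda>x. g x * \<phi> x)"
proof (rule Bochner_Integration.integrable_bound)
  show "integrable M (\<lambda>x. B * g x)" using g by simp
  show "AE x in M. norm (g x * \<phi> x) \<le> norm (B * g x)"
  proof (rule AE_I2)
    fix x assume x: "x \<in> space M"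
    then have "\<bar>\<phi> x\<bar> \<le> \<bar>B\<bar>" using B[of x] by linarith
    then show "norm (g x * \<phi> x) \<le> norm (B * g x)"
      by (simp add: abs_mult mult.commute mult_right_mono)
  qed
qed (use g in measurable)

text \<open>For negative r the kernel is unbounded near the equator; its integrability comes from
  the Gaussian integral with m = 0, where one coordinate alone carries the singularity.\<close>

lemma integrable_sphere_abs_inner:
  fixes y :: "'a::euclidean_space"
  assumes n: "DIM('a) > 1" and r: "r > -1" and y: "norm y = 1"
  shows "integrable sphere_measure (\<lambda>\<theta>. \<bar>y \<bullet> \<theta>\<bar> powr r)"
proof (rule integrable_sphere_homogeneous[where d = r])
  show "integrable lborel (\<lambda>x. exp (- (norm x)\<^sup>2 / 2) * \<bar>y \<bullet> x\<bar> powr r)"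
    using integral_gauss_zonal(1)[OF n r y, of y 0] by (simp add: zonal_def)
qed (auto simp: abs_mult powr_mult)

lemma integrable_sphere_abs_inner_mult:
  fixes y :: "'a::euclidean_space"
  assumes n: "DIM('a) > 1" and r: "r > -1" and y: "norm y = 1"
    and [measurable]: "\<phi> \<in> borel_measurable borel" and B: "\<And>x. norm x = 1 \<Longrightarrow> \<bar>\<phi> x\<bar> \<le> B"
  shows "integrable sphere_measure (\<lambda>\<theta>. \<bar>y \<bullet> \<theta>\<bar> powr r * \<phi> \<theta>)"
  by (rule integrable_bounded_mult[OF integrable_sphere_abs_inner[OF n r y]]) (auto intro: B)

definition cosine_transform :: "real \<Rightarrow> ('a::euclidean_space \<Rightarrow> real) \<Rightarrow> 'a \<Rightarrow> real" where
  "cosine_transform r g y = (\<integral>\<theta>. \<bar>y \<bullet> \<theta>\<bar> powr r * g \<theta> \<partial>sphere_measure)"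

lemma cosine_transform_minus: "cosine_transform r g (- y) = cosine_transform r g y"
  by (simp add: cosine_transform_def)

lemma cosine_transform_scaleR: "t > 0 \<Longrightarrow> cosine_transform r g (t *\<^sub>R y) = t powr r * cosine_transform r g y"
  by (simp add: cosine_transform_def abs_mult powr_mult mult.assoc)

lemma cosine_transform_measurable [measurable]:
  assumes [measurable]: "g \<in> borel_measurable borel"
  shows "cosine_transform r g \<in> borel_measurable borel"
proof -
  interpret S: sigma_finite_measure "sphere_measure :: 'a measure" by (rule sigma_finite_sphere_measure)
  show ?thesis unfolding cosine_transform_def[abs_def] by measurable
qed

text \<open>The same Gaussian integral computed twice: in polar coordinates it is the transform
  times the radial moment of exponent n + r + 2m, in Cartesian coordinates the explicit sum.\<close>

lemma cosine_transform_zonal: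
  fixes y b :: "'a::euclidean_space" and r :: real
  assumes n: "DIM('a) > 1" and r: "r > -1" and y: "norm y = 1"
  shows "gauss_moment (real DIM('a) + r + 2 * real m) * cosine_transform r (zonal b m) y
     = (2 * gauss_moment 1) ^ (DIM('a) - 1) * (2 * gauss_moment (r + 1)) *
       (\<Sum>i\<le>m. ((norm b)\<^sup>2 / 2) ^ i / fact i * (\<Prod>s<m - i. r - 2 * real s) * zonal b (m - i) y)"
proof -
  let ?w = "\<lambda>x. \<bar>y \<bullet> x\<bar> powr r * zonal b m x"
  have pos: "real DIM('a) + r + 2 * real m > 0" using n r by simp
  have pw: "t powr (r + 2 * real m) = t powr r * t ^ (2 * m)" if "t > 0" for t :: real
    using that by (simp add: powr_add powr_realpow[symmetric])
  have w: "integrable sphere_measure ?w"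
    using n r y by (rule integrable_sphere_abs_inner_mult) (auto intro: zonal_bound)
  have s: "set_integrable lborel {0<..} (\<lambda>t. t powr (real DIM('a) + (r + 2 * real m) - 1) * exp (- t\<^sup>2 / 2))"
    using integrable_powr_gauss[OF pos] by (simp add: algebra_simps)
  have "(\<integral>x. exp (- (norm x)\<^sup>2 / 2) * ?w x \<partial>lborel)
     = (LINT t:{0<..}|lborel. t powr (real DIM('a) + (r + 2 * real m) - 1) * exp (- t\<^sup>2 / 2)) * integral\<^sup>L sphere_measure ?w"
    by (rule integral_polar_homogeneous(2)[where h = "\<lambda>t. exp (- t\<^sup>2 / 2)" and d = "r + 2 * real m", OF _ _ _ w s])
       (auto simp: abs_mult powr_mult zonal_scaleR pw)
  also have "(LINT t:{0<..}|lborel. t powr (real DIM('a) + (r + 2 * real m) - 1) * exp (- t\<^sup>2 / 2)) = gauss_moment (real DIM('a) + r + 2 * real m)"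
    using pos by (simp add: gauss_moment_def gauss_int_def algebra_simps)
  finally show ?thesis
    using integral_gauss_zonal(2)[OF n r y, of b m] by (simp add: cosine_transform_def)
qed

lemma cosine_transform_one:
  fixes y :: "'a::euclidean_space" and r :: real
  assumes n: "DIM('a) > 1" and r: "r > -1" and y: "norm y = 1"
  shows "(\<integral>\<theta>. \<bar>y \<bullet> \<theta>\<bar> powr r \<partial>sphere_measure)
     = (2 * gauss_moment 1) ^ (DIM('a) - 1) * (2 * gauss_moment (r + 1)) / gauss_moment (real DIM('a) + r)"
proof -
  have "gauss_moment (real DIM('a) + r) > 0" using n r by (intro gauss_moment_pos) simp
  then show ?thesis
    using cosine_transform_zonal[OF n r y, of 0 0] by (simp add: zonal_def cosine_transform_def field_simps)
qed

text \<open>The kernel is symmetric, so this is Fubini. Its integral over the sphere is the same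
  constant \<open>K\<close> for every unit vector, hence a bounded \<phi> leaves a multiple of |g|
  as majorant even when r is negative.\<close>

lemma cosine_transform_swap:
  fixes g \<phi> :: "'a::euclidean_space \<Rightarrow> real"
  assumes n: "DIM('a) > 1" and r: "r > -1"
    and [measurable]: "g \<in> borel_measurable borel" "\<phi> \<in> borel_measurable borel"
    and g: "integrable sphere_measure g" and B: "\<And>x. norm x = 1 \<Longrightarrow> \<bar>\<phi> x\<bar> \<le> B"
  shows "integrable sphere_measure (\<lambda>y. cosine_transform r g y * \<phi> y)"
    and "integrable sphere_measure (\<lambda>\<theta>. g \<theta> * cosine_transform r \<phi> \<theta>)"
    and "(\<integral>y. cosine_transform r g y * \<phi> y \<partial>sphere_measure) = (\<integral>\<theta>. g \<theta> * cosine_transform r \<phi> \<theta> \<partial>sphere_measure)"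
proof -
  interpret S: sigma_finite_measure "sphere_measure :: 'a measure" by (rule sigma_finite_sphere_measure)
  interpret P: pair_sigma_finite "sphere_measure :: 'a measure" "sphere_measure :: 'a measure" ..
  let ?f = "\<lambda>(\<theta>, y). g \<theta> * (\<bar>\<theta> \<bullet> y\<bar> powr r * \<phi> y)"
  obtain K where K: "\<And>y::'a. norm y = 1 \<Longrightarrow> (\<integral>\<theta>. \<bar>y \<bullet> \<theta>\<bar> powr r \<partial>sphere_measure) = K"
    using cosine_transform_one[OF n r] by blast
  have inn: "integrable sphere_measure (\<lambda>y. \<bar>\<theta> \<bullet> y\<bar> powr r * \<phi> y)" if "norm \<theta> = 1" for \<theta>
    using n r that by (rule integrable_sphere_abs_inner_mult) (auto intro: B)
  have i: "integrable (sphere_measure \<Otimes>\<^sub>M sphere_measure) ?f"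
  proof (rule P.Fubini_integrable)
    show "integrable sphere_measure (\<lambda>\<theta>. \<integral>y. norm (?f (\<theta>, y)) \<partial>sphere_measure)"
    proof (rule Bochner_Integration.integrable_bound)
      show "integrable sphere_measure (\<lambda>\<theta>. \<bar>g \<theta>\<bar> * (B * K))" using g by simp
      show "AE \<theta> in sphere_measure. norm (\<integral>y. norm (?f (\<theta>, y)) \<partial>sphere_measure) \<le> norm (\<bar>g \<theta>\<bar> * (B * K))"
      proof (rule AE_I2)
        fix \<theta> :: 'a assume "\<theta> \<in> space sphere_measure"
        then have t: "norm \<theta> = 1" by simp
        have "(\<integral>y. \<bar>\<theta> \<bullet> y\<bar> powr r * \<bar>\<phi> y\<bar> \<partial>sphere_measure) \<le> (\<integral>y. B * \<bar>\<theta> \<bullet> y\<bar> powr r \<partial>sphere_measure)"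
          using inn[OF t] integrable_sphere_abs_inner[OF n r t]
          by (intro integral_mono_AE) (auto simp: abs_mult mult.commute[of B] intro!: mult_left_mono B dest: integrable_abs)
        then have "(\<integral>y. \<bar>\<theta> \<bullet> y\<bar> powr r * \<bar>\<phi> y\<bar> \<partial>sphere_measure) \<le> B * K" using K[OF t] by simp
        moreover have "(\<integral>y. \<bar>\<theta> \<bullet> y\<bar> powr r * \<bar>\<phi> y\<bar> \<partial>sphere_measure) \<ge> 0" by (rule integral_nonneg_AE) auto
        ultimately have BK: "0 \<le> B * K" and "\<bar>g \<theta>\<bar> * (\<integral>y. \<bar>\<theta> \<bullet> y\<bar> powr r * \<bar>\<phi> y\<bar> \<partial>sphere_measure) \<le> \<bar>g \<theta>\<bar> * (B * K)"
          by (linarith, auto intro: mult_left_mono)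
        moreover have "norm (\<bar>g \<theta>\<bar> * (B * K)) = \<bar>g \<theta>\<bar> * (B * K)"
          by (simp only: real_norm_def abs_mult[of "\<bar>g \<theta>\<bar>" "B * K"] abs_of_nonneg[OF BK] abs_idempotent)
        moreover have "norm (\<integral>y. norm (?f (\<theta>, y)) \<partial>sphere_measure) = \<bar>g \<theta>\<bar> * (\<integral>y. \<bar>\<theta> \<bullet> y\<bar> powr r * \<bar>\<phi> y\<bar> \<partial>sphere_measure)"
          using \<open>(\<integral>y. \<bar>\<theta> \<bullet> y\<bar> powr r * \<bar>\<phi> y\<bar> \<partial>sphere_measure) \<ge> 0\<close> by (simp add: abs_mult)
        ultimately show "norm (\<integral>y. norm (?f (\<theta>, y)) \<partial>sphere_measure) \<le> norm (\<bar>g \<theta>\<bar> * (B * K))"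
          by presburger
      qed
    qed measurable
    show "AE \<theta> in sphere_measure. integrable sphere_measure (\<lambda>y. ?f (\<theta>, y))"
      by (rule AE_I2) (auto intro!: integrable_mult_right inn)
  qed measurable
  have e1: "(\<integral>y. ?f (\<theta>, y) \<partial>sphere_measure) = g \<theta> * cosine_transform r \<phi> \<theta>" for \<theta>
    by (simp add: cosine_transform_def)
  have e2: "(\<integral>\<theta>. ?f (\<theta>, y) \<partial>sphere_measure) = cosine_transform r g y * \<phi> y" for y
    by (simp add: cosine_transform_def inner_commute mult_ac flip: integral_mult_left_zero)
  show "integrable sphere_measure (\<lambda>\<theta>. g \<theta> * cosine_transform r \<phi> \<theta>)"
    using P.integrable_fst'[OF i] unfolding e1 .
  show "integrable sphere_measure (\<lambda>y. cosine_transform r g y * \<phi> y)"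
    using P.integrable_snd[of "\<lambda>\<theta> y. ?f (\<theta>, y)"] i unfolding e2 by (simp add: case_prod_unfold)
  show "(\<integral>y. cosine_transform r g y * \<phi> y \<partial>sphere_measure) = (\<integral>\<theta>. g \<theta> * cosine_transform r \<phi> \<theta> \<partial>sphere_measure)"
    using P.Fubini_integral[of "\<lambda>\<theta> y. ?f (\<theta>, y)"] i unfolding e1 e2 by (simp add: case_prod_unfold)
qed

text \<open>Symmetry is inherited from Lebesgue measure: \<phi>(x/|x|) is integrated against a
  Gaussian, and the nonzero radial factor cancels.\<close>

lemma sphere_measure_uminus:
  fixes \<phi> :: "'a::euclidean_space \<Rightarrow> real"
  assumes [measurable]: "\<phi> \<in> borel_measurable borel" and i: "integrable sphere_measure \<phi>" and i': "integrable sphere_measure (\<lambda>x. \<phi> (- x))"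
  shows "(\<integral>x. \<phi> (- x) \<partial>sphere_measure) = integral\<^sup>L sphere_measure \<phi>"
proof -
  have pos: "real DIM('a) > 0" by simp
  have s: "set_integrable lborel {0<..} (\<lambda>t. t powr (real DIM('a) + 0 - 1) * exp (- t\<^sup>2 / 2))"
    using integrable_powr_gauss[OF pos] by simp
  have e: "(\<integral>x. exp (- (norm x)\<^sup>2 / 2) * \<psi> (x /\<^sub>R norm x) \<partial>lborel)
     = (LINT t:{0<..}|lborel. t powr (real DIM('a) + 0 - 1) * exp (- t\<^sup>2 / 2)) * integral\<^sup>L sphere_measure \<psi>"
    if [measurable]: "\<psi> \<in> borel_measurable borel" and "integrable sphere_measure \<psi>" for \<psi> :: "'a \<Rightarrow> real"
  proof -
    have "integrable sphere_measure (\<lambda>x. \<psi> (x /\<^sub>R norm x)) \<longleftrightarrow> integrable sphere_measure \<psi>"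
      by (rule Bochner_Integration.integrable_cong[OF refl]) simp
    moreover have "(\<integral>x. \<psi> (x /\<^sub>R norm x) \<partial>sphere_measure) = integral\<^sup>L sphere_measure \<psi>"
      by (rule Bochner_Integration.integral_cong[OF refl]) simp
    ultimately have c: "integrable sphere_measure (\<lambda>x. \<psi> (x /\<^sub>R norm x))"
      "(\<integral>x. \<psi> (x /\<^sub>R norm x) \<partial>sphere_measure) = integral\<^sup>L sphere_measure \<psi>"
      using that(2) by simp_all
    show ?thesis
      unfolding c(2)[symmetric]
      by (rule integral_polar_homogeneous(2)[where h = "\<lambda>t. exp (- t\<^sup>2 / 2)" and d = 0, OF _ _ _ c(1) s]) (auto simp: field_simps)
  qed
  have "(LINT t:{0<..}|lborel. t powr (real DIM('a) + 0 - 1) * exp (- t\<^sup>2 / 2)) = gauss_int (DIM('a))"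
    by (simp add: gauss_int_def)
  then have nz: "(LINT t:{0<..}|lborel. t powr (real DIM('a) + 0 - 1) * exp (- t\<^sup>2 / 2)) \<noteq> 0"
    using gauss_int_pos[OF pos] by simp
  have "(\<integral>x. exp (- (norm x)\<^sup>2 / 2) * \<phi> (x /\<^sub>R norm x) \<partial>distr lborel borel (\<lambda>x. - x))
      = (\<integral>x. exp (- (norm (- x))\<^sup>2 / 2) * \<phi> (- x /\<^sub>R norm (- x)) \<partial>lborel)"
    by (rule integral_distr) auto
  moreover have "distr lborel borel (\<lambda>x::'a. - x) = lborel"
    by (rule lborel_distr_orthogonal) (simp add: orthogonal_transformation_neg)
  ultimately show ?thesis
    using e[of \<phi>] e[of "\<lambda>x. \<phi> (- x)"] i i' nz by simp
qed

section \<open>Exponential sums and the determination of measures by even moments\<close>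

text \<open>Exponentials are chosen as the dense algebra because products of them are again
  exponentials and their even parts are hyperbolic cosines, to which the zonal moments give
  access.\<close>

inductive exp_sum :: "('a::euclidean_space \<Rightarrow> real) \<Rightarrow> bool" where
  single: "exp_sum (\<lambda>x. c * exp (b \<bullet> x))"
| add: "exp_sum f \<Longrightarrow> exp_sum g \<Longrightarrow> exp_sum (\<lambda>x. f x + g x)"

lemma exp_sum_mult_single: "exp_sum g \<Longrightarrow> exp_sum (\<lambda>x. c * exp (b \<bullet> x) * g x)"
proof (induction rule: exp_sum.induct)
  case (single c' b')
  have "(\<lambda>x. c * exp (b \<bullet> x) * (c' * exp (b' \<bullet> x))) = (\<lambda>x. (c * c') * exp ((b + b') \<bullet> x))"
    by (simp add: fun_eq_iff inner_add_left exp_add)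
  then show ?case using exp_sum.single by metis
next
  case (add f g)
  then show ?case using exp_sum.add[OF add.IH] by (simp add: distrib_left)
qed

lemma exp_sum_mult: "exp_sum f \<Longrightarrow> exp_sum g \<Longrightarrow> exp_sum (\<lambda>x. f x * g x)"
proof (induction rule: exp_sum.induct)
  case (single c b)
  then show ?case by (rule exp_sum_mult_single)
next
  case (add f1 f2)
  then show ?case using exp_sum.add[OF add.IH] by (simp add: distrib_right)
qed

lemma exp_sum_continuous: "exp_sum f \<Longrightarrow> continuous_on S f"
  by (induction rule: exp_sum.induct) (auto intro!: continuous_intros)

lemma exp_sum_dense:
  fixes S :: "'a::euclidean_space set"
  assumes "compact S" "continuous_on S f" "e > 0"
  shows "\<exists>g. exp_sum g \<and> (\<forall>x\<in>S. \<bar>f x - g x\<bar> < e)"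
proof -
  interpret function_ring_on "Collect exp_sum" S
  proof
    show "f \<in> Collect exp_sum \<Longrightarrow> continuous_on S f" for f by (simp add: exp_sum_continuous)
    show "(\<lambda>_. c) \<in> Collect exp_sum" for c using exp_sum.single[of c 0] by simp
    fix x y :: 'a assume "x \<noteq> y"
    \<comment> \<open>The two values differ by |x - y|^2, so the exponential in direction x - y
      separates the points.\<close>
    then have "(x - y) \<bullet> x \<noteq> (x - y) \<bullet> y"
      by (metis eq_iff_diff_eq_0 inner_diff_right inner_eq_zero_iff)
    then show "\<exists>f\<in>Collect exp_sum. f x \<noteq> f y"
      using exp_sum.single[of 1 "x - y"] by (intro bexI[of _ "\<lambda>z. 1 * exp ((x - y) \<bullet> z)"]) auto
  qed (use assms in \<open>auto intro: exp_sum.add exp_sum_mult\<close>)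
  show ?thesis using Stone_Weierstrass_basic[OF assms(2,3)] by auto
qed

text \<open>\<open>cosh (b \<bullet> x) = \<Sum>m. zonal b m x\<close>, and the even part of an \<open>exp_sum\<close> is a combination of such functions.\<close>

lemma integral_cosh_zonal:
  fixes w :: "'b \<Rightarrow> real" and Y :: "'b \<Rightarrow> 'a::euclidean_space"
  assumes w: "integrable M w" and [measurable]: "Y \<in> M \<rightarrow>\<^sub>M borel" and Y: "\<And>t. t \<in> space M \<Longrightarrow> norm (Y t) \<le> 1"
  shows "(\<lambda>m. \<integral>t. w t * zonal b m (Y t) \<partial>M) sums (\<integral>t. w t * cosh (b \<bullet> Y t) \<partial>M)"
proof -
  have [measurable]: "w \<in> borel_measurable M" using w by auto
  have "cosh z = (\<Sum>m. z ^ (2 * m) / fact (2 * m))" "summable (\<lambda>m. z ^ (2 * m) / fact (2 * m))" for z :: real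
  proof -
    have "(\<lambda>n. if even n then z ^ n /\<^sub>R fact n else 0) sums cosh z" by (rule cosh_converges)
    then have "(\<lambda>m. z ^ (2 * m) /\<^sub>R fact (2 * m)) sums cosh z"
      by (subst (asm) sums_mono_reindex[of "\<lambda>m. 2 * m", symmetric]) (auto simp: strict_mono_def elim!: evenE)
    then have "(\<lambda>m. z ^ (2 * m) / fact (2 * m)) sums cosh z" by (simp add: divide_inverse mult.commute)
    then show "cosh z = (\<Sum>m. z ^ (2 * m) / fact (2 * m))" "summable (\<lambda>m. z ^ (2 * m) / fact (2 * m))"
      by (auto simp: sums_iff)
  qed
  note ch = this
  have zi: "integrable M (\<lambda>t. w t * zonal b m (Y t))" for m
    by (rule integrable_bounded_mult[OF w]) (auto intro: zonal_bound Y)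
  have "(\<lambda>m. \<integral>t. w t * zonal b m (Y t) \<partial>M) sums (\<integral>t. (\<Sum>m. w t * zonal b m (Y t)) \<partial>M)"
  proof (rule sums_integral[OF zi])
    show "AE t in M. summable (\<lambda>m. norm (w t * zonal b m (Y t)))"
    proof (rule AE_I2)
      fix t
      have "norm (w t * zonal b m (Y t)) = \<bar>w t\<bar> * ((b \<bullet> Y t) ^ (2 * m) / fact (2 * m))" for m
        by (simp add: abs_mult zonal_def)
      then show "summable (\<lambda>m. norm (w t * zonal b m (Y t)))"
        by (simp only:) (intro summable_mult ch(2))
    qed
    show "summable (\<lambda>m. \<integral>t. norm (w t * zonal b m (Y t)) \<partial>M)"
    proof (rule summable_comparison_test')
      show "summable (\<lambda>m. norm b ^ (2 * m) / fact (2 * m) * (\<integral>t. \<bar>w t\<bar> \<partial>M))" by (intro summable_mult2 ch(2))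
      fix m :: nat
      have "(\<integral>t. norm (w t * zonal b m (Y t)) \<partial>M) \<le> (\<integral>t. norm b ^ (2 * m) / fact (2 * m) * \<bar>w t\<bar> \<partial>M)"
      proof (rule integral_mono[OF integrable_norm[OF zi]])
        fix t assume "t \<in> space M"
        then show "norm (w t * zonal b m (Y t)) \<le> norm b ^ (2 * m) / fact (2 * m) * \<bar>w t\<bar>"
          using mult_left_mono[OF zonal_bound[OF Y], of t "\<bar>w t\<bar>" b m] by (simp add: abs_mult mult.commute)
      qed (use w in simp)
      then show "norm (\<integral>t. norm (w t * zonal b m (Y t)) \<partial>M) \<le> norm b ^ (2 * m) / fact (2 * m) * (\<integral>t. \<bar>w t\<bar> \<partial>M)"
        by simp
    qed
  qed
  moreover have "(\<Sum>m. w t * zonal b m (Y t)) = w t * cosh (b \<bullet> Y t)" for t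
    using suminf_mult[OF ch(2), of "w t" "b \<bullet> Y t"] by (simp add: zonal_def ch(1))
  ultimately show ?thesis by simp
qed

text \<open>Stone-Weierstrass applied to signed measures given as \<open>w\<close> on an abstract
  space and pushed forward by \<open>Y\<close>. Two different spaces are allowed so that the sphere
  can be compared with the unit interval carrying an embedding, and |Y| \<le> 1 instead of equality
  so that \<open>Y\<close> may take the value 0.\<close>

lemma zonal_moments_determine:
  fixes w :: "'b \<Rightarrow> real" and Y :: "'b \<Rightarrow> 'a::euclidean_space" and w' :: "'c \<Rightarrow> real" and Y' :: "'c \<Rightarrow> 'a::euclidean_space"
  assumes w: "integrable M w" and [measurable]: "Y \<in> M \<rightarrow>\<^sub>M borel" and Y: "\<And>t. t \<in> space M \<Longrightarrow> norm (Y t) \<le> 1"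
    and w': "integrable M' w'" and [measurable]: "Y' \<in> M' \<rightarrow>\<^sub>M borel" and Y': "\<And>t. t \<in> space M' \<Longrightarrow> norm (Y' t) \<le> 1"
    and eq: "\<And>b m. (\<integral>t. w t * zonal b m (Y t) \<partial>M) = (\<integral>t. w' t * zonal b m (Y' t) \<partial>M')"
    and \<phi>: "continuous_on UNIV \<phi>" "\<And>x. \<phi> (- x) = \<phi> x"
  shows "(\<integral>t. w t * \<phi> (Y t) \<partial>M) = (\<integral>t. w' t * \<phi> (Y' t) \<partial>M')"
proof -
  have [measurable]: "w \<in> borel_measurable M" "w' \<in> borel_measurable M'" using w w' by auto
  have ch: "(\<integral>t. w t * cosh (b \<bullet> Y t) \<partial>M) = (\<integral>t. w' t * cosh (b \<bullet> Y' t) \<partial>M')" for b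
    using integral_cosh_zonal[of M w Y b] integral_cosh_zonal[of M' w' Y' b] w w' Y Y' unfolding eq
    by (auto intro: sums_unique2)
  have ci: "integrable M (\<lambda>t. w t * \<psi> (Y t))" "integrable M' (\<lambda>t. w' t * \<psi> (Y' t))"
    if \<psi>: "continuous_on UNIV \<psi>" for \<psi>
  proof -
    have [measurable]: "\<psi> \<in> borel_measurable borel" using \<psi> by (rule borel_measurable_continuous_onI)
    have "compact (\<psi> ` cball 0 1)" using \<psi> by (intro compact_continuous_image) (auto intro: continuous_on_subset)
    then obtain B where "\<And>x. x \<in> cball 0 1 \<Longrightarrow> \<bar>\<psi> x\<bar> \<le> B"
      using compact_imp_bounded bounded_iff by (metis image_eqI real_norm_def)
    then show "integrable M (\<lambda>t. w t * \<psi> (Y t))" "integrable M' (\<lambda>t. w' t * \<psi> (Y' t))"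
      using Y Y' by (auto intro!: integrable_bounded_mult[OF w, where B=B] integrable_bounded_mult[OF w', where B=B])
  qed
  have ev: "(\<integral>t. w t * ((g (Y t) + g (- Y t)) / 2) \<partial>M) = (\<integral>t. w' t * ((g (Y' t) + g (- Y' t)) / 2) \<partial>M')"
    if "exp_sum g" for g
    using that
  proof (induction rule: exp_sum.induct)
    case (single c b)
    have e: "w * ((c * exp (b \<bullet> x) + c * exp (b \<bullet> - x)) / 2) = c * (w * cosh (b \<bullet> x))" for w x
      by (simp add: cosh_def field_simps)
    show ?case unfolding e using ch[of b] by simp
  next
    case (add f g)
    have c: "continuous_on UNIV (\<lambda>x. (f x + f (- x)) / 2)" if "exp_sum f" for f :: "'a \<Rightarrow> real"
      using exp_sum_continuous[OF that, of UNIV] by (auto intro!: continuous_intros intro: continuous_on_compose2)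
    have e: "w * ((f x + g x + (f x' + g x')) / 2) = w * ((f x + f x') / 2) + w * ((g x + g x') / 2)" for w x x'
      by (simp add: field_simps)
    show ?case
      unfolding e using ci[OF c[OF add.hyps(1)]] ci[OF c[OF add.hyps(2)]] add.IH by simp
  qed
  let ?D = "(\<integral>t. w t * \<phi> (Y t) \<partial>M) - (\<integral>t. w' t * \<phi> (Y' t) \<partial>M')"
  let ?K = "(\<integral>t. \<bar>w t\<bar> \<partial>M) + (\<integral>t. \<bar>w' t\<bar> \<partial>M')"
  have bd: "\<bar>?D\<bar> \<le> e * ?K" if e: "e > 0" for e
  proof -
    obtain g where g: "exp_sum g" "\<And>x. x \<in> cball 0 1 \<Longrightarrow> \<bar>\<phi> x - g x\<bar> < e"
      using exp_sum_dense[OF compact_cball continuous_on_subset[OF \<phi>(1)] e, of 0 1] by blast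
    \<comment> \<open>Replacing g by its even part keeps the error within e since \<phi> is even,
      and for the even part the two integrals are known to coincide.\<close>
    define h where "h x = (g x + g (- x)) / 2" for x
    have hc: "continuous_on UNIV h" unfolding h_def[abs_def]
      using exp_sum_continuous[OF g(1), of UNIV] by (auto intro!: continuous_intros intro: continuous_on_compose2)
    have h: "\<bar>\<phi> x - h x\<bar> \<le> e" if "norm x \<le> 1" for x
    proof -
      have "\<bar>\<phi> x - g x\<bar> < e" "\<bar>\<phi> x - g (- x)\<bar> < e"
        using g(2)[of x] g(2)[of "- x"] that \<phi>(2)[of x] by auto
      moreover have "\<phi> x - h x = ((\<phi> x - g x) + (\<phi> x - g (- x))) / 2"
        by (simp add: h_def field_simps)
      moreover have "\<bar>((\<phi> x - g x) + (\<phi> x - g (- x))) / 2\<bar> = \<bar>(\<phi> x - g x) + (\<phi> x - g (- x))\<bar> / 2"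
        by simp
      ultimately show ?thesis
        using abs_triangle_ineq[of "\<phi> x - g x" "\<phi> x - g (- x)"] by simp
    qed
    have dc: "continuous_on UNIV (\<lambda>x. \<phi> x - h x)" using \<phi>(1) hc by (intro continuous_intros)
    have 1: "\<bar>(\<integral>t. w t * (\<phi> (Y t) - h (Y t)) \<partial>M)\<bar> \<le> e * (\<integral>t. \<bar>w t\<bar> \<partial>M)"
    proof -
      have "\<bar>(\<integral>t. w t * (\<phi> (Y t) - h (Y t)) \<partial>M)\<bar> \<le> (\<integral>t. \<bar>w t * (\<phi> (Y t) - h (Y t))\<bar> \<partial>M)"
        by (rule integral_abs_bound)
      also have "\<dots> \<le> (\<integral>t. e * \<bar>w t\<bar> \<partial>M)"
      proof (rule integral_mono[OF integrable_abs[OF ci(1)[OF dc]]])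
        fix t assume "t \<in> space M"
        then show "\<bar>w t * (\<phi> (Y t) - h (Y t))\<bar> \<le> e * \<bar>w t\<bar>"
          using mult_right_mono[OF h[OF Y], of t "\<bar>w t\<bar>"] by (simp add: abs_mult mult.commute)
      qed (use w in simp)
      finally show ?thesis by simp
    qed
    have 2: "\<bar>(\<integral>t. w' t * (\<phi> (Y' t) - h (Y' t)) \<partial>M')\<bar> \<le> e * (\<integral>t. \<bar>w' t\<bar> \<partial>M')"
    proof -
      have "\<bar>(\<integral>t. w' t * (\<phi> (Y' t) - h (Y' t)) \<partial>M')\<bar> \<le> (\<integral>t. \<bar>w' t * (\<phi> (Y' t) - h (Y' t))\<bar> \<partial>M')"
        by (rule integral_abs_bound)
      also have "\<dots> \<le> (\<integral>t. e * \<bar>w' t\<bar> \<partial>M')"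
      proof (rule integral_mono[OF integrable_abs[OF ci(2)[OF dc]]])
        fix t assume "t \<in> space M'"
        then show "\<bar>w' t * (\<phi> (Y' t) - h (Y' t))\<bar> \<le> e * \<bar>w' t\<bar>"
          using mult_right_mono[OF h[OF Y'], of t "\<bar>w' t\<bar>"] by (simp add: abs_mult mult.commute)
      qed (use w' in simp)
      finally show ?thesis by simp
    qed
    have "?D = (\<integral>t. w t * (\<phi> (Y t) - h (Y t)) \<partial>M) - (\<integral>t. w' t * (\<phi> (Y' t) - h (Y' t)) \<partial>M')"
      using ci[OF \<phi>(1)] ci[OF hc] ev[OF g(1)] by (simp add: right_diff_distrib h_def)
    then show ?thesis using 1 2 by (simp add: distrib_left)
  qed
  have "?K \<ge> 0" by (intro add_nonneg_nonneg integral_nonneg_AE) auto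
  have "\<bar>?D\<bar> \<le> 0"
  proof (rule field_le_epsilon)
    fix e :: real assume "e > 0"
    then have "\<bar>?D\<bar> \<le> e / (?K + 1) * ?K" using \<open>?K \<ge> 0\<close> by (intro bd divide_pos_pos) linarith+
    also have "e / (K + 1) * K \<le> e" if "K \<ge> 0" for K :: real
      using that \<open>e > 0\<close> by (simp add: field_simps)
    note this[OF \<open>?K \<ge> 0\<close>]
    finally show "\<bar>?D\<bar> \<le> 0 + e" by simp
  qed
  then show ?thesis by simp
qed

section \<open>Smooth test functions\<close>

lemma partial_eqI: "(\<phi> has_derivative \<phi>') (at x) \<Longrightarrow> partial b \<phi> x = \<phi>' b"
  unfolding partial_def using frechet_derivative_at by metis

lemma partial_add:
  assumes "\<And>x. f differentiable (at x)" "\<And>x. g differentiable (at x)"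
  shows "partial b (\<lambda>x. f x + g x) = (\<lambda>x. partial b f x + partial b g x)"
proof
  fix x
  have "((\<lambda>x. f x + g x) has_derivative (\<lambda>h. frechet_derivative f (at x) h + frechet_derivative g (at x) h)) (at x)"
    using assms by (intro has_derivative_add) (auto simp: frechet_derivative_works[symmetric])
  then show "partial b (\<lambda>x. f x + g x) x = partial b f x + partial b g x"
    by (simp add: partial_eqI) (simp add: partial_def)
qed

lemma partial_mult:
  assumes "\<And>x. f differentiable (at x)" "\<And>x. g differentiable (at x)"
  shows "partial b (\<lambda>x. f x * g x) = (\<lambda>x. f x * partial b g x + partial b f x * g x)"
proof
  fix x
  have "((\<lambda>x. f x * g x) has_derivative (\<lambda>h. f x * frechet_derivative g (at x) h + frechet_derivative f (at x) h * g x)) (at x)"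
    using assms by (intro has_derivative_mult) (auto simp: frechet_derivative_works[symmetric])
  then show "partial b (\<lambda>x. f x * g x) x = f x * partial b g x + partial b f x * g x"
    by (simp add: partial_eqI) (simp add: partial_def)
qed

lemma partial_const [simp]: "partial b (\<lambda>x. c) = (\<lambda>x. 0)"
  by (rule ext) (simp add: partial_eqI[OF has_derivative_const])

lemma partial_inner [simp]: "partial b (\<lambda>x. a \<bullet> x) = (\<lambda>x. a \<bullet> b)"
  by (rule ext) (rule partial_eqI, auto intro!: derivative_eq_intros)

lemma C_k_SucD: "C_k (Suc m) \<phi> \<Longrightarrow> C_k m \<phi>"
proof (induction m arbitrary: \<phi>)
  case 0
  then show ?case
    by (auto intro!: continuous_at_imp_continuous_on differentiable_imp_continuous_within)
next
  case (Suc m)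
  then show ?case by (metis C_k.simps(2))
qed

lemma C_k_const [simp]: "C_k m (\<lambda>x. c)"
  by (induction m arbitrary: c) auto

lemma C_k_inner [simp]: "C_k m (\<lambda>x. a \<bullet> x)"
  by (cases m) (auto intro!: continuous_intros simp: differentiable_def intro: bounded_linear_imp_has_derivative bounded_linear_inner_right)

lemma C_k_add: "C_k m f \<Longrightarrow> C_k m g \<Longrightarrow> C_k m (\<lambda>x. f x + g x)"
  by (induction m arbitrary: f g) (auto intro!: continuous_intros simp: partial_add)

lemma C_k_mult: "C_k m f \<Longrightarrow> C_k m g \<Longrightarrow> C_k m (\<lambda>x. f x * g x)"
proof (induction m arbitrary: f g)
  case 0
  then show ?case by (auto intro!: continuous_intros)
next
  case (Suc m)
  have "C_k m f" "C_k m g" using Suc.prems by (auto dest: C_k_SucD simp del: C_k.simps)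
  then show ?case using Suc.prems by (auto simp: partial_mult intro!: C_k_add Suc.IH)
qed

definition smooth :: "('a::euclidean_space \<Rightarrow> real) \<Rightarrow> bool" where
  "smooth \<phi> \<longleftrightarrow> (\<forall>m. C_k m \<phi>)"

lemma smooth_differentiable: "smooth \<phi> \<Longrightarrow> \<phi> differentiable (at x)"
  unfolding smooth_def by (metis C_k.simps(2))

lemma smooth_partial: "smooth \<phi> \<Longrightarrow> b \<in> Basis \<Longrightarrow> smooth (partial b \<phi>)"
  unfolding smooth_def by (metis C_k.simps(2))

lemma smooth_const: "smooth (\<lambda>x. c)" and smooth_inner: "smooth (\<lambda>x. a \<bullet> x)"
  and smooth_add: "smooth f \<Longrightarrow> smooth g \<Longrightarrow> smooth (\<lambda>x. f x + g x)"
  and smooth_mult: "smooth f \<Longrightarrow> smooth g \<Longrightarrow> smooth (\<lambda>x. f x * g x)"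
  by (auto simp: smooth_def intro: C_k_add C_k_mult)

lemma smooth_sum: "(\<And>i. i \<in> I \<Longrightarrow> smooth (f i)) \<Longrightarrow> smooth (\<lambda>x. \<Sum>i\<in>I. f i x)"
  by (induction I rule: infinite_finite_induct) (auto intro: smooth_const smooth_add)

lemma smooth_power: "smooth f \<Longrightarrow> smooth (\<lambda>x. f x ^ k)"
  by (induction k) (auto intro: smooth_const smooth_mult)

lemma smooth_laplacian: "smooth \<phi> \<Longrightarrow> smooth (laplacian \<phi>)"
  unfolding laplacian_def by (intro smooth_sum smooth_partial) auto

lemma laplacian_add:
  assumes "smooth f" "smooth g"
  shows "laplacian (\<lambda>x. f x + g x) = (\<lambda>x. laplacian f x + laplacian g x)"
  using assms by (auto simp: laplacian_def partial_add smooth_differentiable smooth_partial sum.distrib)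

lemma laplacian_cmult:
  fixes f :: "'a::euclidean_space \<Rightarrow> real"
  assumes "smooth f"
  shows "laplacian (\<lambda>x. c * f x) = (\<lambda>x. c * laplacian f x)"
proof -
  have c: "partial b (\<lambda>x. c * g x) = (\<lambda>x. c * partial b g x)" if "smooth g" for b and g :: "'a \<Rightarrow> real"
    using that by (subst partial_mult) (auto simp: smooth_differentiable)
  have "partial b (partial b (\<lambda>x. c * f x)) = (\<lambda>x. c * partial b (partial b f) x)" if "b \<in> Basis" for b
    unfolding c[OF assms] by (rule c[OF smooth_partial[OF assms that]])
  then show ?thesis by (simp add: laplacian_def sum_distrib_left)
qed

lemma laplacian_funpow_linear:
  "smooth f \<Longrightarrow> smooth g \<Longrightarrow>
    (laplacian ^^ k) (\<lambda>x. f x + c * g x) = (\<lambda>x. (laplacian ^^ k) f x + c * (laplacian ^^ k) g x)"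
proof (induction k arbitrary: f g)
  case (Suc k)
  have s: "smooth (laplacian f)" "smooth (laplacian g)" using Suc.prems by (auto intro: smooth_laplacian)
  have "laplacian (\<lambda>x. f x + c * g x) = (\<lambda>x. laplacian f x + c * laplacian g x)"
    using Suc.prems by (subst laplacian_add) (auto intro: smooth_mult smooth_const simp: laplacian_cmult)
  then show ?case using Suc.IH[OF s] by (simp add: funpow_Suc_right del: funpow.simps)
qed simp

section \<open>Smooth functions of one variable and bump functions\<close>

text \<open>Order 0 asks for nothing: for \<open>smooth1\<close> continuity follows from
  differentiability.\<close>

primrec C1_k :: "nat \<Rightarrow> (real \<Rightarrow> real) \<Rightarrow> bool" where
  "C1_k 0 h \<longleftrightarrow> True"
| "C1_k (Suc m) h \<longleftrightarrow> (\<forall>t. h field_differentiable (at t)) \<and> C1_k m (deriv h)"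

lemma C1_k_SucD: "C1_k (Suc m) h \<Longrightarrow> C1_k m h"
  by (induction m arbitrary: h) auto

lemma C1_k_const [simp]: "C1_k m (\<lambda>t. c)"
  by (induction m arbitrary: c) auto

lemma C1_k_id [simp]: "C1_k m (\<lambda>t. t)"
  by (cases m) auto

lemma C1_k_add: "C1_k m f \<Longrightarrow> C1_k m g \<Longrightarrow> C1_k m (\<lambda>x. f x + g x)"
proof (induction m arbitrary: f g)
  case (Suc m)
  then have "deriv (\<lambda>x. f x + g x) = (\<lambda>x. deriv f x + deriv g x)" by auto
  then show ?case using Suc by (auto intro: field_differentiable_add)
qed simp

lemma C1_k_mult: "C1_k m f \<Longrightarrow> C1_k m g \<Longrightarrow> C1_k m (\<lambda>x. f x * g x)"
proof (induction m arbitrary: f g)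
  case (Suc m)
  then have "deriv (\<lambda>x. f x * g x) = (\<lambda>x. f x * deriv g x + deriv f x * g x)" by auto
  moreover have "C1_k m f" "C1_k m g" using Suc.prems by (auto dest: C1_k_SucD simp del: C1_k.simps)
  ultimately show ?case using Suc by (auto intro!: field_differentiable_mult C1_k_add)
qed simp

lemma C1_k_compose: "C1_k m f \<Longrightarrow> C1_k m g \<Longrightarrow> C1_k m (\<lambda>x. f (g x))"
proof (induction m arbitrary: f)
  case (Suc m)
  then have d: "f field_differentiable at x" "g field_differentiable at x" for x by auto
  have c: "((\<lambda>x. f (g x)) has_field_derivative deriv f (g x) * deriv g x) (at x)" for x
    using DERIV_chain2[OF d(1)[THEN field_differentiable_derivI] d(2)[THEN field_differentiable_derivI]] .
  then have "deriv (\<lambda>x. f (g x)) = (\<lambda>x. deriv f (g x) * deriv g x)" by (auto intro: DERIV_imp_deriv)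
  moreover have "C1_k m g" using Suc.prems by (auto dest: C1_k_SucD simp del: C1_k.simps)
  ultimately show ?case using Suc c by (auto simp: field_differentiable_def intro!: C1_k_mult)
qed simp

definition smooth1 :: "(real \<Rightarrow> real) \<Rightarrow> bool" where
  "smooth1 h \<longleftrightarrow> (\<forall>m. C1_k m h)"

lemma smooth1_DERIV: "smooth1 h \<Longrightarrow> (h has_real_derivative deriv h t) (at t)"
  unfolding smooth1_def by (metis C1_k.simps(2) field_differentiable_derivI)

lemma smooth1_deriv: "smooth1 h \<Longrightarrow> smooth1 (deriv h)"
  unfolding smooth1_def by (metis C1_k.simps(2))

lemma smooth1_isCont: "smooth1 h \<Longrightarrow> isCont h t"
  using smooth1_DERIV DERIV_isCont by blast

lemma smooth1_compose_has_derivative: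
  assumes "smooth1 h" "smooth w"
  shows "((\<lambda>x. h (w x)) has_derivative (\<lambda>v. deriv h (w x) * frechet_derivative w (at x) v)) (at x)"
proof -
  have "(w has_derivative frechet_derivative w (at x)) (at x)"
    using smooth_differentiable[OF assms(2)] by (simp add: frechet_derivative_works[symmetric])
  from has_derivative_compose[OF this, of h "(*) (deriv h (w x))"] show ?thesis
    using smooth1_DERIV[OF assms(1)] by (simp add: has_field_derivative_def)
qed

lemma smooth_compose:
  assumes "smooth1 h" "smooth w"
  shows "smooth (\<lambda>x. h (w x))"
  unfolding smooth_def
proof
  fix m show "C_k m (\<lambda>x. h (w x))"
    using assms(1)
  proof (induction m arbitrary: h)
    case 0
    then show ?case
      using smooth1_compose_has_derivative[OF 0 assms(2)]
      by (auto intro!: continuous_at_imp_continuous_on has_derivative_continuous)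
  next
    case (Suc m)
    note d = smooth1_compose_has_derivative[OF Suc.prems assms(2)]
    have "partial b (\<lambda>x. h (w x)) = (\<lambda>x. deriv h (w x) * partial b w x)" for b
    proof
      fix x
      have "partial b w x = frechet_derivative w (at x) b" by (simp add: partial_def)
      then show "partial b (\<lambda>x. h (w x)) x = deriv h (w x) * partial b w x"
        using partial_eqI[OF d, of b x] by simp
    qed
    moreover have "C_k m (\<lambda>x. deriv h (w x))" by (rule Suc.IH[OF smooth1_deriv[OF Suc.prems]])
    ultimately show ?case
      using d assms(2) by (auto simp: differentiable_def smooth_def intro!: C_k_mult) (metis C_k.simps(2))+
  qed
qed

lemma poly_exp_tendsto_0: "((\<lambda>y::real. poly p y * exp (- y)) \<longlongrightarrow> 0) at_top"
proof -
  have "((\<lambda>y::real. \<Sum>i\<le>degree p. coeff p i * (y ^ i / exp y)) \<longlongrightarrow> (\<Sum>i\<le>degree p. coeff p i * 0)) at_top"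
    by (intro tendsto_intros tendsto_power_div_exp_0)
  then show ?thesis
    by (simp add: poly_altdef sum_distrib_right exp_minus divide_inverse mult.assoc)
qed

text \<open>A family containing exp(-1/t) and closed under differentiation: the derivative has the
  polynomial X^2 (p - p'). Smoothness therefore follows by induction on the order, simultaneously
  for all p.\<close>

definition flat :: "real poly \<Rightarrow> real \<Rightarrow> real" where
  "flat p t = (if t > 0 then poly p (1 / t) * exp (- 1 / t) else 0)"

lemma flat_deriv:
  "(flat p has_real_derivative flat ([:0, 0, 1:] * (p - pderiv p)) t) (at t)"
proof -
  consider "t > 0" | "t < 0" | "t = 0" by linarith
  then show ?thesis
  proof cases
    case 1
    have "((\<lambda>t. poly p (1 / t) * exp (- 1 / t)) has_real_derivative flat ([:0, 0, 1:] * (p - pderiv p)) t) (at t)"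
      using 1 by (auto intro!: derivative_eq_intros simp: flat_def field_simps power2_eq_square)
    then show ?thesis
    proof (rule has_field_derivative_transform_within_open[where S = "{0<..}"])
      show "poly p (1 / s) * exp (- 1 / s) = flat p s" if "s \<in> {0<..}" for s
        using that by (simp add: flat_def)
    qed (use 1 in auto)
  next
    case 2
    have "((\<lambda>t. 0) has_real_derivative flat ([:0, 0, 1:] * (p - pderiv p)) t) (at t)"
      using 2 by (simp add: flat_def)
    then show ?thesis
      by (rule has_field_derivative_transform_within_open[where S = "{..<0}"]) (use 2 in \<open>auto simp: flat_def\<close>)
  next
    case 3
    have "((\<lambda>s. (flat p s - flat p 0) / (s - 0)) \<longlongrightarrow> 0) (at 0)"
    proof (subst filterlim_at_split, rule conjI)
      have "eventually (\<lambda>s::real. (flat p s - flat p 0) / (s - 0) = 0) (at_left 0)"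
        by (simp add: eventually_at_filter flat_def)
      then show "((\<lambda>s. (flat p s - flat p 0) / (s - 0)) \<longlongrightarrow> 0) (at_left 0)"
        by (rule tendsto_eventually)
      \<comment> \<open>\<open>pCons 0 p\<close> is X p: dividing by s multiplies a polynomial in
        1/s by its variable.\<close>
      have "((\<lambda>s::real. poly (pCons 0 p) (inverse s) * exp (- inverse s)) \<longlongrightarrow> 0) (at_right 0)"
        by (rule filterlim_compose[OF poly_exp_tendsto_0 filterlim_inverse_at_top_right])
      moreover have "eventually (\<lambda>s::real. poly (pCons 0 p) (inverse s) * exp (- inverse s) = (flat p s - flat p 0) / (s - 0)) (at_right 0)"
        using eventually_at_right_less[of 0] by eventually_elim (auto simp: flat_def field_simps)
      ultimately show "((\<lambda>s. (flat p s - flat p 0) / (s - 0)) \<longlongrightarrow> 0) (at_right 0)"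
        by (rule Lim_transform_eventually)
    qed
    then show ?thesis using 3 by (simp add: has_field_derivative_iff flat_def)
  qed
qed

lemma smooth1_flat: "smooth1 (flat p)"
proof -
  have "C1_k m (flat p)" for m
  proof (induction m arbitrary: p)
    case (Suc m)
    have "deriv (flat p) = flat ([:0, 0, 1:] * (p - pderiv p))"
      by (rule ext) (rule DERIV_imp_deriv[OF flat_deriv])
    then show ?case using Suc flat_deriv by (auto simp: field_differentiable_def simp del: mult_pCons_left)
  qed simp
  then show ?thesis by (simp add: smooth1_def)
qed

text \<open>No sign is required, so the class is closed under derivatives and under products with
  smooth functions, which is what repeated Laplacians of h(|x|^2) produce. The support in [1, 2]
  keeps the test functions away from the origin.\<close>

definition bump :: "(real \<Rightarrow> real) \<Rightarrow> bool" where
  "bump h \<longleftrightarrow> smooth1 h \<and> (\<forall>t. t \<notin> {1..2} \<longrightarrow> h t = 0)"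

lemma bump_deriv: "bump h \<Longrightarrow> bump (deriv h)"
  unfolding bump_def
proof (safe intro!: smooth1_deriv)
  fix t :: real assume h: "smooth1 h" "\<forall>t. t \<notin> {1..2} \<longrightarrow> h t = 0" and t: "t \<notin> {1..2}"
  have "((\<lambda>_. 0) has_real_derivative 0) (at t)" by simp
  then have "(h has_real_derivative 0) (at t)"
    by (rule has_field_derivative_transform_within_open[where S = "- {1..2}"]) (use h t in auto)
  then show "deriv h t = 0" by (rule DERIV_imp_deriv)
qed

lemma bump_add: "bump f \<Longrightarrow> bump g \<Longrightarrow> bump (\<lambda>t. f t + g t)"
  by (auto simp: bump_def smooth1_def intro: C1_k_add)

lemma bump_mult: "smooth1 g \<Longrightarrow> bump f \<Longrightarrow> bump (\<lambda>t. g t * f t)"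
  by (auto simp: bump_def smooth1_def intro: C1_k_mult)

lemma smooth1_const: "smooth1 (\<lambda>t. c)" and smooth1_id: "smooth1 (\<lambda>t. t)"
  by (auto simp: smooth1_def)

lemma bump_exists: "\<exists>h. bump h \<and> (\<forall>t. h t \<ge> 0) \<and> (\<forall>t\<in>{1<..<2}. h t > 0)"
proof (intro exI conjI allI ballI)
  let ?h = "\<lambda>t. flat 1 ((t + - 1) * (2 + - 1 * t))"
  have "smooth1 ?h"
    unfolding smooth1_def
  proof
    fix m
    have "C1_k m (\<lambda>t. (t + - 1) * (2 + - 1 * t))"
      by (rule C1_k_mult[OF C1_k_add[OF C1_k_id C1_k_const] C1_k_add[OF C1_k_const C1_k_mult[OF C1_k_const C1_k_id]]])
    then show "C1_k m ?h"
      using smooth1_flat[of 1] C1_k_compose[of m "flat 1"] by (simp add: smooth1_def)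
  qed
  moreover have "?h t = 0" if "t \<notin> {1..2}" for t
  proof -
    have "(t + - 1) * (2 + - 1 * t) \<le> 0" using that by (auto simp: mult_le_0_iff)
    then show ?thesis by (simp add: flat_def)
  qed
  ultimately show "bump ?h" by (auto simp: bump_def)
  show "?h t \<ge> 0" for t by (auto simp: flat_def)
  show "?h t > 0" if "t \<in> {1<..<2}" for t using that by (auto simp: flat_def)
qed

text \<open>\<open>radial_int h \<alpha> = \<integral>\<^sub>0\<^sup>\<infinity> r\<^sup>\<alpha>\<^sup>-\<^sup>1 h(r\<^sup>2) dr\<close>, as \<open>h\<close> is supported in \<open>[1, 2]\<close>.\<close>

definition radial_int :: "(real \<Rightarrow> real) \<Rightarrow> real \<Rightarrow> real" where
  "radial_int h \<alpha> = (\<integral>r. r powr (\<alpha> - 1) * h (r\<^sup>2) * indicator {1/2..3} r \<partial>lborel)"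

lemma bump_square_zero: "bump h \<Longrightarrow> r \<notin> {1/2..3} \<Longrightarrow> r > 0 \<Longrightarrow> h (r\<^sup>2) = 0"
proof -
  assume h: "bump h" and r: "r \<notin> {1/2..3}" "r > 0"
  have "r\<^sup>2 < 1 \<or> r\<^sup>2 > 2"
  proof (cases "r < 1/2")
    case True
    then have "r\<^sup>2 < 1\<^sup>2" using r by (intro power_strict_mono) auto
    then show ?thesis by simp
  next
    case False
    then have "3\<^sup>2 < r\<^sup>2" using r by (intro power_strict_mono) auto
    then show ?thesis by simp
  qed
  then show ?thesis using h by (auto simp: bump_def)
qed

lemma radial_int_integrable:
  assumes h: "bump h"
  shows "integrable lborel (\<lambda>r. r powr (\<alpha> - 1) * h (r\<^sup>2) * indicator {1/2..3} r)"
proof -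
  have c: "isCont h t" for t using h by (auto simp: bump_def intro: smooth1_isCont)
  have "continuous_on {1/2..3} (\<lambda>r::real. h (r\<^sup>2))"
    by (rule continuous_on_compose2[of UNIV h]) (auto intro!: continuous_at_imp_continuous_on continuous_intros simp: c)
  then have "continuous_on {1/2..3} (\<lambda>r. r powr (\<alpha> - 1) * h (r\<^sup>2))"
    by (intro continuous_on_mult) (auto intro!: continuous_intros)
  from borel_integrable_compact[OF compact_Icc this] show ?thesis
    by (simp add: mult.commute)
qed

lemma radial_int_set_integral:
  assumes h: "bump h"
  shows "set_integrable lborel {0<..} (\<lambda>r. r powr (\<alpha> - 1) * h (r\<^sup>2))"
    and "(LINT r:{0<..}|lborel. r powr (\<alpha> - 1) * h (r\<^sup>2)) = radial_int h \<alpha>"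
proof -
  have "(\<lambda>r. indicator {0<..} r *\<^sub>R (r powr (\<alpha> - 1) * h (r\<^sup>2))) = (\<lambda>r. r powr (\<alpha> - 1) * h (r\<^sup>2) * indicator {1/2..3} r)"
    using bump_square_zero[OF h] by (auto simp: fun_eq_iff indicator_def)
  then show "set_integrable lborel {0<..} (\<lambda>r. r powr (\<alpha> - 1) * h (r\<^sup>2))"
    "(LINT r:{0<..}|lborel. r powr (\<alpha> - 1) * h (r\<^sup>2)) = radial_int h \<alpha>"
    using radial_int_integrable[OF h] by (simp_all add: set_integrable_def set_lebesgue_integral_def radial_int_def)
qed

lemma radial_int_pos:
  assumes h: "bump h" and nn: "\<And>t. h t \<ge> 0" and pos: "\<And>t. t \<in> {1<..<2} \<Longrightarrow> h t > 0"
  shows "radial_int h \<alpha> > 0"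
proof -
  have "radial_int h \<alpha> \<noteq> 0"
  proof
    assume "radial_int h \<alpha> = 0"
    then have "AE r in lborel. r powr (\<alpha> - 1) * h (r\<^sup>2) * indicator {1/2..3} r = 0"
      unfolding radial_int_def
      by (subst (asm) integral_nonneg_eq_0_iff_AE) (use radial_int_integrable[OF h] nn in auto)
    then have "AE r in lborel. r \<notin> {1<..<5/4::real}"
    proof eventually_elim
      case (elim r)
      show ?case
      proof
        assume r: "r \<in> {1<..<5/4}"
        then have "1\<^sup>2 < r\<^sup>2" "r\<^sup>2 < (5/4)\<^sup>2" by (intro power_strict_mono; simp)+
        then have "r\<^sup>2 \<in> {1<..<2}" by (simp add: power2_eq_square)
        then show False using pos[of "r\<^sup>2"] elim r by (auto simp: indicator_def)
      qed
    qed
    then show False using not_AE_interval[of 1 "5/4"] by simp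
  qed
  moreover have "radial_int h \<alpha> \<ge> 0"
    unfolding radial_int_def by (intro integral_nonneg_AE) (use nn in auto)
  ultimately show ?thesis by simp
qed

text \<open>For c = 2n + 4l the left integrand is the radial factor of the Laplacian of h(|x|^2)
  times a monomial of degree l; moving the derivatives onto the power of r shows how that Laplacian
  acts on radial integrals.\<close>

lemma radial_int_by_parts:
  assumes h: "bump h"
  shows "radial_int (\<lambda>t. 4 * t * deriv (deriv h) t + c * deriv h t) \<alpha> = (2 * \<alpha> - c) / 2 * (\<alpha> - 2) * radial_int h (\<alpha> - 2)"
proof -
  define h1 where "h1 = deriv h"
  define h2 where "h2 = deriv h1"
  have b1: "bump h1" unfolding h1_def using h by (rule bump_deriv)
  have b2: "bump h2" unfolding h2_def using b1 by (rule bump_deriv)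
  have D: "(h has_real_derivative h1 t) (at t)" "(h1 has_real_derivative h2 t) (at t)" for t
    unfolding h2_def using h b1 by (auto simp: bump_def h1_def intro: smooth1_DERIV)
  have c: "isCont h t" "isCont h1 t" "isCont h2 t" for t using h b1 b2 by (auto simp: bump_def intro: smooth1_isCont)
  \<comment> \<open>The first summand produces the h'' term together with 2\<alpha> r^(\<alpha>-1)
    h'; the second corrects the coefficient 2\<alpha> to c and leaves a multiple of h. At both
    endpoints h and h' vanish.\<close>
  let ?G = "\<lambda>r. 2 * r powr \<alpha> * h1 (r\<^sup>2) + (c - 2 * \<alpha>) / 2 * r powr (\<alpha> - 2) * h (r\<^sup>2)"
  let ?g = "\<lambda>r. r powr (\<alpha> - 1) * (4 * r\<^sup>2 * h2 (r\<^sup>2) + c * h1 (r\<^sup>2)) + (c - 2 * \<alpha>) / 2 * (\<alpha> - 2) * (r powr (\<alpha> - 2 - 1) * h (r\<^sup>2))"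
  have "(\<integral>r. ?g r * indicator {1/2..3} r \<partial>lborel) = ?G 3 - ?G (1/2)"
  proof (rule integral_FTC_Icc_real)
    fix r :: real assume r: "1/2 \<le> r" "r \<le> 3"
    define X where "X = r powr (\<alpha> - 2 - 1)"
    have p: "r powr (\<alpha> - 2) = r * X" "r powr (\<alpha> - 1) = r * r * X" "r powr \<alpha> = r * r * r * X"
      using r by (simp_all add: X_def powr_diff power2_eq_square power3_eq_cube)
    show "(?G has_real_derivative ?g r) (at r)"
    proof -
      have sq: "((\<lambda>r. r\<^sup>2) has_real_derivative 2 * r) (at r)" by (auto intro!: derivative_eq_intros)
      note d1 = DERIV_chain2[OF D(1) sq] and d2 = DERIV_chain2[OF D(2) sq]
      have "(?G has_real_derivative
          (2 * (\<alpha> * r powr (\<alpha> - 1))) * h1 (r\<^sup>2) + (h2 (r\<^sup>2) * (2 * r)) * (2 * r powr \<alpha>)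
          + (((c - 2 * \<alpha>) / 2 * ((\<alpha> - 2) * r powr (\<alpha> - 2 - 1))) * h (r\<^sup>2) + (h1 (r\<^sup>2) * (2 * r)) * ((c - 2 * \<alpha>) / 2 * r powr (\<alpha> - 2)))) (at r)"
        using r by (intro DERIV_add DERIV_mult d1 d2 DERIV_cmult has_real_derivative_powr) auto
      then show ?thesis
        by (rule DERIV_cong) (simp add: p X_def[symmetric] algebra_simps power2_eq_square diff_divide_distrib)
    qed
    have "isCont (\<lambda>r. r\<^sup>2) r" by (intro continuous_intros)
    then have "isCont (\<lambda>r. h (r\<^sup>2)) r" "isCont (\<lambda>r. h1 (r\<^sup>2)) r" "isCont (\<lambda>r. h2 (r\<^sup>2)) r"
      using isCont_o2 c by blast+
    moreover have "isCont (\<lambda>r. r powr (\<alpha> - 1)) r" "isCont (\<lambda>r. r powr (\<alpha> - 2 - 1)) r"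
      using r by (auto intro!: continuous_intros)
    ultimately show "isCont ?g r"
      by (simp add: continuous_intros)
  qed simp
  also have "\<dots> = 0"
    using bump_def b1 h by (simp add: bump_def power2_eq_square)
  finally have 0: "(\<integral>r. ?g r * indicator {1/2..3} r \<partial>lborel) = 0" .
  have bb: "bump (\<lambda>t. 4 * t * h2 t + c * h1 t)"
    using bump_add[OF bump_mult[OF _ b2, of "\<lambda>t. 4 * t"] bump_mult[OF smooth1_const b1, of c]]
    by (simp add: smooth1_def C1_k_mult)
  have "(\<integral>r. ?g r * indicator {1/2..3} r \<partial>lborel)
     = (\<integral>r. (r powr (\<alpha> - 1) * (4 * r\<^sup>2 * h2 (r\<^sup>2) + c * h1 (r\<^sup>2)) * indicator {1/2..3} r)
        + (c - 2 * \<alpha>) / 2 * (\<alpha> - 2) * (r powr (\<alpha> - 2 - 1) * h (r\<^sup>2) * indicator {1/2..3} r) \<partial>lborel)"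
    by (simp add: distrib_right mult.assoc)
  also have "\<dots> = radial_int (\<lambda>t. 4 * t * h2 t + c * h1 t) \<alpha> + (c - 2 * \<alpha>) / 2 * (\<alpha> - 2) * radial_int h (\<alpha> - 2)"
    unfolding radial_int_def
    using radial_int_integrable[OF bb, of \<alpha>] radial_int_integrable[OF h, of "\<alpha> - 2"]
    by (subst Bochner_Integration.integral_add) auto
  finally show ?thesis
    using 0 unfolding h2_def h1_def by (simp add: algebra_simps diff_divide_distrib)
qed

text \<open>Product rule: the Laplacian of the radial factor, the cross term of the gradients, and
  the Laplacian of the monomial, which lowers its degree by 2.\<close>

lemma laplacian_radial_power:
  fixes a :: "'a::euclidean_space"
  assumes h: "smooth1 h"
  defines "P \<equiv> \<lambda>l x. (a \<bullet> x) ^ l / fact l"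
  shows "laplacian (\<lambda>x. h (x \<bullet> x) * P l x) x
       = (4 * (x \<bullet> x) * deriv (deriv h) (x \<bullet> x) + (2 * DIM('a) + 4 * l) * deriv h (x \<bullet> x)) * P l x
         + (norm a)\<^sup>2 * (h (x \<bullet> x) * (if l < 2 then 0 else P (l - 2) x))"
proof -
  define Q where "Q l x = (if l = 0 then 0 else P (l - 1) x)" for l x
  have D: "(h has_real_derivative deriv h t) (at t)" if "smooth1 h" for h :: "real \<Rightarrow> real" and t
    using that by (rule smooth1_DERIV)
  have dP: "(P l has_derivative (\<lambda>v. (a \<bullet> v) * Q l x)) (at x)" for l x
  proof (cases l)
    case (Suc m)
    have "((\<lambda>t::real. t ^ Suc m / fact (Suc m)) has_real_derivative t ^ m / fact m) (at t)" for t
      by (rule DERIV_cong[OF DERIV_cdivide[OF DERIV_pow]]) (simp add: field_simps del: of_nat_Suc)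
    then have "((\<lambda>t::real. t ^ Suc m / fact (Suc m)) has_derivative (*) ((a \<bullet> x) ^ m / fact m)) (at (a \<bullet> x))"
      by (simp add: has_field_derivative_def)
    from has_derivative_compose[OF bounded_linear_imp_has_derivative[OF bounded_linear_inner_right], where s = UNIV, OF this]
    have "(P l has_derivative (\<lambda>v. (a \<bullet> x) ^ m / fact m * (a \<bullet> v))) (at x)"
      unfolding P_def Suc .
    then show ?thesis
      by (rule has_derivative_eq_rhs) (simp add: fun_eq_iff P_def Q_def Suc mult.commute)
  qed (simp add: P_def Q_def)
  have dh: "((\<lambda>x. g (x \<bullet> x)) has_derivative (\<lambda>v. deriv g (x \<bullet> x) * (2 * (x \<bullet> v)))) (at x)" if "smooth1 g" for g and x :: 'a
  proof -
    have "((\<lambda>x. x \<bullet> x) has_derivative (\<lambda>v. 2 * (x \<bullet> v))) (at x)"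
      by (auto intro!: derivative_eq_intros simp: inner_commute)
    from has_derivative_compose[OF this, of g "(*) (deriv g (x \<bullet> x))"] show ?thesis
      using D[OF that] by (simp add: has_field_derivative_def)
  qed
  have p1: "partial b (\<lambda>x. h (x \<bullet> x) * P l x) = (\<lambda>x. h (x \<bullet> x) * ((a \<bullet> b) * Q l x) + deriv h (x \<bullet> x) * (2 * (x \<bullet> b)) * P l x)" for b
    by (rule ext, rule partial_eqI) (rule has_derivative_mult[OF dh[OF h] dP])
  have dQ: "(Q l has_derivative (\<lambda>v. (a \<bullet> v) * (if l = 0 then 0 else Q (l - 1) x))) (at x)" for l x
    using dP[of "l - 1"] by (cases "l = 0") (simp_all add: Q_def[abs_def])
  have p2: "partial b (partial b (\<lambda>x. h (x \<bullet> x) * P l x)) x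
     = (h (x \<bullet> x) * ((a \<bullet> b) * ((a \<bullet> b) * (if l = 0 then 0 else Q (l - 1) x))) + deriv h (x \<bullet> x) * (2 * (x \<bullet> b)) * ((a \<bullet> b) * Q l x))
       + (deriv h (x \<bullet> x) * (2 * (x \<bullet> b)) * ((a \<bullet> b) * Q l x)
          + (deriv h (x \<bullet> x) * (2 * (b \<bullet> b)) + deriv (deriv h) (x \<bullet> x) * (2 * (x \<bullet> b)) * (2 * (x \<bullet> b))) * P l x)" for b
    unfolding p1
  proof (rule partial_eqI[THEN trans])
    show "((\<lambda>x. h (x \<bullet> x) * ((a \<bullet> b) * Q l x) + deriv h (x \<bullet> x) * (2 * (x \<bullet> b)) * P l x) has_derivative
      (\<lambda>v. (h (x \<bullet> x) * ((a \<bullet> b) * ((a \<bullet> v) * (if l = 0 then 0 else Q (l - 1) x))) + deriv h (x \<bullet> x) * (2 * (x \<bullet> v)) * ((a \<bullet> b) * Q l x))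
       + (deriv h (x \<bullet> x) * (2 * (x \<bullet> b)) * ((a \<bullet> v) * Q l x)
          + (deriv h (x \<bullet> x) * (2 * (v \<bullet> b)) + deriv (deriv h) (x \<bullet> x) * (2 * (x \<bullet> v)) * (2 * (x \<bullet> b))) * P l x))) (at x)"
      by (intro has_derivative_add has_derivative_mult dh dP h smooth1_deriv has_derivative_mult_right dQ)
         (auto intro!: derivative_eq_intros)
  qed simp
  have Q2: "(if l = 0 then 0 else Q (l - 1) x) = (if l < 2 then 0 else P (l - 2) x)"
    by (auto simp: Q_def numeral_2_eq_2)
  \<comment> \<open>Euler's relation for the homogeneous monomial; it turns the cross term into the
    summand 4 l h'.\<close>
  have aQ: "(a \<bullet> x) * Q l x = l * P l x"
    by (cases l) (auto simp: Q_def P_def field_simps simp del: of_nat_Suc)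
  have s1: "(\<Sum>b\<in>Basis. (a \<bullet> b) * (a \<bullet> b)) = (norm a)\<^sup>2"
    by (simp add: power2_norm_eq_inner euclidean_inner[of a a])
  have s2: "(\<Sum>b\<in>Basis. (x \<bullet> b) * (a \<bullet> b)) = a \<bullet> x" by (simp add: euclidean_inner[of a x] mult.commute)
  have s3: "(\<Sum>b\<in>Basis. (x \<bullet> b) * (x \<bullet> b)) = x \<bullet> x" by (simp add: euclidean_inner[of x x])
  have "laplacian (\<lambda>x. h (x \<bullet> x) * P l x) x
     = (\<Sum>b\<in>Basis. h (x \<bullet> x) * (if l = 0 then 0 else Q (l - 1) x) * ((a \<bullet> b) * (a \<bullet> b))
        + 4 * deriv h (x \<bullet> x) * Q l x * ((x \<bullet> b) * (a \<bullet> b))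
        + 2 * deriv h (x \<bullet> x) * P l x
        + 4 * deriv (deriv h) (x \<bullet> x) * P l x * ((x \<bullet> b) * (x \<bullet> b)))"
    unfolding laplacian_def p2 by (rule sum.cong) (auto simp: algebra_simps)
  also have "\<dots> = h (x \<bullet> x) * (if l = 0 then 0 else Q (l - 1) x) * (norm a)\<^sup>2
        + 4 * deriv h (x \<bullet> x) * ((a \<bullet> x) * Q l x)
        + DIM('a) * (2 * deriv h (x \<bullet> x) * P l x)
        + 4 * deriv (deriv h) (x \<bullet> x) * P l x * (x \<bullet> x)"
    unfolding sum.distrib sum_distrib_left[symmetric] s1 s2 s3 by simp
  finally show ?thesis unfolding aQ Q2 by (simp add: algebra_simps)
qed

section \<open>Moments of the Laplacian of a homogeneous function\<close>

lemma smooth_laplacian_funpow: "smooth \<phi> \<Longrightarrow> smooth ((laplacian ^^ k) \<phi>)"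
  by (induction k) (auto intro: smooth_laplacian)

lemma smooth_borel_measurable: "smooth \<phi> \<Longrightarrow> \<phi> \<in> borel_measurable borel"
  unfolding smooth_def by (metis C_k.simps(1) borel_measurable_continuous_onI)

lemma smooth_norm_square: "smooth (\<lambda>x::'a::euclidean_space. x \<bullet> x)"
proof -
  have "smooth (\<lambda>x::'a. \<Sum>b\<in>Basis. (b \<bullet> x) * (b \<bullet> x))"
    by (intro smooth_sum smooth_mult smooth_inner)
  then show ?thesis by (simp add: inner_commute flip: euclidean_inner)
qed

lemma smooth_zonal: "smooth (zonal b m)"
proof -
  have "smooth (\<lambda>x. (b \<bullet> x) ^ (2 * m) * (1 / fact (2 * m)))"
    by (intro smooth_mult smooth_power smooth_inner smooth_const)
  then show ?thesis by (simp add: zonal_def[abs_def])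
qed

lemma smooth_radial_zonal: "smooth1 h \<Longrightarrow> smooth (\<lambda>x. h (x \<bullet> x) * zonal b m x)"
  by (rule smooth_mult[OF smooth_compose[OF _ smooth_norm_square] smooth_zonal])

lemma bump_test_function:
  assumes h: "bump h"
  shows "(\<lambda>x::'a::euclidean_space. h (x \<bullet> x) * zonal b m x) \<in> test_functions (- {0})"
proof -
  let ?\<phi> = "\<lambda>x::'a. h (x \<bullet> x) * zonal b m x"
  let ?S = "{x::'a. 1 \<le> x \<bullet> x \<and> x \<bullet> x \<le> 2}"
  have cl: "closed ?S"
    by (intro closed_Collect_conj closed_Collect_le continuous_intros)
  have "{x. ?\<phi> x \<noteq> 0} \<subseteq> ?S" using h by (force simp: bump_def)
  then have sub: "closure {x. ?\<phi> x \<noteq> 0} \<subseteq> ?S" using cl by (rule closure_minimal)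
  have "?S \<subseteq> cball 0 2"
  proof
    fix x :: 'a assume "x \<in> ?S"
    then have "(norm x)\<^sup>2 \<le> 2\<^sup>2" by (simp add: power2_norm_eq_inner)
    then have "norm x \<le> 2" by (rule power2_le_imp_le) simp
    then show "x \<in> cball 0 2" by simp
  qed
  then have "bounded ?S" using bounded_cball bounded_subset by blast
  then have "compact (closure {x. ?\<phi> x \<noteq> 0})"
    using bounded_subset[OF _ sub] by (simp add: compact_eq_bounded_closed)
  moreover have "0 \<notin> ?S" by simp
  ultimately show ?thesis
    using smooth_radial_zonal[of h b m] h sub by (auto simp: test_functions_def smooth_def bump_def)
qed

text \<open>The effect of k Laplacians on zonal moments, with \<open>v\<close> the moments of u and
  \<beta> = |b|^2. At degree d = q - 2k the factor (n + d + 2m - 2)(d - 2m) comes from integrating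
  the radial part by parts, the shifted term from the Laplacian of the monomial.\<close>

primrec lap_moment :: "real \<Rightarrow> real \<Rightarrow> real \<Rightarrow> (nat \<Rightarrow> real) \<Rightarrow> nat \<Rightarrow> nat \<Rightarrow> real" where
  "lap_moment n q \<beta> v 0 = v"
| "lap_moment n q \<beta> v (Suc k) = (\<lambda>m. (n + q - 2 * real k + 2 * real m - 2) * (q - 2 * real k - 2 * real m) * lap_moment n q \<beta> v k m
     + (if m = 0 then 0 else \<beta> * lap_moment n q \<beta> v k (m - 1)))"

lemma integral_radial_zonal:
  fixes u :: "'a::euclidean_space \<Rightarrow> real" and q :: real
  assumes um [measurable]: "u \<in> borel_measurable borel" and ui: "integrable sphere_measure u"
    and hom: "\<And>t x. t > 0 \<Longrightarrow> x \<noteq> 0 \<Longrightarrow> u (t *\<^sub>R x) = t powr q * u x"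
    and h: "bump h"
  shows "integrable lborel (\<lambda>x. u x * (h (x \<bullet> x) * zonal b m x))"
    and "(\<integral>x. u x * (h (x \<bullet> x) * zonal b m x) \<partial>lborel)
       = radial_int h (DIM('a) + q + 2 * real m) * (\<integral>x. u x * zonal b m x \<partial>sphere_measure)"
proof -
  have [measurable]: "h \<in> borel_measurable borel"
    using h by (intro borel_measurable_continuous_onI continuous_at_imp_continuous_on) (auto simp: bump_def intro: smooth1_isCont)
  have w: "integrable sphere_measure (\<lambda>x. u x * zonal b m x)"
    by (rule integrable_bounded_mult[OF ui]) (auto intro: zonal_bound)
  have pw: "t powr (q + 2 * real m) = t powr q * t ^ (2 * m)" if "t > 0" for t :: real
    using that by (simp add: powr_add powr_realpow[symmetric])
  have e: "(\<lambda>x. u x * (h (x \<bullet> x) * zonal b m x)) = (\<lambda>x. h ((norm x)\<^sup>2) * (u x * zonal b m x))"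
    by (simp add: power2_norm_eq_inner mult_ac)
  have hw: "u (t *\<^sub>R x) * zonal b m (t *\<^sub>R x) = t powr (q + 2 * real m) * (u x * zonal b m x)" if "t > 0" "x \<noteq> 0" for t x
    using that by (simp add: hom zonal_scaleR pw)
  have s: "set_integrable lborel {0<..} (\<lambda>r. r powr (real DIM('a) + (q + 2 * real m) - 1) * h (r\<^sup>2))"
    using radial_int_set_integral(1)[OF h] .
  show "integrable lborel (\<lambda>x. u x * (h (x \<bullet> x) * zonal b m x))"
    unfolding e by (rule integral_polar_homogeneous(1)[where h = "\<lambda>r. h (r\<^sup>2)", OF _ _ hw w s]) auto
  have "(\<integral>x. u x * (h (x \<bullet> x) * zonal b m x) \<partial>lborel)
     = (LINT r:{0<..}|lborel. r powr (real DIM('a) + (q + 2 * real m) - 1) * h (r\<^sup>2)) * (\<integral>x. u x * zonal b m x \<partial>sphere_measure)"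
    unfolding e by (rule integral_polar_homogeneous(2)[where h = "\<lambda>r. h (r\<^sup>2)", OF _ _ hw w s]) auto
  then show "(\<integral>x. u x * (h (x \<bullet> x) * zonal b m x) \<partial>lborel)
       = radial_int h (DIM('a) + q + 2 * real m) * (\<integral>x. u x * zonal b m x \<partial>sphere_measure)"
    unfolding radial_int_set_integral(2)[OF h] by (simp add: add.assoc)
qed

text \<open>Induction over k for all h and m at once, as one Laplacian replaces h by another bump
  function and adds a term with m - 1. Integration by parts leads back to the radial integral of the
  original h, so the dependence on h stays a single factor.\<close>

lemma integral_laplacian_zonal:
  fixes u :: "'a::euclidean_space \<Rightarrow> real" and q :: real
  assumes um [measurable]: "u \<in> borel_measurable borel" and ui: "integrable sphere_measure u"
    and hom: "\<And>t x. t > 0 \<Longrightarrow> x \<noteq> 0 \<Longrightarrow> u (t *\<^sub>R x) = t powr q * u x"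
  shows "bump h \<Longrightarrow> integrable lborel (\<lambda>x. u x * (laplacian ^^ k) (\<lambda>x. h (x \<bullet> x) * zonal b m x) x) \<and>
     (\<integral>x. u x * (laplacian ^^ k) (\<lambda>x. h (x \<bullet> x) * zonal b m x) x \<partial>lborel)
       = radial_int h (DIM('a) + q - 2 * real k + 2 * real m) *
         lap_moment (DIM('a)) q ((norm b)\<^sup>2) (\<lambda>m. \<integral>x. u x * zonal b m x \<partial>sphere_measure) k m"
proof (induction k arbitrary: h m)
  case 0
  then show ?case using integral_radial_zonal[OF um ui hom] by simp
next
  case (Suc k)
  let ?v = "lap_moment (DIM('a)) q ((norm b)\<^sup>2) (\<lambda>m. \<integral>x. u x * zonal b m x \<partial>sphere_measure) k"
  let ?h1 = "\<lambda>t. 4 * t * deriv (deriv h) t + (2 * DIM('a) + 8 * m) * deriv h t"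
  let ?L = "laplacian ^^ k"
  let ?\<alpha> = "DIM('a) + q - 2 * real k + 2 * real m"
  have b1: "bump ?h1"
    using bump_add[OF bump_mult[OF _ bump_deriv[OF bump_deriv[OF Suc.prems]], of "\<lambda>t. 4 * t"]
        bump_mult[OF smooth1_const bump_deriv[OF Suc.prems], of "2 * DIM('a) + 8 * m"]]
    by (simp add: smooth1_def C1_k_mult)
  have sm: "smooth (\<lambda>x::'a. g (x \<bullet> x) * zonal b m x)" if "bump g" for g m
    using that by (simp add: smooth_radial_zonal bump_def)
  \<comment> \<open>With c = 2n + 8m, since the monomial has degree 2m, half of 2\<alpha> - c is q -
    2k - 2m.\<close>
  have r: "radial_int ?h1 ?\<alpha> = (?\<alpha> - 2) * (q - 2 * real k - 2 * real m) * radial_int h (?\<alpha> - 2)"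
    unfolding radial_int_by_parts[OF Suc.prems] by (simp add: algebra_simps diff_divide_distrib add_divide_distrib)
  have z: "zonal b m x = (b \<bullet> x) ^ (2 * m) / fact (2 * m)" for m and x :: 'a by (simp add: zonal_def)
  have lap: "laplacian (\<lambda>x::'a. h (x \<bullet> x) * zonal b m x)
     = (\<lambda>x. ?h1 (x \<bullet> x) * zonal b m x + (norm b)\<^sup>2 * (h (x \<bullet> x) * (if m = 0 then 0 else zonal b (m - 1) x)))"
  proof
    fix x :: 'a
    have "2 * m - 2 = 2 * (m - 1)" by simp
    then show "laplacian (\<lambda>x::'a. h (x \<bullet> x) * zonal b m x) x = ?h1 (x \<bullet> x) * zonal b m x + (norm b)\<^sup>2 * (h (x \<bullet> x) * (if m = 0 then 0 else zonal b (m - 1) x))"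
      using laplacian_radial_power[of h b "2 * m" x] Suc.prems by (simp add: z bump_def)
  qed
  have kk: "(laplacian ^^ Suc k) \<phi> = ?L (laplacian \<phi>)" for \<phi> :: "'a \<Rightarrow> real"
    by (simp add: funpow_Suc_right del: funpow.simps)
  note IH1 = Suc.IH[OF b1, of m]
  show ?case
  proof (cases "m = 0")
    case True
    then have "(laplacian ^^ Suc k) (\<lambda>x::'a. h (x \<bullet> x) * zonal b m x) = ?L (\<lambda>x. ?h1 (x \<bullet> x) * zonal b m x)"
      unfolding kk lap by simp
    then have "integrable lborel (\<lambda>x. u x * (laplacian ^^ Suc k) (\<lambda>x::'a. h (x \<bullet> x) * zonal b m x) x)"
      and "(\<integral>x. u x * (laplacian ^^ Suc k) (\<lambda>x::'a. h (x \<bullet> x) * zonal b m x) x \<partial>lborel) = radial_int ?h1 ?\<alpha> * ?v m"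
      using IH1 by simp_all
    moreover have "radial_int ?h1 ?\<alpha> * ?v m = radial_int h (?\<alpha> - 2) * lap_moment (DIM('a)) q ((norm b)\<^sup>2) (\<lambda>m. \<integral>x. u x * zonal b m x \<partial>sphere_measure) (Suc k) m"
      unfolding r using True by (simp add: mult_ac)
    moreover have "DIM('a) + q - 2 * real (Suc k) + 2 * real m = ?\<alpha> - 2" by simp
    ultimately show ?thesis by metis
  next
    case False
    have "(laplacian ^^ Suc k) (\<lambda>x::'a. h (x \<bullet> x) * zonal b m x)
       = (\<lambda>x. ?L (\<lambda>x. ?h1 (x \<bullet> x) * zonal b m x) x + (norm b)\<^sup>2 * ?L (\<lambda>x. h (x \<bullet> x) * zonal b (m - 1) x) x)"
      unfolding kk lap using False laplacian_funpow_linear[OF sm[OF b1, of m] sm[OF Suc.prems, of "m - 1"], of k "(norm b)\<^sup>2"]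
      by (simp only: if_False)
    then have e: "(\<lambda>x. u x * (laplacian ^^ Suc k) (\<lambda>x::'a. h (x \<bullet> x) * zonal b m x) x)
      = (\<lambda>x. u x * ?L (\<lambda>x. ?h1 (x \<bullet> x) * zonal b m x) x + (norm b)\<^sup>2 * (u x * ?L (\<lambda>x. h (x \<bullet> x) * zonal b (m - 1) x) x))"
      by (simp only: distrib_left mult.left_commute)
    note IH2 = Suc.IH[OF Suc.prems, of "m - 1"]
    have i: "integrable lborel (\<lambda>x. u x * ?L (\<lambda>x. ?h1 (x \<bullet> x) * zonal b m x) x)"
      "integrable lborel (\<lambda>x. (norm b)\<^sup>2 * (u x * ?L (\<lambda>x. h (x \<bullet> x) * zonal b (m - 1) x) x))"
      using IH1 IH2 by auto
    have \<alpha>: "DIM('a) + q - 2 * real (Suc k) + 2 * real m = ?\<alpha> - 2" "DIM('a) + q - 2 * real k + 2 * real (m - 1) = ?\<alpha> - 2"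
      using False by (simp_all add: of_nat_diff)
    have "(\<integral>x. u x * (laplacian ^^ Suc k) (\<lambda>x::'a. h (x \<bullet> x) * zonal b m x) x \<partial>lborel)
       = radial_int ?h1 ?\<alpha> * ?v m + (norm b)\<^sup>2 * (radial_int h (?\<alpha> - 2) * ?v (m - 1))"
      unfolding e Bochner_Integration.integral_add[OF i] integral_mult_right_zero using IH1 IH2 unfolding \<alpha> by simp
    also have "\<dots> = radial_int h (?\<alpha> - 2) * lap_moment (DIM('a)) q ((norm b)\<^sup>2) (\<lambda>m. \<integral>x. u x * zonal b m x \<partial>sphere_measure) (Suc k) m"
      unfolding r using False by (simp add: algebra_simps)
    finally show ?thesis
      unfolding \<alpha> using Bochner_Integration.integrable_add[OF i] unfolding e by simp
  qed
qed

text \<open>Tested on h(|x|^2) times a zonal monomial, both sides of the distributional identity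
  carry the same radial integral, because f has degree q - 2k; for a nonnegative bump it is positive
  and cancels.\<close>

lemma laplacian_moments:
  fixes u f :: "'a::euclidean_space \<Rightarrow> real" and q :: real
  assumes um [measurable]: "u \<in> borel_measurable borel" and ui: "integrable sphere_measure u"
    and uhom: "\<And>t x. t > 0 \<Longrightarrow> x \<noteq> 0 \<Longrightarrow> u (t *\<^sub>R x) = t powr q * u x"
    and fm [measurable]: "f \<in> borel_measurable borel" and fi: "integrable sphere_measure f"
    and fhom: "\<And>t x. t > 0 \<Longrightarrow> x \<noteq> 0 \<Longrightarrow> f (t *\<^sub>R x) = t powr (q - 2 * real k) * f x"
    and distr: "\<And>\<phi>. \<phi> \<in> test_functions (- {0}) \<Longrightarrow>
        (LINT x|lebesgue. u x * (laplacian ^^ k) \<phi> x) = (LINT x|lebesgue. f x * \<phi> x)"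
  shows "(\<integral>x. f x * zonal b m x \<partial>sphere_measure)
     = lap_moment (DIM('a)) q ((norm b)\<^sup>2) (\<lambda>m. \<integral>x. u x * zonal b m x \<partial>sphere_measure) k m"
proof -
  obtain h where h: "bump h" and hp: "\<And>t. h t \<ge> 0" "\<And>t. t \<in> {1<..<2} \<Longrightarrow> h t > 0"
    using bump_exists by blast
  let ?\<phi> = "\<lambda>x::'a. h (x \<bullet> x) * zonal b m x"
  have sm: "smooth ?\<phi>" using h by (simp add: smooth_radial_zonal bump_def)
  have [measurable]: "?\<phi> \<in> borel_measurable borel" "(laplacian ^^ k) ?\<phi> \<in> borel_measurable borel"
    by (intro smooth_borel_measurable sm smooth_laplacian_funpow)+
  have "(LINT x|lebesgue. u x * (laplacian ^^ k) ?\<phi> x) = (\<integral>x. u x * (laplacian ^^ k) ?\<phi> x \<partial>lborel)"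
    "(LINT x|lebesgue. f x * ?\<phi> x) = (\<integral>x. f x * ?\<phi> x \<partial>lborel)"
    by (rule integral_completion; measurable)+
  then have "(\<integral>x. u x * (laplacian ^^ k) ?\<phi> x \<partial>lborel) = (\<integral>x. f x * ?\<phi> x \<partial>lborel)"
    using distr[OF bump_test_function[OF h]] by metis
  then have "radial_int h (DIM('a) + q - 2 * real k + 2 * real m) *
         lap_moment (DIM('a)) q ((norm b)\<^sup>2) (\<lambda>m. \<integral>x. u x * zonal b m x \<partial>sphere_measure) k m
       = radial_int h (DIM('a) + (q - 2 * real k) + 2 * real m) * (\<integral>x. f x * zonal b m x \<partial>sphere_measure)"
    using integral_laplacian_zonal[OF um ui uhom h, of k b m] integral_radial_zonal(2)[OF fm fi fhom h, of b m] by simp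
  moreover have "radial_int h (DIM('a) + q - 2 * real k + 2 * real m) > 0"
    by (rule radial_int_pos[OF h hp])
  ultimately show ?thesis by (simp add: add_diff_eq)
qed

section \<open>Representatives, positivity and continuity on the sphere\<close>

text \<open>A Borel version on the sphere is extended along rays. It equals f almost everywhere in
  space because both are homogeneous, so that the exceptional set lies, apart from the origin, in
  the cone over a null set of directions.\<close>

lemma homogeneous_borel_representative:
  fixes f :: "'a::euclidean_space \<Rightarrow> real" and d :: real
  assumes f: "integrable surface_measure f" and hom: "pos_homogeneous d f"
  obtains g where "g \<in> borel_measurable borel" "integrable sphere_measure g" "AE x in sphere_measure. f x = g x"
    "\<And>t x. t > 0 \<Longrightarrow> x \<noteq> 0 \<Longrightarrow> g (t *\<^sub>R x) = t powr d * g x" "AE x in lebesgue. f x = g x"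
proof -
  obtain g0 where g0: "g0 \<in> borel_measurable sphere_measure" "AE x in sphere_measure. f x = g0 x"
    using completion_ex_borel_measurable_real f unfolding surface_measure_eq by (metis borel_measurable_integrable)
  then have "g0 \<in> borel_measurable (restrict_space borel (sphere 0 1))"
    by (simp cong: measurable_cong_sets[OF sets_sphere_measure refl])
  then have [measurable]: "(\<lambda>x. indicator (sphere 0 1) x *\<^sub>R g0 x) \<in> borel_measurable borel"
    by (subst (asm) borel_measurable_restrict_space_iff) auto
  define g where "g x = norm x powr d * (indicator (sphere 0 1) (x /\<^sub>R norm x) *\<^sub>R g0 (x /\<^sub>R norm x))" for x
  have gm [measurable]: "g \<in> borel_measurable borel"
    unfolding g_def[abs_def] by (intro borel_measurable_times measurable_compose[OF _ \<open>(\<lambda>x. indicator (sphere 0 1) x *\<^sub>R g0 x) \<in> borel_measurable borel\<close>]) auto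
  have gs: "g x = g0 x" if "norm x = 1" for x using that by (simp add: g_def)
  have ae: "AE x in sphere_measure. f x = g x"
    using g0(2) AE_space by eventually_elim (simp add: gs)
  have fb: "f \<in> borel_measurable (completion sphere_measure)" using f unfolding surface_measure_eq by auto
  have "integrable (completion sphere_measure) g"
    using f unfolding surface_measure_eq
    by (rule integrable_cong_AE_imp) (use ae in \<open>auto intro!: measurable_completion AE_completion elim!: eventually_mono\<close>)
  then have gi: "integrable sphere_measure g" by (simp add: integrable_completion)
  have ghom: "g (t *\<^sub>R x) = t powr d * g x" if "t > 0" "x \<noteq> 0" for t x
    using that by (simp add: g_def powr_mult field_simps)
  obtain Z where Z: "Z \<in> sets sphere_measure" "emeasure sphere_measure Z = 0" "{x \<in> space sphere_measure. f x \<noteq> g x} \<subseteq> Z"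
    using ae by (rule AE_E) auto
  have Zb: "Z \<in> sets (restrict_space borel (sphere 0 1))" using Z(1) by (simp add: sets_sphere_measure)
  then have [measurable]: "Z \<in> sets borel" by (auto simp: sets_restrict_space)
  have [measurable]: "Z \<in> sets (restrict_space borel (sphere 0 1))" by (rule Zb)
  interpret R: sigma_finite_measure "radial_measure (DIM('a))" by (rule sigma_finite_radial_measure) simp
  interpret S: sigma_finite_measure "sphere_measure :: 'a measure" by (rule sigma_finite_sphere_measure)
  \<comment> \<open>The cone over a null set is null: in the product the radial factor is infinite,
    but infinity times 0 is 0.\<close>
  have "(\<integral>\<^sup>+x. indicator Z (x /\<^sub>R norm x) \<partial>lborel) = (\<integral>\<^sup>+z. indicator Z (snd z) \<partial>(radial_measure (DIM('a)) \<Otimes>\<^sub>M sphere_measure))"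
    by (rule nn_integral_polar[of _ "\<lambda>z. indicator Z (snd z)"]) auto
  also have "\<dots> = (\<integral>\<^sup>+z. indicator (UNIV \<times> Z) z \<partial>(radial_measure (DIM('a)) \<Otimes>\<^sub>M sphere_measure))"
    by (intro nn_integral_cong) (auto simp: indicator_def)
  also have "\<dots> = emeasure (radial_measure (DIM('a)) \<Otimes>\<^sub>M sphere_measure) (UNIV \<times> Z)"
    using Z(1) by (intro nn_integral_indicator pair_measureI) auto
  also have "\<dots> = 0"
    using S.emeasure_pair_measure_Times[of UNIV "radial_measure (DIM('a))" Z] Z by simp
  finally have "AE x in lborel. indicator Z (x /\<^sub>R norm x) = (0::ennreal)"
    by (subst (asm) nn_integral_0_iff_AE) auto
  then have "AE x in lborel. f x = g x"
    using AE_lborel_singleton[of 0]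
  proof eventually_elim
    case (elim x)
    let ?y = "x /\<^sub>R norm x"
    have "?y \<notin> Z" "?y \<in> space sphere_measure" using elim by (auto simp: indicator_def split: if_splits)
    then have y: "f ?y = g ?y" using Z(3) by blast
    have "f (norm x *\<^sub>R ?y) = norm x powr d * f ?y"
      using hom elim unfolding pos_homogeneous_def by (metis inverse_nonzero_iff_nonzero norm_eq_zero scale_eq_0_iff zero_less_norm_iff)
    moreover have "g (norm x *\<^sub>R ?y) = norm x powr d * g ?y"
      using elim by (intro ghom) auto
    ultimately show ?case using y elim by simp
  qed
  then have "AE x in lebesgue. f x = g x" by (rule AE_completion)
  then show ?thesis using that gm gi ae ghom by blast
qed

text \<open>Continuous tests pass to closed sets by a monotone approximation of indicators, and to
  {g < 0} by inner regularity of the finite measure whose density is the negative part of g.\<close>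

lemma AE_nonneg_if_continuous_tests:
  fixes g :: "'a::euclidean_space \<Rightarrow> real"
  assumes gm [measurable]: "g \<in> borel_measurable borel" and gi: "integrable sphere_measure g"
    and test: "\<And>\<phi>. continuous_on UNIV \<phi> \<Longrightarrow> (\<And>x. \<phi> x \<ge> 0) \<Longrightarrow> (\<integral>x. g x * \<phi> x \<partial>sphere_measure) \<ge> 0"
  shows "AE x in sphere_measure. g x \<ge> 0"
proof -
  have cl: "(\<integral>x. g x * indicator K x \<partial>sphere_measure) \<ge> 0" if K: "closed K" "K \<noteq> {}" for K :: "'a set"
  proof -
    have [measurable]: "K \<in> sets borel" using K by simp
    \<comment> \<open>Tents that equal 1 on K and, for i > 0, vanish at distance 1/i from it.
      Nonempty K matters: \<open>infdist\<close> from the empty set is 0.\<close>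
    define \<phi> where "\<phi> i x = max 0 (1 - real i * infdist x K)" for i x
    have c: "continuous_on UNIV (\<phi> i)" for i unfolding \<phi>_def by (intro continuous_on_max continuous_intros)
    have b: "\<bar>\<phi> i x\<bar> \<le> 1" for i x by (auto simp: \<phi>_def infdist_nonneg)
    have [measurable]: "\<phi> i \<in> borel_measurable borel" for i using c by (rule borel_measurable_continuous_onI)
    have lim: "(\<lambda>i. \<phi> i x) \<longlonglongrightarrow> indicator K x" for x
    proof (cases "x \<in> K")
      case True
      then show ?thesis by (simp add: \<phi>_def)
    next
      case False
      then have pos: "infdist x K > 0" using K by (metis in_closed_iff_infdist_zero infdist_nonneg less_eq_real_def)
      have "eventually (\<lambda>i. \<phi> i x = 0) sequentially"
      proof -
        obtain N :: nat where N: "1 / infdist x K < N" using reals_Archimedean2 by blast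
        show ?thesis
        proof (rule eventually_sequentiallyI[of N])
          fix i assume "N \<le> i"
          then have "1 / infdist x K < i" using N by linarith
          then show "\<phi> i x = 0" using pos by (simp add: \<phi>_def field_simps)
        qed
      qed
      then show ?thesis using False by (simp add: tendsto_eventually)
    qed
    have "(\<lambda>i. \<integral>x. g x * \<phi> i x \<partial>sphere_measure) \<longlonglongrightarrow> (\<integral>x. g x * indicator K x \<partial>sphere_measure)"
    proof (rule integral_dominated_convergence[where w = "\<lambda>x. \<bar>g x\<bar>"])
      show "AE x in sphere_measure. norm (g x * \<phi> i x) \<le> \<bar>g x\<bar>" for i
        by (rule AE_I2) (use b in \<open>auto simp: abs_mult mult_left_le\<close>)
      show "AE x in sphere_measure. (\<lambda>i. g x * \<phi> i x) \<longlonglongrightarrow> g x * indicator K x"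
        by (rule AE_I2) (intro tendsto_intros lim)
    qed (use gi in auto)
    then show ?thesis
    proof (rule LIMSEQ_le_const, intro exI allI impI)
      show "0 \<le> (\<integral>x. g x * \<phi> i x \<partial>sphere_measure)" for i
        by (rule test[OF c]) (simp add: \<phi>_def)
    qed
  qed
  \<comment> \<open>Inner regularity by compact sets is used for Borel measures on the whole space,
    hence the push-forward from the sphere.\<close>
  define D where "D = distr (sphere_measure :: 'a measure) borel (\<lambda>x. x)"
  define M where "M = density D (\<lambda>x. ennreal (- g x))"
  have idm: "(\<lambda>x. x) \<in> sphere_measure \<rightarrow>\<^sub>M (borel :: 'a measure)" by simp
  have em: "emeasure M A = (\<integral>\<^sup>+x. ennreal (- g x) * indicator A x \<partial>sphere_measure)" if [measurable]: "A \<in> sets borel" for A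
    unfolding M_def D_def by (subst emeasure_density) (auto simp: nn_integral_distr)
  define A where "A = {x. g x < 0}"
  have Ab [measurable]: "A \<in> sets borel" unfolding A_def by measurable
  have "emeasure M A = (SUP K \<in> {K. K \<subseteq> A \<and> compact K}. emeasure M K)"
  proof (rule inner_regular[OF _ _ Ab])
    show "sets M = sets borel" by (simp add: M_def D_def)
    have "emeasure M (space M) \<le> (\<integral>\<^sup>+x. ennreal (norm (g x)) \<partial>sphere_measure)"
      by (subst em) (auto simp: M_def D_def intro!: nn_integral_mono ennreal_leI split: split_indicator)
    also have "\<dots> < \<infinity>" using gi by (simp add: integrable_iff_bounded)
    finally show "emeasure M (space M) \<noteq> \<infinity>" by simp
  qed
  also have "\<dots> \<le> 0"
  proof (rule SUP_least)
    fix K assume "K \<in> {K. K \<subseteq> A \<and> compact K}"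
    then have K: "K \<subseteq> A" "compact K" by auto
    then have [measurable]: "K \<in> sets borel" by (simp add: compact_imp_closed)
    have i: "integrable sphere_measure (\<lambda>x. - g x * indicator K x)"
      using integrable_bounded_mult[OF gi, of "indicator K" 1] by auto
    have nn: "- g x * indicator K x \<ge> 0" for x using K by (auto simp: A_def indicator_def less_imp_le)
    have "emeasure M K = (\<integral>\<^sup>+x. ennreal (- g x * indicator K x) \<partial>sphere_measure)"
      by (subst em) (auto intro!: nn_integral_cong simp: indicator_def)
    also have "\<dots> = ennreal (\<integral>x. - g x * indicator K x \<partial>sphere_measure)"
      by (rule nn_integral_eq_integral[OF i]) (use nn in auto)
    also have "\<dots> = 0" using cl[of K] K by (cases "K = {}") (auto simp: compact_imp_closed ennreal_neg)
    finally show "emeasure M K \<le> 0" by simp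
  qed
  finally have "(\<integral>\<^sup>+x. ennreal (- g x) * indicator A x \<partial>sphere_measure) = 0" using em[OF Ab] by simp
  then have "AE x in sphere_measure. ennreal (- g x) * indicator A x = 0"
    by (subst (asm) nn_integral_0_iff_AE) auto
  then show ?thesis by eventually_elim (auto simp: A_def indicator_def ennreal_eq_0_iff split: if_splits)
qed

text \<open>For positive q the kernel is continuous and stays bounded along a convergent sequence,
  so a multiple of |g| dominates and g may be unbounded.\<close>

lemma continuous_cosine_transform:
  fixes g :: "'a::euclidean_space \<Rightarrow> real" and q :: real
  assumes q: "q > 0" and gm [measurable]: "g \<in> borel_measurable borel" and gi: "integrable sphere_measure g"
  shows "continuous_on UNIV (cosine_transform q g)"
  unfolding continuous_on_sequentially
proof (intro allI ballI impI, elim conjE)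
  fix X :: "nat \<Rightarrow> 'a" and y assume X: "X \<longlonglongrightarrow> y"
  obtain B where B: "\<And>i. norm (X i) \<le> B" "B > 0"
    using convergent_imp_Bseq[of X] X by (metis Bseq_def convergentI)
  have cont: "continuous_on UNIV (\<lambda>t::real. \<bar>t\<bar> powr q)"
    by (rule continuous_on_powr') (use q in \<open>auto intro!: continuous_intros\<close>)
  show "(cosine_transform q g \<circ> X) \<longlonglongrightarrow> cosine_transform q g y"
    unfolding cosine_transform_def comp_def
  proof (rule integral_dominated_convergence[where w = "\<lambda>\<theta>. B powr q * \<bar>g \<theta>\<bar>"])
    show "AE \<theta> in sphere_measure. (\<lambda>i. \<bar>X i \<bullet> \<theta>\<bar> powr q * g \<theta>) \<longlonglongrightarrow> \<bar>y \<bullet> \<theta>\<bar> powr q * g \<theta>"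
    proof (rule AE_I2)
      fix \<theta> :: 'a
      have "(\<lambda>i. X i \<bullet> \<theta>) \<longlonglongrightarrow> y \<bullet> \<theta>" using X by (intro tendsto_intros)
      then have "(\<lambda>i. \<bar>X i \<bullet> \<theta>\<bar> powr q) \<longlonglongrightarrow> \<bar>y \<bullet> \<theta>\<bar> powr q"
        using continuous_on_tendsto_compose[OF cont, of "\<lambda>i. X i \<bullet> \<theta>"] by simp
      then show "(\<lambda>i. \<bar>X i \<bullet> \<theta>\<bar> powr q * g \<theta>) \<longlonglongrightarrow> \<bar>y \<bullet> \<theta>\<bar> powr q * g \<theta>"
        by (rule tendsto_mult[OF _ tendsto_const])
    qed
    show "AE \<theta> in sphere_measure. norm (\<bar>X i \<bullet> \<theta>\<bar> powr q * g \<theta>) \<le> B powr q * \<bar>g \<theta>\<bar>" for i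
    proof (rule AE_I2)
      fix \<theta> :: 'a assume "\<theta> \<in> space sphere_measure"
      then have "\<bar>X i \<bullet> \<theta>\<bar> \<le> B" using Cauchy_Schwarz_ineq2[of "X i" \<theta>] B(1)[of i] by simp
      then show "norm (\<bar>X i \<bullet> \<theta>\<bar> powr q * g \<theta>) \<le> B powr q * \<bar>g \<theta>\<bar>"
        using q by (auto simp: abs_mult intro!: mult_right_mono powr_mono2)
    qed
  qed (use gi in auto)
qed

text \<open>The cone over a neighbourhood of y contains a ball around y/2, which has positive
  volume.\<close>

lemma sphere_measure_open_nonzero:
  fixes y :: "'a::euclidean_space"
  assumes y: "norm y = 1" and e: "e > 0" and Z: "AE x in sphere_measure. x \<notin> ball y e"
  shows False
proof -
  let ?A = "ball y e \<inter> sphere 0 1"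
  have A: "?A \<in> sets sphere_measure" by (auto simp: sets_sphere_measure sets_restrict_space)
  have "emeasure sphere_measure ?A = 0"
    using Z A by (subst (asm) AE_iff_measurable[OF A]) auto
  then have "emeasure lborel {x \<in> cball 0 1 - {0}. x /\<^sub>R norm x \<in> ?A} = 0"
    unfolding emeasure_sphere_measure[OF A] by simp
  moreover have "continuous_on (- {0}) (\<lambda>x::'a. x /\<^sub>R norm x)" by (intro continuous_intros) auto
  then have "open ((\<lambda>x::'a. x /\<^sub>R norm x) -` ball y e \<inter> - {0})"
    by (rule continuous_on_open_vimage[THEN iffD1, rule_format, rotated]) auto
  then have "open (((\<lambda>x::'a. x /\<^sub>R norm x) -` ball y e \<inter> - {0}) \<inter> ball 0 1)" (is "open ?U") by auto
  moreover have "(1/2) *\<^sub>R y \<in> ?U" using y e by auto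
  ultimately obtain d where d: "d > 0" "ball ((1/2) *\<^sub>R y) d \<subseteq> ?U" by (meson open_contains_ball)
  have "?U \<subseteq> {x \<in> cball 0 1 - {0}. x /\<^sub>R norm x \<in> ?A}" by auto
  then have "emeasure lborel (ball ((1/2) *\<^sub>R y) d) \<le> emeasure lborel {x \<in> cball 0 1 - {0}. x /\<^sub>R norm x \<in> ?A}"
    using d(2) by (intro emeasure_mono) auto
  moreover have "emeasure lborel (ball ((1/2) *\<^sub>R y) d) > 0"
    using content_ball_pos[OF d(1), of "(1/2) *\<^sub>R y"] emeasure_lborel_ball_finite[of "(1/2) *\<^sub>R y" d]
    by (simp add: measure_def enn2real_positive_iff)
  ultimately show False using \<open>emeasure lborel {x \<in> cball 0 1 - {0}. x /\<^sub>R norm x \<in> ?A} = 0\<close> by simp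
qed

section \<open>Probability measures as laws on the unit interval\<close>

definition cantor_code :: "(nat \<Rightarrow> int) \<Rightarrow> real" where
  "cantor_code d = (\<Sum>k. real_of_int (d k) / 4 ^ Suc k)"

lemma cantor_code_summable:
  assumes "\<And>k. d k \<in> {0, 1}"
  shows "summable (\<lambda>k. real_of_int (d k) / 4 ^ Suc k)"
proof (rule summable_comparison_test')
  show "summable (\<lambda>k. (1/4 :: real) ^ Suc k)" by simp
  show "norm (real_of_int (d k) / 4 ^ Suc k) \<le> (1/4) ^ Suc k" for k
    using assms[of k] by (auto simp: power_divide)
qed

text \<open>Digits at most 1 in base 4 sum to at most 1/3. This gap below 1 lets the floor function
  return leading digits exactly.\<close>

lemma cantor_code_bounds:
  assumes d: "\<And>k. d k \<in> {0, 1}"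
  shows "0 \<le> cantor_code d" "cantor_code d < 1"
proof -
  have dk: "0 \<le> d k" "d k \<le> 1" for k using d[of k] by auto
  show "0 \<le> cantor_code d"
    unfolding cantor_code_def by (rule suminf_nonneg[OF cantor_code_summable[OF d]]) (use dk in auto)
  have s: "(\<lambda>k. (1/4 :: real) ^ Suc k) sums (1/3)"
    using sums_mult[OF geometric_sums[of "1/4::real"], of "1/4"] by simp
  have "cantor_code d \<le> (\<Sum>k. (1/4 :: real) ^ Suc k)"
    unfolding cantor_code_def
    by (rule suminf_le[OF _ cantor_code_summable[OF d] sums_summable[OF s]]) (use dk in \<open>auto simp: power_divide divide_right_mono\<close>)
  also have "\<dots> = 1/3" using s by (simp add: sums_iff)
  finally show "cantor_code d < 1" by simp
qed

lemma cantor_code_Suc: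
  assumes "\<And>k. d k \<in> {0, 1}"
  shows "4 * cantor_code d = d 0 + cantor_code (\<lambda>k. d (Suc k))"
proof -
  have "cantor_code d = (\<Sum>k. real_of_int (d (Suc k)) / 4 ^ Suc (Suc k)) + d 0 / 4"
    unfolding cantor_code_def using suminf_split_head[OF cantor_code_summable[of d, OF assms]] by simp
  also have "(\<Sum>k. real_of_int (d (Suc k)) / 4 ^ Suc (Suc k)) = (\<Sum>k. (1/4) * (real_of_int (d (Suc k)) / 4 ^ Suc k))"
    by (intro arg_cong[where f = suminf] ext) simp
  also have "\<dots> = 1/4 * cantor_code (\<lambda>k. d (Suc k))"
    unfolding cantor_code_def by (rule suminf_mult) (use cantor_code_summable[of "\<lambda>k. d (Suc k)"] assms in auto)
  finally show ?thesis by simp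
qed

lemma cantor_code_digit:
  "(\<And>k. d k \<in> {0, 1}) \<Longrightarrow> \<lfloor>4 ^ Suc k * cantor_code d\<rfloor> mod 4 = d k"
proof (induction k arbitrary: d)
  case 0
  have "\<lfloor>cantor_code (\<lambda>k. d (Suc k))\<rfloor> = 0"
    using cantor_code_bounds[of "\<lambda>k. d (Suc k)"] 0 by (simp add: floor_eq_iff)
  then show ?case using cantor_code_Suc[OF 0] 0[of 0] by auto
next
  case (Suc k)
  let ?e = "cantor_code (\<lambda>k. d (Suc k))"
  have "4 ^ Suc (Suc k) * cantor_code d = 4 ^ Suc k * (4 * cantor_code d)" by simp
  also have "\<dots> = of_int (4 ^ Suc k * d 0) + 4 ^ Suc k * ?e"
    unfolding cantor_code_Suc[OF Suc.prems] by (simp add: distrib_left)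
  finally have "\<lfloor>4 ^ Suc (Suc k) * cantor_code d\<rfloor> = 4 * (4 ^ k * d 0) + \<lfloor>4 ^ Suc k * ?e\<rfloor>"
    by (simp only: int_add_floor[symmetric]) simp
  then show ?case using Suc.IH[of "\<lambda>k. d (Suc k)"] Suc.prems by simp
qed

definition bit_digit :: "nat \<Rightarrow> real \<Rightarrow> int" where
  "bit_digit m y = \<lfloor>2 ^ Suc m * y\<rfloor> mod 2"

lemma bit_digit_cases: "bit_digit m y \<in> {0, 1}"
  by (auto simp: bit_digit_def)

text \<open>The partial sum of the first M digits is y rounded down to a multiple of 2^(-M).\<close>

lemma bit_digit_sums:
  assumes y: "0 \<le> y" "y < 1"
  shows "(\<lambda>m. real_of_int (bit_digit m y) / 2 ^ Suc m) sums y"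
proof -
  have part: "(\<Sum>m<M. real_of_int (bit_digit m y) / 2 ^ Suc m) = \<lfloor>2 ^ M * y\<rfloor> / 2 ^ M" for M
  proof (induction M)
    case 0
    then show ?case using y by (simp add: floor_eq_iff)
  next
    case (Suc M)
    let ?z = "2 ^ M * y"
    have "\<lfloor>2 * ?z\<rfloor> div 2 = \<lfloor>?z\<rfloor>"
      using floor_divide_real_eq_div[of 2 "2 * ?z"] by simp
    then have "\<lfloor>2 ^ Suc M * y\<rfloor> = 2 * \<lfloor>?z\<rfloor> + bit_digit M y"
      unfolding bit_digit_def using mult_div_mod_eq[of 2 "\<lfloor>2 * ?z\<rfloor>"] by (simp add: mult.assoc)
    then show ?case using Suc.IH by (simp add: field_simps)
  qed
  have "(\<lambda>M. \<lfloor>2 ^ M * y\<rfloor> / 2 ^ M) \<longlonglongrightarrow> y"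
  proof (rule tendsto_sandwich)
    show "\<forall>\<^sub>F M in sequentially. y - (1/2) ^ M \<le> \<lfloor>2 ^ M * y\<rfloor> / 2 ^ M"
    proof (rule always_eventually, rule allI)
      fix M :: nat
      have "2 ^ M * y - 1 \<le> \<lfloor>2 ^ M * y\<rfloor>" by linarith
      then have "(2 ^ M * y - 1) / 2 ^ M \<le> \<lfloor>2 ^ M * y\<rfloor> / 2 ^ M" by (rule divide_right_mono) simp
      then show "y - (1/2) ^ M \<le> \<lfloor>2 ^ M * y\<rfloor> / 2 ^ M" by (simp add: diff_divide_distrib power_divide)
    qed
    show "\<forall>\<^sub>F M in sequentially. \<lfloor>2 ^ M * y\<rfloor> / 2 ^ M \<le> y"
    proof (rule always_eventually, rule allI)
      fix M :: nat
      have "\<lfloor>2 ^ M * y\<rfloor> / 2 ^ M \<le> (2 ^ M * y) / 2 ^ M" by (rule divide_right_mono) (simp_all add: of_int_floor_le)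
      then show "\<lfloor>2 ^ M * y\<rfloor> / 2 ^ M \<le> y" by simp
    qed
    have "(\<lambda>M. (1/2 :: real) ^ M) \<longlonglongrightarrow> 0" by (rule LIMSEQ_power_zero) simp
    from tendsto_diff[OF tendsto_const this] show "(\<lambda>M. y - (1/2) ^ M) \<longlonglongrightarrow> y" by simp
  qed auto
  then show ?thesis unfolding sums_def part .
qed

lemma borel_measurable_bit_digit [measurable]: "(\<lambda>y. real_of_int (bit_digit m y)) \<in> borel_measurable borel"
  unfolding bit_digit_def by measurable

text \<open>The binary digits of all coordinates are interleaved into one base 4 expansion with digits 0 and 1;
  these digits are then read off without carries.\<close>

lemma borel_injection_into_real:
  "\<exists>(i :: 'a::euclidean_space \<Rightarrow> real) j. i \<in> borel_measurable borel \<and> j \<in> borel_measurable borel \<and> (\<forall>x. j (i x) = x)"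
proof -
  obtain idx :: "'a \<Rightarrow> nat" and K where idx: "bij_betw idx Basis {0..<K}"
    using ex_bij_betw_finite_nat[OF finite_Basis] by blast
  define inv_idx where "inv_idx = the_inv_into Basis idx"
  \<comment> \<open>A bijection of the line onto (0, 1): binary digits recover only numbers in [0,
    1).\<close>
  define s where "s t = 1/2 + arctan t / pi" for t :: real
  have s: "0 \<le> s t" "s t < 1" "tan (pi * (s t - 1/2)) = t" for t
    using arctan_lbound[of t] arctan_ubound[of t] by (auto simp: s_def field_simps tan_arctan)
  have [measurable]: "s \<in> borel_measurable borel"
    unfolding s_def[abs_def] by (intro borel_measurable_continuous_onI continuous_intros) auto
  define d where "d x k = (let (a, m) = prod_decode k in bit_digit m (s (x \<bullet> inv_idx a)))" for x :: 'a and k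
  have d01: "d x k \<in> {0, 1}" for x k
    using bit_digit_cases by (auto simp: d_def split: prod.split)
  have [measurable]: "(\<lambda>x. real_of_int (d x k)) \<in> borel_measurable borel" for k
    unfolding d_def by (cases "prod_decode k") simp
  define i where "i x = cantor_code (d x)" for x
  define dig where "dig k t = real_of_int (\<lfloor>4 ^ Suc k * t\<rfloor> mod 4)" for k and t :: real
  have [measurable]: "dig k \<in> borel_measurable borel" for k unfolding dig_def[abs_def] by measurable
  define j where "j t = (\<Sum>b\<in>Basis. tan (pi * ((\<Sum>m. dig (prod_encode (idx b, m)) t / 2 ^ Suc m) - 1/2)) *\<^sub>R b)" for t :: real
  have tan_m [measurable]: "tan \<in> borel_measurable (borel :: real measure)"
    unfolding tan_def[abs_def] by measurable
  have im: "i \<in> borel_measurable borel"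
    unfolding i_def[abs_def] cantor_code_def by (intro borel_measurable_suminf) measurable
  have jm: "j \<in> borel_measurable borel"
    unfolding j_def[abs_def]
    by (intro borel_measurable_sum borel_measurable_scaleR measurable_compose[OF _ tan_m] borel_measurable_times
        borel_measurable_diff borel_measurable_suminf) measurable
  have "j (i x) = x" for x
  proof -
    have "dig k (i x) = d x k" for k
      unfolding dig_def i_def using cantor_code_digit[OF d01] by simp
    moreover have "d x (prod_encode (idx b, m)) = bit_digit m (s (x \<bullet> b))" if "b \<in> Basis" for b m
      using that idx by (simp add: d_def inv_idx_def the_inv_into_f_f bij_betw_imp_inj_on)
    ultimately have "j (i x) = (\<Sum>b\<in>Basis. tan (pi * ((\<Sum>m. real_of_int (bit_digit m (s (x \<bullet> b))) / 2 ^ Suc m) - 1/2)) *\<^sub>R b)"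
      unfolding j_def by (intro sum.cong) auto
    also have "\<dots> = (\<Sum>b\<in>Basis. (x \<bullet> b) *\<^sub>R b)"
      using bit_digit_sums[OF s(1,2)] by (simp add: sums_iff s(3))
    finally show ?thesis by (simp add: euclidean_representation)
  qed
  with im jm show ?thesis by blast
qed

text \<open>The measure is carried to the line by the injection \<open>i\<close>, realised there by
  the quantile function of its distribution function, and carried back by \<open>j\<close>, which
  inverts \<open>i\<close>.\<close>

lemma prob_measure_representation:
  fixes M :: "'a::euclidean_space measure"
  assumes M: "prob_space M" "sets M = sets borel"
  obtains h where "h \<in> borel_measurable borel"
    "distr (restrict_space lborel {0<..<1::real}) borel h = M"
proof -
  interpret prob_space M by fact
  obtain i :: "'a \<Rightarrow> real" and j where ij: "i \<in> borel_measurable borel" "j \<in> borel_measurable borel" "\<forall>x. j (i x) = x"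
    using borel_injection_into_real by blast
  have im: "i \<in> borel_measurable M" using ij(1) by (simp cong: measurable_cong_sets[OF M(2) refl])
  have cd: "cdf_distribution (distr M borel i)"
    unfolding cdf_distribution_def by (rule real_distribution_distr) (rule im)
  let ?R = "restrict_space lborel {0<..<1::real}"
  let ?I = "\<lambda>\<omega>. Inf {x. \<omega> \<le> cdf (distr M borel i) x}"
  define h where "h t = (if t \<in> {0<..<1} then j (?I t) else 0)" for t
  have Im: "?I \<in> borel_measurable (restrict_space borel {0<..<1})" by (rule cdf_distribution.measurable_CI[OF cd])
  have jIm: "(\<lambda>t. j (?I t)) \<in> borel_measurable (restrict_space borel {0<..<1})"
    by (rule measurable_compose[OF Im ij(2)])
  then have "(\<lambda>t. indicator {0<..<1} t *\<^sub>R j (?I t)) \<in> borel_measurable borel"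
    by (subst (asm) borel_measurable_restrict_space_iff) auto
  moreover have "h = (\<lambda>t. indicator {0<..<1} t *\<^sub>R j (?I t))" by (auto simp: h_def fun_eq_iff)
  ultimately have hm: "h \<in> borel_measurable borel" by simp
  have sR: "sets ?R = sets (restrict_space borel {0<..<1})" by (simp cong: sets_restrict_space_cong)
  have "distr ?R borel h = distr ?R borel (\<lambda>t. j (?I t))"
    by (rule distr_cong) (auto simp: h_def space_restrict_space)
  also have "\<dots> = distr (distr ?R borel ?I) borel j"
    using Im ij(2) by (subst distr_distr) (auto simp: comp_def cong: measurable_cong_sets[OF sR refl])
  also have "distr ?R borel ?I = distr M borel i" by (rule cdf_distribution.distr_I_eq_M[OF cd])
  also have "distr (distr M borel i) borel j = distr M borel (\<lambda>x. x)"
    using im ij by (subst distr_distr) (auto simp: comp_def)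
  also have "\<dots> = M" by (rule distr_id2) (simp add: M(2))
  finally show ?thesis using that hm by blast
qed

section \<open>Inversion of the cosine transform\<close>

text \<open>The recursion of the Gaussian moments iterated from -p; for positive p the start is a
  continued, negative value. It converts the coefficients of the transform of order p into the
  weights at -p met after k Laplacians.\<close>

lemma prod_gauss_moment:
  assumes "p < 1" "p \<noteq> 0" "p > -1"
  shows "(\<Prod>s<l. p - 2 * real s) = (-1) ^ l * gauss_moment (- p + 2 * real l) / gauss_moment (- p)"
proof -
  have nz: "gauss_moment (- p) \<noteq> 0"
    using gauss_moment_rec[of "- p"] gauss_moment_pos[of "- p + 2"] assms by auto
  show ?thesis
  proof (induction l)
    case (Suc l)
    have "- p + 2 * real l \<noteq> 0"
    proof (cases l)
      case (Suc m)
      then show ?thesis using assms by simp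
    qed (use assms in auto)
    then have "gauss_moment (- p + 2 * real (Suc l)) = (- p + 2 * real l) * gauss_moment (- p + 2 * real l)"
      using gauss_moment_rec[of "- p + 2 * real l"] assms by (simp add: algebra_simps)
    moreover have "x * G / g * (p - 2 * L) = - 1 * x * ((- p + 2 * L) * G) / g" for x G g L :: real
      by (cases "g = 0") (simp_all add: field_simps)
    ultimately show ?case using Suc.IH by simp
  qed (use nz in auto)
qed

lemma cosine_transform_moments:
  fixes f :: "'a::euclidean_space \<Rightarrow> real" and p :: real
  assumes n: "DIM('a) > 1" and p: "p > -1"
    and fm [measurable]: "f \<in> borel_measurable borel" and fi: "integrable sphere_measure f"
  shows "gauss_moment (DIM('a) + p + 2 * real m) * (\<integral>x. cosine_transform p f x * zonal b m x \<partial>sphere_measure)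
    = (2 * gauss_moment 1) ^ (DIM('a) - 1) * (2 * gauss_moment (p + 1)) *
      (\<Sum>i\<le>m. ((norm b)\<^sup>2 / 2) ^ i / fact i * (\<Prod>s<m - i. p - 2 * real s) * (\<integral>x. f x * zonal b (m - i) x \<partial>sphere_measure))"
proof -
  let ?G = "gauss_moment (DIM('a) + p + 2 * real m)"
  let ?\<kappa> = "(2 * gauss_moment 1) ^ (DIM('a) - 1) * (2 * gauss_moment (p + 1))"
  let ?c = "\<lambda>i. ((norm b)\<^sup>2 / 2) ^ i / fact i * (\<Prod>s<m - i. p - 2 * real s)"
  have zi: "integrable sphere_measure (\<lambda>x. f x * zonal b l x)" for l
    by (rule integrable_bounded_mult[OF fi]) (auto intro: zonal_bound)
  have "(\<integral>x. cosine_transform p f x * zonal b m x \<partial>sphere_measure) = (\<integral>x. f x * cosine_transform p (zonal b m) x \<partial>sphere_measure)"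
    by (rule cosine_transform_swap(3)[OF n p fm _ fi]) (auto intro: zonal_bound)
  then have "?G * (\<integral>x. cosine_transform p f x * zonal b m x \<partial>sphere_measure) = (\<integral>x. f x * (?G * cosine_transform p (zonal b m) x) \<partial>sphere_measure)"
    by (simp only: mult.left_commute[of _ ?G] integral_mult_right_zero)
  also have "\<dots> = (\<integral>x. (\<Sum>i\<le>m. ?\<kappa> * ?c i * (f x * zonal b (m - i) x)) \<partial>sphere_measure)"
  proof (rule Bochner_Integration.integral_cong[OF refl])
    fix x :: 'a assume "x \<in> space sphere_measure"
    then have "norm x = 1" by simp
    from cosine_transform_zonal[OF n p this, of m b]
    show "f x * (?G * cosine_transform p (zonal b m) x) = (\<Sum>i\<le>m. ?\<kappa> * ?c i * (f x * zonal b (m - i) x))"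
      by (simp only: sum_distrib_left) (simp add: mult_ac)
  qed
  also have "\<dots> = (\<Sum>i\<le>m. ?\<kappa> * ?c i * (\<integral>x. f x * zonal b (m - i) x \<partial>sphere_measure))"
    using zi by simp
  finally show ?thesis by (simp add: sum_distrib_left mult_ac)
qed

text \<open>The combination of monomials that the cosine transform of order \<open>q\<close> maps to a single monomial:
  the Hermite function \<open>(b \<bullet> \<nabla>)\<^sup>2\<^sup>m exp(-|x|\<^sup>2/2)\<close>, integrated along rays against the weight of degree \<open>q\<close>.\<close>

definition hermite_sum :: "real \<Rightarrow> real \<Rightarrow> (nat \<Rightarrow> real) \<Rightarrow> nat \<Rightarrow> real" where
  "hermite_sum a \<beta> v m = (\<Sum>i\<le>m. (-\<beta>/2) ^ i / fact i * gauss_moment (a + 2 * real (m - i)) * v (m - i))"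

text \<open>In generating functions, the weights exp(-\<beta>/2) of the Hermite sum cancel the
  factor exp(\<beta>/2) of \<open>cosine_transform_zonal\<close>, and a single monomial
  remains.\<close>

lemma hermite_sum_cosine_transform:
  fixes y b :: "'a::euclidean_space" and q :: real
  assumes n: "DIM('a) > 1" and q: "q > -1" and y: "norm y = 1"
  shows "hermite_sum (DIM('a) + q) ((norm b)\<^sup>2) (\<lambda>l. cosine_transform q (zonal b l) y) m
    = (2 * gauss_moment 1) ^ (DIM('a) - 1) * (2 * gauss_moment (q + 1)) * ((\<Prod>s<m. q - 2 * real s) * zonal b m y)"
proof -
  let ?\<kappa> = "(2 * gauss_moment 1) ^ (DIM('a) - 1) * (2 * gauss_moment (q + 1))"
  let ?\<beta> = "(norm b)\<^sup>2"
  define H where "H = Abs_fps (\<lambda>l. (\<Prod>s<l. q - 2 * real s) * zonal b l y)"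
  have G: "gauss_moment (DIM('a) + q + 2 * real l) * cosine_transform q (zonal b l) y = fps_nth (fps_const ?\<kappa> * (fps_exp (?\<beta> / 2) * H)) l" for l
    unfolding cosine_transform_zonal[OF n q y] by (simp add: fps_mult_nth[of "fps_exp _"] H_def atLeast0AtMost mult.assoc)
  have "hermite_sum (DIM('a) + q) ?\<beta> (\<lambda>l. cosine_transform q (zonal b l) y) m
     = (\<Sum>i\<le>m. fps_nth (fps_exp (- ?\<beta> / 2)) i * fps_nth (fps_const ?\<kappa> * (fps_exp (?\<beta> / 2) * H)) (m - i))"
    unfolding hermite_sum_def by (rule sum.cong[OF refl]) (simp only: G[symmetric] fps_exp_nth of_nat_fact mult.assoc)
  also have "\<dots> = fps_nth (fps_exp (- ?\<beta> / 2) * (fps_const ?\<kappa> * (fps_exp (?\<beta> / 2) * H))) m"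
    by (simp only: fps_mult_nth[of "fps_exp (- ?\<beta> / 2)"] atLeast0AtMost)
  also have "fps_exp (- ?\<beta> / 2) * (fps_const ?\<kappa> * (fps_exp (?\<beta> / 2) * H)) = fps_const ?\<kappa> * ((fps_exp (- ?\<beta> / 2) * fps_exp (?\<beta> / 2)) * H)"
    by (simp only: mult_ac)
  also have "fps_exp (- ?\<beta> / 2) * fps_exp (?\<beta> / 2) = 1"
    unfolding fps_exp_add_mult[symmetric] by simp
  finally show ?thesis by (simp add: H_def)
qed

lemma hermite_sum_integral:
  assumes "\<And>l. integrable M (\<lambda>x. g x * v l x)"
  shows "hermite_sum a \<beta> (\<lambda>l. \<integral>x. g x * v l x \<partial>M) m = (\<integral>x. g x * hermite_sum a \<beta> (\<lambda>l. v l x) m \<partial>M)"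
proof -
  have "g x * hermite_sum a \<beta> (\<lambda>l. v l x) m = (\<Sum>i\<le>m. ((-\<beta>/2) ^ i / fact i * gauss_moment (a + 2 * real (m - i))) * (g x * v (m - i) x))" for x
    unfolding hermite_sum_def sum_distrib_left by (rule sum.cong) (simp_all add: mult_ac)
  then show ?thesis using assms by (simp add: hermite_sum_def)
qed

text \<open>The system is triangular in m with the positive diagonal
  \<open>gauss_moment (a + 2 * real m)\<close>.\<close>

lemma hermite_sum_inj:
  assumes a: "a > 0" and eq: "\<And>m. hermite_sum a \<beta> v m = hermite_sum a \<beta> w m"
  shows "v m = w m"
proof (induction m rule: less_induct)
  case (less m)
  have s: "hermite_sum a \<beta> v m = gauss_moment (a + 2 * real m) * v m
     + (\<Sum>i\<in>{..m} - {0}. (-\<beta>/2) ^ i / fact i * gauss_moment (a + 2 * real (m - i)) * v (m - i))" for v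
    unfolding hermite_sum_def by (subst sum.remove[of _ 0]) auto
  have "(\<Sum>i\<in>{..m} - {0}. (-\<beta>/2) ^ i / fact i * gauss_moment (a + 2 * real (m - i)) * v (m - i))
     = (\<Sum>i\<in>{..m} - {0}. (-\<beta>/2) ^ i / fact i * gauss_moment (a + 2 * real (m - i)) * w (m - i))"
    by (rule sum.cong) (use less in auto)
  then have "gauss_moment (a + 2 * real m) * v m = gauss_moment (a + 2 * real m) * w m"
    using eq[of m] unfolding s by simp
  moreover have "gauss_moment (a + 2 * real m) > 0" using a by (intro gauss_moment_pos) simp
  ultimately show ?case by simp
qed

lemma hermite_sum_cmult: "hermite_sum a \<beta> (\<lambda>l. c * v l) m = c * hermite_sum a \<beta> v m"
  unfolding hermite_sum_def sum_distrib_left by (rule sum.cong) (simp_all add: mult_ac)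

lemma prod_shift:
  fixes q :: real
  shows "(q - 2 * real m) * (\<Prod>i<k. q - 2 * real i - 2 * real (Suc m)) = (\<Prod>i<k. q - 2 * real i - 2 * real m) * (q - 2 * real k - 2 * real m)"
proof -
  have "(q - 2 * real m) * (\<Prod>i<k. q - 2 * real i - 2 * real (Suc m)) = (\<Prod>i<Suc k. q - 2 * real i - 2 * real m)"
    unfolding prod.lessThan_Suc_shift by (simp add: algebra_simps)
  then show ?thesis by (simp only: prod.lessThan_Suc)
qed

text \<open>\<open>inversion_const\<close> is the constant \<open>c\<close> in \<open>T\<^sub>q \<circ> \<Delta>\<^sup>k \<circ> T\<^sub>p = c\<close> on even functions.\<close>

definition inversion_const :: "nat \<Rightarrow> nat \<Rightarrow> real \<Rightarrow> real \<Rightarrow> real" where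
  "inversion_const n k p q = ((2 * gauss_moment 1) ^ (n - 1))\<^sup>2 * (2 * gauss_moment (p + 1)) * (2 * gauss_moment (q + 1)) *
     (\<Prod>i<k. q - 2 * real i) / (gauss_moment (n + p) * gauss_moment (- p))"

text \<open>Once \<open>prod_gauss_moment\<close> has rewritten its coefficients, the moment formula
  for the transform of order p is a Hermite sum at exponent -p, and \<open>heat_chain\<close> pulls
  it back through the k Laplacians to exponent n + q. What is left is to see that the scalar factors
  do not depend on m.\<close>

lemma hermite_sum_laplacian:
  fixes f :: "'a::euclidean_space \<Rightarrow> real" and p q :: real
  assumes n: "DIM('a) > 1" and p: "-1 < p" "p < 1" "p \<noteq> 0" "p = - real DIM('a) - q + 2 * real k"
    and fm: "f \<in> borel_measurable borel" and fi: "integrable sphere_measure f"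
    and F: "\<And>m. (\<integral>x. f x * zonal b m x \<partial>sphere_measure) = lap_moment (DIM('a)) q ((norm b)\<^sup>2) v k m"
  shows "(2 * gauss_moment 1) ^ (DIM('a) - 1) * (2 * gauss_moment (q + 1)) * (\<Prod>s<m. q - 2 * real s) *
      (\<integral>x. cosine_transform p f x * zonal b m x \<partial>sphere_measure)
    = inversion_const (DIM('a)) k p q * hermite_sum (DIM('a) + q) ((norm b)\<^sup>2) v m"
proof -
  let ?n = "real DIM('a)"
  let ?\<beta> = "(norm b)\<^sup>2"
  let ?F = "lap_moment ?n q ?\<beta> v k"
  let ?Q = "\<lambda>m. \<Prod>i<k. q - 2 * real i - 2 * real m"
  let ?P = "\<lambda>m. \<Prod>s<m. q - 2 * real s"
  let ?G = "\<lambda>m. gauss_moment (?n + p + 2 * real m)"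
  let ?\<kappa> = "\<lambda>r. (2 * gauss_moment 1) ^ (DIM('a) - 1) * (2 * gauss_moment (r + 1))"
  let ?H = "hermite_sum (?n + q) ?\<beta> v m"
  have Gpos: "?G m > 0" for m using n p by (intro gauss_moment_pos) simp
  have gp: "gauss_moment (- p) \<noteq> 0"
    using gauss_moment_rec[of "- p"] gauss_moment_pos[of "- p + 2"] p by auto
  have np: "?n + q - 2 * real k = - p" using p by simp
  have chain: "(\<Sum>i\<le>m. (-?\<beta>/2)^i / fact i * gauss_moment (- p + 2 * real (m - i)) * ?F (m - i)) = ?Q m * ?H"
  proof -
    have "(\<Sum>i\<le>m. (-?\<beta>/2)^i / fact i * gauss_moment (?n + q - 2 * real k + 2 * real (m - i)) * lap_moment ?n q ?\<beta> v k (m - i))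
       = ?Q m * (\<Sum>i\<le>m. (-?\<beta>/2)^i / fact i * gauss_moment (?n + q + 2 * real (m - i)) * lap_moment ?n q ?\<beta> v 0 (m - i))"
    proof (rule heat_chain)
      \<comment> \<open>Below step k the exponent is -p + 2j with j \<ge> 0. It is nonzero, because
        p is nonzero and less than 1, so the recursion never meets its pole.\<close>
      fix i l assume "i < k"
      then obtain k' where k: "k = Suc (i + k')" using less_iff_Suc_add by auto
      define j where "j = k' + l"
      have "real k = real i + 1 + real k'" by (simp add: k)
      then have a: "?n + q - 2 * real i - 2 + 2 * real l = - p + 2 * real j"
        using np by (simp add: j_def)
      have "- p + 2 * real j \<noteq> 0"
        by (cases j) (use p(2,3) in auto)
      then show "gauss_moment (?n + q - 2 * real i + 2 * real l)
        = (?n + q - 2 * real i - 2 + 2 * real l) * gauss_moment (?n + q - 2 * real i - 2 + 2 * real l)"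
      proof -
        have "?n + q - 2 * real i + 2 * real l = (- p + 2 * real j) + 2" using a by simp
        then show ?thesis
          unfolding a using gauss_moment_rec[of "- p + 2 * real j"] \<open>- p + 2 * real j \<noteq> 0\<close> p(2) by simp
      qed
    qed simp
    then show ?thesis unfolding np by (simp add: hermite_sum_def)
  qed
  have "?G m * (\<integral>x. cosine_transform p f x * zonal b m x \<partial>sphere_measure)
     = ?\<kappa> p * (\<Sum>i\<le>m. (?\<beta> / 2) ^ i / fact i * (\<Prod>s<m - i. p - 2 * real s) * ?F (m - i))"
    using cosine_transform_moments[OF n p(1) fm fi, of m b] by (simp only: F)
  also have "(\<Sum>i\<le>m. (?\<beta> / 2) ^ i / fact i * (\<Prod>s<m - i. p - 2 * real s) * ?F (m - i))
     = (-1) ^ m / gauss_moment (- p) * (\<Sum>i\<le>m. (-?\<beta>/2)^i / fact i * gauss_moment (- p + 2 * real (m - i)) * ?F (m - i))"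
    unfolding sum_distrib_left
  proof (rule sum.cong[OF refl])
    fix i assume i: "i \<in> {..m}"
    have "(-1 :: real) ^ (m - i) * (-1) ^ i = (-1) ^ m" using i by (simp flip: power_add)
    moreover have "(-1 :: real) ^ i * (-1) ^ i = 1" by (simp flip: power_mult_distrib)
    ultimately have s: "(-1 :: real) ^ (m - i) = (-1) ^ m * (-1) ^ i" by (metis mult.assoc mult.right_neutral)
    have b: "(-?\<beta>/2)^i = (-1) ^ i * (?\<beta>/2)^i" by (simp flip: power_mult_distrib)
    show "(?\<beta> / 2) ^ i / fact i * (\<Prod>s<m - i. p - 2 * real s) * ?F (m - i)
      = (-1) ^ m / gauss_moment (- p) * ((-?\<beta>/2)^i / fact i * gauss_moment (- p + 2 * real (m - i)) * ?F (m - i))"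
      unfolding prod_gauss_moment[OF p(2,3,1)] s b by (simp add: mult_ac)
  qed
  finally have "?G m * (\<integral>x. cosine_transform p f x * zonal b m x \<partial>sphere_measure)
     = ?\<kappa> p * ((-1) ^ m / gauss_moment (- p) * (?Q m * ?H))"
    unfolding chain .
  note GI = this
  have I: "(\<integral>x. cosine_transform p f x * zonal b m x \<partial>sphere_measure) = ?\<kappa> p * ((-1) ^ m / gauss_moment (- p) * (?Q m * ?H)) / ?G m"
  proof -
    have "x = y / z" if "z * x = y" "z > 0" for x y z :: real using that by auto
    from this[OF GI Gpos[of m]] show ?thesis .
  qed
  \<comment> \<open>By induction: \<open>prod_shift\<close> exchanges the new factor q - 2m for q -
    2k - 2m, which is -(n + p + 2m). The minus sign goes into (-1)^m and the rest cancels against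
    \<open>?G\<close>.\<close>
  have c: "?P m * (-1) ^ m * ?Q m / ?G m = (\<Prod>i<k. q - 2 * real i) / gauss_moment (?n + p)"
  proof (induction m)
    case (Suc m)
    have nz: "?n + p + 2 * real m > 0" using n p(1) by simp
    have "?n + p + 2 * real (Suc m) = (?n + p + 2 * real m) + 2" by simp
    then have G: "?G (Suc m) = (?n + p + 2 * real m) * ?G m"
      using gauss_moment_rec[of "?n + p + 2 * real m"] nz by (simp only:)
    have e: "q - 2 * real k - 2 * real m = - (?n + p + 2 * real m)" using np by simp
    have "?P (Suc m) * (-1) ^ Suc m * ?Q (Suc m) = ?P m * (-1) ^ Suc m * ((q - 2 * real m) * ?Q (Suc m))"
      by (simp only: prod.lessThan_Suc mult_ac)
    also have "\<dots> = ?P m * (-1) ^ m * ?Q m * (?n + p + 2 * real m)"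
    proof -
      have "x * (-1) ^ Suc m * (y * - z) = x * (-1) ^ m * y * z" for x y z :: real by simp
      then show ?thesis unfolding prod_shift e .
    qed
    finally have "?P (Suc m) * (-1) ^ Suc m * ?Q (Suc m) / ?G (Suc m) = ?P m * (-1) ^ m * ?Q m / ?G m"
      unfolding G using nz by simp
    then show ?case using Suc.IH by simp
  qed simp
  have "?\<kappa> q * ?P m * (?\<kappa> p * ((-1) ^ m / gauss_moment (- p) * (?Q m * ?H)) / ?G m)
     = ?\<kappa> q * ?\<kappa> p / gauss_moment (- p) * (?P m * (-1) ^ m * ?Q m / ?G m) * ?H"
    by (simp add: mult_ac)
  also have "\<dots> = inversion_const (DIM('a)) k p q * ?H"
    unfolding c inversion_const_def by (simp add: mult_ac power2_eq_square)
  finally show ?thesis unfolding I .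
qed

lemma continuous_even_square_zero:
  fixes w :: "'a::euclidean_space \<Rightarrow> real"
  assumes c: "continuous_on UNIV w" and i: "integrable sphere_measure (\<lambda>x. w x * w x)"
    and z: "(\<integral>x. w x * w x \<partial>sphere_measure) = 0" and y: "norm y = 1"
  shows "w y = 0"
proof (rule ccontr)
  assume "w y \<noteq> 0"
  have "open {x. w x \<noteq> 0}" using c by (intro open_Collect_neq) auto
  then obtain e where e: "e > 0" "ball y e \<subseteq> {x. w x \<noteq> 0}"
    using \<open>w y \<noteq> 0\<close> by (auto simp: open_contains_ball)
  have "AE x in sphere_measure. w x * w x = 0"
    using integral_nonneg_eq_0_iff_AE[OF i] z by simp
  then have "AE x in sphere_measure. x \<notin> ball y e"
    by eventually_elim (use e in auto)
  then show False by (rule sphere_measure_open_nonzero[OF y e(1)])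
qed

lemma integrable_sphere_continuous:
  fixes u :: "'a::euclidean_space \<Rightarrow> real"
  assumes "continuous_on UNIV u"
  shows "\<exists>B. \<forall>x. norm x \<le> 1 \<longrightarrow> \<bar>u x\<bar> \<le> B" "integrable sphere_measure u"
proof -
  have "compact (u ` cball 0 1)" using assms by (intro compact_continuous_image) (auto intro: continuous_on_subset)
  then obtain B where "\<forall>y\<in>u ` cball 0 1. norm y \<le> B"
    using compact_imp_bounded bounded_iff by metis
  then have B: "\<forall>x. norm x \<le> 1 \<longrightarrow> \<bar>u x\<bar> \<le> B" by auto
  then show "\<exists>B. \<forall>x. norm x \<le> 1 \<longrightarrow> \<bar>u x\<bar> \<le> B" ..
  have [measurable]: "u \<in> borel_measurable borel" using assms by (rule borel_measurable_continuous_onI)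
  have "integrable sphere_measure (\<lambda>x. 1 * u x)"
    using finite_measure.integrable_const[OF finite_measure_sphere_measure, of 1] B
    by (intro integrable_bounded_mult[where B = B]) auto
  then show "integrable sphere_measure u" by simp
qed

text \<open>Both sides are continuous, even and homogeneous of degree q, so equality of zonal
  moments on the sphere suffices. Their Hermite sums agree by the diagonal form of the two
  transforms, and triangularity gives the moments themselves.\<close>

lemma inversion_formula:
  fixes u f :: "'a::euclidean_space \<Rightarrow> real" and p q :: real
  assumes n: "DIM('a) > 1" and p: "-1 < p" "p < 1" "p \<noteq> 0" "p = - real DIM('a) - q + 2 * real k"
    and q: "q > 0" "q \<notin> \<int>"
    and fm: "f \<in> borel_measurable borel" and fi: "integrable sphere_measure f"
    and uc: "continuous_on UNIV u" and ue: "\<And>x. u (- x) = u x"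
    and uhom: "\<And>t x. t > 0 \<Longrightarrow> x \<noteq> 0 \<Longrightarrow> u (t *\<^sub>R x) = t powr q * u x" and u0: "u 0 = 0"
    and F: "\<And>b m. (\<integral>x. f x * zonal b m x \<partial>sphere_measure)
        = lap_moment (DIM('a)) q ((norm b)\<^sup>2) (\<lambda>m. \<integral>x. u x * zonal b m x \<partial>sphere_measure) k m"
  shows "cosine_transform q (cosine_transform p f) y = inversion_const (DIM('a)) k p q * u y"
proof -
  let ?n = "real DIM('a)"
  let ?c = "inversion_const (DIM('a)) k p q"
  let ?\<kappa> = "(2 * gauss_moment 1) ^ (DIM('a) - 1) * (2 * gauss_moment (q + 1))"
  let ?P = "\<lambda>m. \<Prod>s<m. q - 2 * real s"
  define g where "g = cosine_transform p f"
  define u' where "u' = cosine_transform q g"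
  have q1: "q > -1" using q by simp
  have gm [measurable]: "g \<in> borel_measurable borel" unfolding g_def using fm by measurable
  have gi: "integrable sphere_measure g"
    using cosine_transform_swap(1)[OF n p(1) fm _ fi, of "\<lambda>_. 1" 1] by (simp add: g_def)
  have u'c: "continuous_on UNIV u'" unfolding u'_def by (rule continuous_cosine_transform[OF q(1) gm gi])
  note ui = integrable_sphere_continuous(2)[OF uc] and u'i = integrable_sphere_continuous(2)[OF u'c]
  have mom: "(\<integral>x. u' x * zonal b m x \<partial>sphere_measure) = ?c * (\<integral>x. u x * zonal b m x \<partial>sphere_measure)" for b m
  proof -
    let ?U = "\<lambda>m. \<integral>x. u x * zonal b m x \<partial>sphere_measure"
    have sw: "(\<integral>x. u' x * zonal b l x \<partial>sphere_measure) = (\<integral>x. g x * cosine_transform q (zonal b l) x \<partial>sphere_measure)"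
      and swi: "integrable sphere_measure (\<lambda>x. g x * cosine_transform q (zonal b l) x)" for l
      unfolding u'_def by (rule cosine_transform_swap[OF n q1 gm _ gi]; auto intro: zonal_bound)+
    have "hermite_sum (?n + q) ((norm b)\<^sup>2) (\<lambda>m. \<integral>x. u' x * zonal b m x \<partial>sphere_measure) m
      = hermite_sum (?n + q) ((norm b)\<^sup>2) (\<lambda>m. ?c * ?U m) m" for m
    proof -
      have "hermite_sum (?n + q) ((norm b)\<^sup>2) (\<lambda>m. \<integral>x. u' x * zonal b m x \<partial>sphere_measure) m
         = (\<integral>x. g x * hermite_sum (?n + q) ((norm b)\<^sup>2) (\<lambda>l. cosine_transform q (zonal b l) x) m \<partial>sphere_measure)"
        unfolding sw by (rule hermite_sum_integral[OF swi])
      also have "\<dots> = (\<integral>x. ?\<kappa> * ?P m * (g x * zonal b m x) \<partial>sphere_measure)"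
      proof (rule Bochner_Integration.integral_cong[OF refl])
        fix x :: 'a assume "x \<in> space sphere_measure"
        then have "norm x = 1" by simp
        then show "g x * hermite_sum (?n + q) ((norm b)\<^sup>2) (\<lambda>l. cosine_transform q (zonal b l) x) m = ?\<kappa> * ?P m * (g x * zonal b m x)"
          by (simp add: hermite_sum_cosine_transform[OF n q1] mult_ac)
      qed
      also have "\<dots> = ?\<kappa> * ?P m * (\<integral>x. g x * zonal b m x \<partial>sphere_measure)" by simp
      also have "\<dots> = ?c * hermite_sum (?n + q) ((norm b)\<^sup>2) ?U m"
        unfolding g_def by (rule hermite_sum_laplacian[OF n p fm fi F])
      finally show ?thesis by (simp add: hermite_sum_cmult)
    qed
    then show ?thesis
      using hermite_sum_inj[of "?n + q" "(norm b)\<^sup>2" "\<lambda>m. \<integral>x. u' x * zonal b m x \<partial>sphere_measure" "\<lambda>m. ?c * ?U m"] q n by simp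
  qed
  define w where "w x = u' x - ?c * u x" for x
  have wc: "continuous_on UNIV w" unfolding w_def using uc u'c by (intro continuous_intros)
  have we: "w (- x) = w x" for x by (simp add: w_def u'_def cosine_transform_minus ue)
  have id_m: "(\<lambda>x. x) \<in> sphere_measure \<rightarrow>\<^sub>M (borel :: 'a measure)" by simp
  have cui: "integrable sphere_measure (\<lambda>x. ?c * u x)" using ui by simp
  \<comment> \<open>The difference \<open>w\<close> is continuous and even, hence an admissible test
    function for itself; its square then has integral 0.\<close>
  have "(\<integral>x. u' x * w x \<partial>sphere_measure) = (\<integral>x. (?c * u x) * w x \<partial>sphere_measure)"
    by (rule zonal_moments_determine[OF u'i id_m _ cui id_m _ _ wc we]) (auto simp: mom mult.assoc)
  moreover obtain Bw where Bw: "\<forall>x. norm x \<le> 1 \<longrightarrow> \<bar>w x\<bar> \<le> Bw"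
    using integrable_sphere_continuous(1)[OF wc] by blast
  moreover have [measurable]: "w \<in> borel_measurable borel" using wc by (rule borel_measurable_continuous_onI)
  moreover have i1: "integrable sphere_measure (\<lambda>x. u' x * w x)"
    by (rule integrable_bounded_mult[OF u'i, where B = Bw]) (auto simp: Bw)
  moreover have i2: "integrable sphere_measure (\<lambda>x. (?c * u x) * w x)"
    by (rule integrable_bounded_mult[OF cui, where B = Bw]) (auto simp: Bw)
  moreover have ww: "w x * w x = u' x * w x - (?c * u x) * w x" for x by (simp add: w_def algebra_simps)
  ultimately have z: "(\<integral>x. w x * w x \<partial>sphere_measure) = 0" unfolding ww by simp
  have wi: "integrable sphere_measure (\<lambda>x. w x * w x)" unfolding ww using i1 i2 by simp
  have s: "u' x = ?c * u x" if "norm x = 1" for x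
    using continuous_even_square_zero[OF wc wi z that] by (simp add: w_def)
  show ?thesis
  proof (cases "y = 0")
    case True
    then show ?thesis by (simp add: cosine_transform_def u0)
  next
    case False
    have "u' (norm y *\<^sub>R (y /\<^sub>R norm y)) = norm y powr q * u' (y /\<^sub>R norm y)"
      unfolding u'_def using False by (intro cosine_transform_scaleR) simp
    moreover have "u (norm y *\<^sub>R (y /\<^sub>R norm y)) = norm y powr q * u (y /\<^sub>R norm y)"
      using False by (intro uhom) auto
    moreover have "u' (y /\<^sub>R norm y) = ?c * u (y /\<^sub>R norm y)" using False by (intro s) simp
    ultimately show ?thesis using False by (simp add: u'_def g_def)
  qed
qed

section \<open>Embeddings into \<open>L\<^sub>q\<close>\<close>

lemma integral_lebesgue_on_01:
  fixes F :: "real \<Rightarrow> real"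
  assumes [measurable]: "F \<in> borel_measurable borel"
  shows "integrable (lebesgue_on {0..1}) F \<longleftrightarrow> integrable (restrict_space lborel {0<..<1}) F"
    and "integral\<^sup>L (lebesgue_on {0..1}) F = integral\<^sup>L (restrict_space lborel {0<..<1}) F"
proof -
  let ?g = "\<lambda>x::real. indicator {0..1} x *\<^sub>R F x" and ?h = "\<lambda>x::real. indicator {0<..<1} x *\<^sub>R F x"
  have ae: "AE x in lborel. ?g x = ?h x"
    using AE_lborel_singleton[of 0] AE_lborel_singleton[of 1] by eventually_elim (auto simp: indicator_def)
  have "integrable (lebesgue_on {0..1}) F \<longleftrightarrow> integrable lebesgue ?g"
    by (rule integrable_restrict_space) simp
  also have "\<dots> \<longleftrightarrow> integrable lborel ?g" by (rule integrable_completion) measurable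
  also have "\<dots> \<longleftrightarrow> integrable lborel ?h" by (rule integrable_cong_AE) (use ae in measurable)
  also have "\<dots> \<longleftrightarrow> integrable (restrict_space lborel {0<..<1}) F"
    by (rule integrable_restrict_space[symmetric]) simp
  finally show "integrable (lebesgue_on {0..1}) F \<longleftrightarrow> integrable (restrict_space lborel {0<..<1}) F" .
  have "integral\<^sup>L (lebesgue_on {0..1}) F = integral\<^sup>L lebesgue ?g"
    by (rule integral_restrict_space) simp
  also have "\<dots> = integral\<^sup>L lborel ?g" by (rule integral_completion) measurable
  also have "\<dots> = integral\<^sup>L lborel ?h" by (rule integral_cong_AE) (use ae in measurable)
  also have "\<dots> = integral\<^sup>L (restrict_space lborel {0<..<1}) F"
    by (rule integral_restrict_space[symmetric]) simp
  finally show "integral\<^sup>L (lebesgue_on {0..1}) F = integral\<^sup>L (restrict_space lborel {0<..<1}) F" .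
qed

text \<open>G is normalised to a probability density on the sphere and realised as the law of a
  vector function h on [0, 1]; x is sent to the function x . h(t), and the factor m^(1/q) restores
  the total mass.\<close>

lemma embeds_if_representation:
  fixes N :: "'a::euclidean_space \<Rightarrow> real" and q :: real
  assumes q: "q > 0" and N: "quasi_norm N"
    and Gm [measurable]: "G \<in> borel_measurable borel" and Gi: "integrable sphere_measure G"
    and G0: "AE \<theta> in sphere_measure. G \<theta> \<ge> 0"
    and rep: "\<And>y. N y powr q = cosine_transform q G y"
  shows "embeds_isometrically_Lq q N"
proof -
  have Nnn: "N x \<ge> 0" for x using N by (simp add: quasi_norm_def)
  define m where "m = integral\<^sup>L sphere_measure G"
  \<comment> \<open>If m were 0, G would vanish almost everywhere and N would be identically 0,
    against the existence of a basis vector.\<close>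
  have "m \<noteq> 0"
  proof
    assume "m = 0"
    then have "AE \<theta> in sphere_measure. G \<theta> = 0"
      using integral_nonneg_eq_0_iff_AE[OF Gi G0] by (simp add: m_def)
    then have "cosine_transform q G y = 0" for y
      unfolding cosine_transform_def by (intro integral_eq_zero_AE) (auto elim!: eventually_mono)
    then have "N y = 0" for y using rep[of y] by simp
    moreover obtain b :: 'a where "b \<in> Basis" using nonempty_Basis by blast
    ultimately show False using N by (auto simp: quasi_norm_def)
  qed
  moreover have "m \<ge> 0" unfolding m_def by (rule integral_nonneg_AE[OF G0])
  ultimately have m: "m > 0" by simp
  define D where "D = density (distr (sphere_measure :: 'a measure) borel (\<lambda>x. x)) (\<lambda>x. ennreal (G x / m))"
  have idm: "(\<lambda>x. x) \<in> sphere_measure \<rightarrow>\<^sub>M (borel :: 'a measure)" by simp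
  have ae: "AE x in distr (sphere_measure :: 'a measure) borel (\<lambda>x. x). 0 \<le> G x / m"
    using G0 m by (subst AE_distr_iff[OF idm]) (auto elim!: eventually_mono)
  have "emeasure D (space D) = (\<integral>\<^sup>+x. ennreal (G x / m) \<partial>sphere_measure)"
    unfolding D_def by (subst emeasure_density) (auto simp: nn_integral_distr[OF idm])
  also have "\<dots> = ennreal (integral\<^sup>L sphere_measure (\<lambda>x. G x / m))"
    using Gi G0 m by (intro nn_integral_eq_integral) (auto elim!: eventually_mono)
  also have "integral\<^sup>L sphere_measure (\<lambda>x. G x / m) = 1" using m by (simp add: m_def)
  finally have prob: "prob_space D" by (intro prob_spaceI) simp
  have "sets D = sets borel" by (simp add: D_def)
  then obtain h where hm [measurable]: "h \<in> borel_measurable borel"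
    and hD: "distr (restrict_space lborel {0<..<1::real}) borel h = D"
    using prob_measure_representation[OF prob] by blast
  have hm': "h \<in> restrict_space lborel {0<..<1::real} \<rightarrow>\<^sub>M borel"
    by (rule measurable_restrict_space1) simp
  define T where "T x t = m powr (1 / q) * (x \<bullet> h t)" for x t
  have Tm [measurable]: "T x \<in> borel_measurable borel" for x unfolding T_def[abs_def] by measurable
  have Tq: "\<bar>T x t\<bar> powr q = m * \<bar>x \<bullet> h t\<bar> powr q" for x t
    using m q by (simp add: T_def abs_mult powr_mult powr_powr)
  have ci: "integrable sphere_measure (\<lambda>\<theta>. \<bar>x \<bullet> \<theta>\<bar> powr q * G \<theta>)" for x
  proof -
    have "integrable sphere_measure (\<lambda>\<theta>. G \<theta> * \<bar>x \<bullet> \<theta>\<bar> powr q)"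
    proof (rule integrable_bounded_mult[OF Gi, where B = "norm x powr q"])
      fix \<theta> :: 'a assume "\<theta> \<in> space sphere_measure"
      then have "\<bar>x \<bullet> \<theta>\<bar> \<le> norm x" using Cauchy_Schwarz_ineq2[of x \<theta>] by simp
      then show "\<bar>\<bar>x \<bullet> \<theta>\<bar> powr q\<bar> \<le> norm x powr q" using q by (simp add: powr_mono2)
    qed simp
    then show ?thesis by (simp add: mult.commute)
  qed
  have s: "integrable (lebesgue_on {0..1}) (\<lambda>t. \<bar>T x t\<bar> powr q) \<and> (LINT t|lebesgue_on {0..1}. \<bar>T x t\<bar> powr q) = N x powr q" for x
  proof -
    let ?F = "\<lambda>z. \<bar>x \<bullet> z\<bar> powr q"
    have e: "G z / m * ?F z = (1 / m) * (?F z * G z)" for z by simp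
    have "integrable D ?F"
      unfolding D_def using ae ci[of x] by (subst integrable_density) (auto simp: integrable_distr_eq[OF idm] e simp del: times_divide_eq_left times_divide_eq_right)
    then have 1: "integrable (restrict_space lborel {0<..<1}) (\<lambda>t. ?F (h t))"
      unfolding hD[symmetric] by (subst (asm) integrable_distr_eq[OF hm']) auto
    have "(\<integral>t. ?F (h t) \<partial>restrict_space lborel {0<..<1}) = integral\<^sup>L D ?F"
      unfolding hD[symmetric] by (rule integral_distr[OF hm', symmetric]) simp
    also have "\<dots> = (\<integral>z. (1 / m) * (?F z * G z) \<partial>sphere_measure)"
      unfolding D_def using ae by (subst integral_density) (auto simp: integral_distr[OF idm] e simp del: times_divide_eq_left times_divide_eq_right)
    also have "\<dots> = N x powr q / m" using rep[of x] by (simp add: cosine_transform_def)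
    finally have 2: "(\<integral>t. ?F (h t) \<partial>restrict_space lborel {0<..<1}) = N x powr q / m" .
    show ?thesis
      unfolding Tq using 1 2 m by (simp add: integral_lebesgue_on_01)
  qed
  show ?thesis
    unfolding embeds_isometrically_Lq_def
  proof (intro exI[of _ T] conjI allI)
    show "T x \<in> Lq_space q" for x
      using s[of x] by (simp add: Lq_space_def measurable_restrict_space1 measurable_completion)
    show "AE t in lebesgue_on {0..1}. T (x + y) t = T x t + T y t" for x y
      by (rule AE_I2) (simp add: T_def inner_add_left distrib_left)
    show "AE t in lebesgue_on {0..1}. T (c *\<^sub>R x) t = c * T x t" for c x
      by (rule AE_I2) (simp add: T_def)
    show "Lq_norm q (T x) = N x" for x
      using s[of x] q Nnn[of x] by (simp add: Lq_norm_def powr_powr)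
  qed
qed

text \<open>The images of the basis vectors are the coordinates of h. The null set off which T x = x
  . h depends on x, but every use concerns one fixed x under an integral.\<close>

lemma representation_if_embeds:
  fixes N :: "'a::euclidean_space \<Rightarrow> real" and q :: real
  assumes q: "q > 0" and N: "quasi_norm N" and emb: "embeds_isometrically_Lq q N"
  obtains h :: "real \<Rightarrow> 'a" where "h \<in> borel_measurable (lebesgue_on {0..1})"
    "integrable (lebesgue_on {0..1}) (\<lambda>t. norm (h t) powr q)"
    "\<And>x. N x powr q = (LINT t|lebesgue_on {0..1}. \<bar>x \<bullet> h t\<bar> powr q)"
proof -
  let ?M = "lebesgue_on {0..1::real}"
  obtain T :: "'a \<Rightarrow> real \<Rightarrow> real" where T: "\<And>x. T x \<in> Lq_space q"
      "\<And>x y. AE t in ?M. T (x + y) t = T x t + T y t"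
      "\<And>c x. AE t in ?M. T (c *\<^sub>R x) t = c * T x t"
      "\<And>x. Lq_norm q (T x) = N x"
    using emb unfolding embeds_isometrically_Lq_def by blast
  have [measurable]: "T x \<in> borel_measurable ?M" and Ti: "integrable ?M (\<lambda>t. \<bar>T x t\<bar> powr q)" for x
    using T(1)[of x] by (auto simp: Lq_space_def)
  define h where "h t = (\<Sum>b\<in>Basis. T b t *\<^sub>R b)" for t
  have hm [measurable]: "h \<in> borel_measurable ?M" unfolding h_def[abs_def] by measurable
  have lin: "AE t in ?M. T (\<Sum>b\<in>S. c b *\<^sub>R b) t = (\<Sum>b\<in>S. c b * T b t)" if "finite S" for S :: "'a set" and c
    using that
  proof induction
    case empty
    show ?case using T(3)[of 0 0] by simp
  next
    case (insert b S)
    show ?case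
      using insert.IH T(2)[of "c b *\<^sub>R b" "\<Sum>b\<in>S. c b *\<^sub>R b"] T(3)[of "c b" b]
      by eventually_elim (use insert in simp)
  qed
  have Th: "AE t in ?M. T x t = x \<bullet> h t" for x
    using lin[OF finite_Basis, of "\<lambda>b. x \<bullet> b"]
    by eventually_elim (simp add: euclidean_representation h_def inner_sum_right mult.commute)
  have rep: "N x powr q = (LINT t|?M. \<bar>x \<bullet> h t\<bar> powr q)" for x
  proof -
    have "(LINT t|?M. \<bar>T x t\<bar> powr q) \<ge> 0" by (rule integral_nonneg_AE) simp
    then have "N x powr q = (LINT t|?M. \<bar>T x t\<bar> powr q)"
      using q unfolding T(4)[of x, symmetric] Lq_norm_def by (simp add: powr_powr)
    also have "\<dots> = (LINT t|?M. \<bar>x \<bullet> h t\<bar> powr q)"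
      by (rule integral_cong_AE) (use Th[of x] in \<open>auto elim!: eventually_mono\<close>)
    finally show ?thesis .
  qed
  have "integrable ?M (\<lambda>t. norm (h t) powr q)"
  proof (rule Bochner_Integration.integrable_bound)
    show "integrable ?M (\<lambda>t. real DIM('a) powr q * (\<Sum>b\<in>Basis. \<bar>T b t\<bar> powr q))"
      using Ti by (intro integrable_mult_right Bochner_Integration.integrable_sum) auto
    show "AE t in ?M. norm (norm (h t) powr q) \<le> norm (real DIM('a) powr q * (\<Sum>b\<in>Basis. \<bar>T b t\<bar> powr q))"
    proof (rule AE_I2)
      fix t
      \<comment> \<open>Estimating through the largest coordinate works for every positive q, also
        for q < 1, where the q-th root of the integral is only a quasi-norm.\<close>
      define mx where "mx = Max ((\<lambda>b. \<bar>T b t\<bar>) ` (Basis :: 'a set))"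
      have "mx \<in> (\<lambda>b. \<bar>T b t\<bar>) ` (Basis :: 'a set)" unfolding mx_def by (intro Max_in) auto
      then obtain b0 :: 'a where b0: "b0 \<in> Basis" "mx = \<bar>T b0 t\<bar>" by auto
      have "norm (h t) \<le> (\<Sum>b\<in>Basis. norm (T b t *\<^sub>R b))" unfolding h_def by (rule norm_sum)
      also have "\<dots> \<le> (\<Sum>b\<in>(Basis :: 'a set). mx)"
        unfolding mx_def by (intro sum_mono) (auto intro!: Max_ge)
      finally have "norm (h t) \<le> DIM('a) * mx" by simp
      then have "norm (h t) powr q \<le> (DIM('a) * mx) powr q" using q by (intro powr_mono2) auto
      also have "\<dots> = real DIM('a) powr q * \<bar>T b0 t\<bar> powr q" using b0 by (simp add: powr_mult)
      also have "\<dots> \<le> real DIM('a) powr q * (\<Sum>b\<in>Basis. \<bar>T b t\<bar> powr q)"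
        using b0(1) by (intro mult_left_mono member_le_sum) auto
      finally show "norm (norm (h t) powr q) \<le> norm (real DIM('a) powr q * (\<Sum>b\<in>Basis. \<bar>T b t\<bar> powr q))"
        by (simp add: sum_nonneg)
    qed
  qed measurable
  with hm rep show ?thesis by (intro that) auto
qed

text \<open>The representing measure is the image of |h|^q dt under t \<mapsto> h/|h|. Its Hermite
  sums and those of u are related as in the inversion, so the transform of f and c times this
  positive measure have equal zonal moments, hence equal integrals of even continuous
  functions.\<close>

lemma nonneg_if_representation:
  fixes u f :: "'a::euclidean_space \<Rightarrow> real" and p q :: real and h :: "real \<Rightarrow> 'a"
  assumes n: "DIM('a) > 1" and p: "-1 < p" "p < 1" "p \<noteq> 0" "p = - real DIM('a) - q + 2 * real k"
    and q: "q > 0" "q \<notin> \<int>"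
    and fm: "f \<in> borel_measurable borel" and fi: "integrable sphere_measure f"
    and F: "\<And>b m. (\<integral>x. f x * zonal b m x \<partial>sphere_measure)
        = lap_moment (DIM('a)) q ((norm b)\<^sup>2) (\<lambda>m. \<integral>x. u x * zonal b m x \<partial>sphere_measure) k m"
    and fin: "finite_measure M"
    and hm [measurable]: "h \<in> borel_measurable M" and hi: "integrable M (\<lambda>t. norm (h t) powr q)"
    and rep: "\<And>x. u x = (LINT t|M. \<bar>x \<bullet> h t\<bar> powr q)"
  shows "AE x in sphere_measure. 0 \<le> inversion_const (DIM('a)) k p q * cosine_transform p f x"
proof -
  let ?n = "real DIM('a)"
  let ?c = "inversion_const (DIM('a)) k p q"
  let ?\<kappa> = "(2 * gauss_moment 1) ^ (DIM('a) - 1) * (2 * gauss_moment (q + 1))"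
  let ?P = "\<lambda>m. \<Prod>s<m. q - 2 * real s"
  interpret M: finite_measure M by fact
  interpret S: finite_measure "sphere_measure :: 'a measure" by (rule finite_measure_sphere_measure)
  interpret MS: pair_sigma_finite M "sphere_measure :: 'a measure" ..
  have q1: "q > -1" using q by simp
  define g where "g = cosine_transform p f"
  have gm [measurable]: "g \<in> borel_measurable borel" unfolding g_def using fm by measurable
  have gi: "integrable sphere_measure g"
    using cosine_transform_swap(1)[OF n p(1) fm _ fi, of "\<lambda>_. 1" 1] by (simp add: g_def)
  \<comment> \<open>Where h vanishes, division by zero puts \<open>Y\<close> at 0, off the sphere;
    there the weight \<omega> is 0, so such t contribute nothing.\<close>
  define Y where "Y t = h t /\<^sub>R norm (h t)" for t
  define \<omega> where "\<omega> t = norm (h t) powr q" for t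
  have [measurable]: "Y \<in> borel_measurable M" unfolding Y_def[abs_def] by measurable
  have [measurable]: "\<omega> \<in> borel_measurable M" unfolding \<omega>_def[abs_def] by measurable
  have \<omega>i: "integrable M \<omega>" unfolding \<omega>_def[abs_def] by (rule hi)
  have Y1: "norm (Y t) \<le> 1" for t by (cases "h t = 0") (simp_all add: Y_def)
  have ct: "cosine_transform q \<phi> (h t) = \<omega> t * cosine_transform q \<phi> (Y t)" for \<phi> :: "'a \<Rightarrow> real" and t
  proof (cases "h t = 0")
    case True
    then show ?thesis by (simp add: cosine_transform_def \<omega>_def)
  next
    case False
    then have "cosine_transform q \<phi> (norm (h t) *\<^sub>R Y t) = \<omega> t * cosine_transform q \<phi> (Y t)"
      unfolding \<omega>_def by (intro cosine_transform_scaleR) simp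
    then show ?thesis using False by (simp add: Y_def)
  qed
  have fub: "integrable M (\<lambda>t. \<omega> t * cosine_transform q (zonal b l) (Y t))"
     "(\<integral>x. u x * zonal b l x \<partial>sphere_measure) = (\<integral>t. \<omega> t * cosine_transform q (zonal b l) (Y t) \<partial>M)" for b l
  proof -
    let ?f = "\<lambda>(t, x). \<bar>h t \<bullet> x\<bar> powr q * zonal b l x"
    define B where "B = norm b ^ (2 * l) / fact (2 * l)"
    have hfst [measurable]: "(\<lambda>z. h (fst z)) \<in> borel_measurable (M \<Otimes>\<^sub>M (sphere_measure :: 'a measure))"
      by (rule measurable_compose[OF measurable_fst hm])
    have fm': "?f \<in> borel_measurable (M \<Otimes>\<^sub>M sphere_measure)"
      unfolding case_prod_unfold by measurable
    have bd: "norm (?f (t, x)) \<le> \<omega> t * B" if "norm x = 1" for t x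
    proof -
      have "\<bar>h t \<bullet> x\<bar> \<le> norm (h t)" using Cauchy_Schwarz_ineq2[of "h t" x] that by simp
      then have "\<bar>h t \<bullet> x\<bar> powr q \<le> \<omega> t" unfolding \<omega>_def using q by (intro powr_mono2) auto
      moreover have "\<bar>zonal b l x\<bar> \<le> B" unfolding B_def using that by (intro zonal_bound) simp
      moreover have "\<omega> t \<ge> 0" by (simp add: \<omega>_def)
      ultimately show ?thesis by (simp add: abs_mult mult_mono)
    qed
    have i: "integrable (M \<Otimes>\<^sub>M sphere_measure) ?f"
    proof (rule Bochner_Integration.integrable_bound)
      show "integrable (M \<Otimes>\<^sub>M (sphere_measure :: 'a measure)) (\<lambda>z. \<omega> (fst z) * B)"
        by (rule MS.integral_times(1)[OF \<omega>i S.integrable_const])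
      show "AE z in M \<Otimes>\<^sub>M sphere_measure. norm (?f z) \<le> norm (\<omega> (fst z) * B)"
        by (rule AE_I2) (use bd in \<open>force simp: space_pair_measure intro: order_trans[OF _ abs_ge_self]\<close>)
    qed (rule fm')
    have e1: "(\<integral>x. ?f (t, x) \<partial>sphere_measure) = \<omega> t * cosine_transform q (zonal b l) (Y t)" for t
      unfolding ct[symmetric] by (simp add: cosine_transform_def)
    have e2: "(\<integral>t. ?f (t, x) \<partial>M) = u x * zonal b l x" for x
      unfolding rep by (simp add: inner_commute)
    show "integrable M (\<lambda>t. \<omega> t * cosine_transform q (zonal b l) (Y t))"
      using MS.integrable_fst'[OF i] unfolding e1 .
    show "(\<integral>x. u x * zonal b l x \<partial>sphere_measure) = (\<integral>t. \<omega> t * cosine_transform q (zonal b l) (Y t) \<partial>M)"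
      using MS.Fubini_integral[of "\<lambda>t x. ?f (t, x)"] i unfolding e1 e2 by (simp add: case_prod_unfold)
  qed
  have mom: "(\<integral>x. g x * zonal b m x \<partial>sphere_measure) = (\<integral>t. (?c * \<omega> t) * zonal b m (Y t) \<partial>M)" for b m
  proof -
    have "?\<kappa> * ?P m * (\<integral>x. g x * zonal b m x \<partial>sphere_measure)
       = ?c * hermite_sum (?n + q) ((norm b)\<^sup>2) (\<lambda>l. \<integral>x. u x * zonal b l x \<partial>sphere_measure) m"
      unfolding g_def by (rule hermite_sum_laplacian[OF n p fm fi F])
    also have "hermite_sum (?n + q) ((norm b)\<^sup>2) (\<lambda>l. \<integral>x. u x * zonal b l x \<partial>sphere_measure) m
       = (\<integral>t. \<omega> t * hermite_sum (?n + q) ((norm b)\<^sup>2) (\<lambda>l. cosine_transform q (zonal b l) (Y t)) m \<partial>M)"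
      unfolding fub(2) by (rule hermite_sum_integral[OF fub(1)])
    also have "\<dots> = (\<integral>t. ?\<kappa> * ?P m * (\<omega> t * zonal b m (Y t)) \<partial>M)"
    proof (rule Bochner_Integration.integral_cong[OF refl])
      fix t
      show "\<omega> t * hermite_sum (?n + q) ((norm b)\<^sup>2) (\<lambda>l. cosine_transform q (zonal b l) (Y t)) m = ?\<kappa> * ?P m * (\<omega> t * zonal b m (Y t))"
      proof (cases "h t = 0")
        case False
        then have "norm (Y t) = 1" by (simp add: Y_def)
        then show ?thesis by (simp add: hermite_sum_cosine_transform[OF n q1] mult_ac)
      qed (simp add: \<omega>_def)
    qed
    also have "?c * (\<integral>t. ?\<kappa> * ?P m * (\<omega> t * zonal b m (Y t)) \<partial>M) = (?\<kappa> * ?P m) * (?c * (\<integral>t. \<omega> t * zonal b m (Y t) \<partial>M))"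
      by (simp only: integral_mult_right_zero mult.left_commute[of ?c])
    also have "?c * (\<integral>t. \<omega> t * zonal b m (Y t) \<partial>M) = (\<integral>t. (?c * \<omega> t) * zonal b m (Y t) \<partial>M)"
      by (simp only: mult.assoc integral_mult_right_zero)
    finally have eq: "(?\<kappa> * ?P m) * (\<integral>x. g x * zonal b m x \<partial>sphere_measure) = (?\<kappa> * ?P m) * (\<integral>t. (?c * \<omega> t) * zonal b m (Y t) \<partial>M)" .
    \<comment> \<open>A vanishing factor would make q an even integer; this is what permits
      cancelling on both sides.\<close>
    have "?P m \<noteq> 0"
    proof
      assume "?P m = 0"
      then obtain s where "q = real (2 * s)" by auto
      then show False using q(2) by (metis Ints_of_nat)
    qed
    moreover have "?\<kappa> \<noteq> 0" using gauss_moment_pos[of 1] gauss_moment_pos[of "q + 1"] q by simp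
    ultimately have "?\<kappa> * ?P m \<noteq> 0" using no_zero_divisors by blast
    then show ?thesis using eq by (rule mult_left_cancel[THEN iffD1])
  qed
  have idm: "(\<lambda>x. x) \<in> sphere_measure \<rightarrow>\<^sub>M (borel :: 'a measure)" by simp
  show ?thesis
    unfolding g_def[symmetric]
  proof (rule AE_nonneg_if_continuous_tests)
    show "integrable sphere_measure (\<lambda>x. ?c * g x)" using gi by simp
    fix \<phi> :: "'a \<Rightarrow> real" assume \<phi>: "continuous_on UNIV \<phi>" "\<And>x. \<phi> x \<ge> 0"
    \<comment> \<open>Zonal moments see only even functions; since g is even, a test function may be
      replaced by its even part.\<close>
    define \<psi> where "\<psi> x = (\<phi> x + \<phi> (- x)) / 2" for x
    have \<phi>'c: "continuous_on UNIV (\<lambda>x. \<phi> (- x))"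
      using \<phi>(1) by (auto intro!: continuous_intros intro: continuous_on_compose2)
    have \<psi>c: "continuous_on UNIV \<psi>" unfolding \<psi>_def using \<phi>(1) \<phi>'c by (intro continuous_intros) auto
    have [measurable]: "\<phi> \<in> borel_measurable borel" using \<phi>(1) by (rule borel_measurable_continuous_onI)
    obtain B where B: "\<forall>x. norm x \<le> 1 \<longrightarrow> \<bar>\<phi> x\<bar> \<le> B"
      using integrable_sphere_continuous(1)[OF \<phi>(1)] by blast
    have i1: "integrable sphere_measure (\<lambda>x. g x * \<phi> x)"
      by (rule integrable_bounded_mult[OF gi, where B = B]) (use B in auto)
    have i2: "integrable sphere_measure (\<lambda>x. g x * \<phi> (- x))"
      by (rule integrable_bounded_mult[OF gi, where B = B]) (use B in auto)
    have ge: "g (- x) = g x" for x by (simp add: g_def cosine_transform_minus)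
    have "(\<integral>x. g x * \<phi> (- x) \<partial>sphere_measure) = (\<integral>x. g x * \<phi> x \<partial>sphere_measure)"
      using sphere_measure_uminus[of "\<lambda>x. g x * \<phi> x"] i1 i2 by (simp add: ge)
    then have "(\<integral>x. g x * \<phi> x \<partial>sphere_measure) = (\<integral>x. (g x * \<phi> x + g x * \<phi> (- x)) / 2 \<partial>sphere_measure)"
      using i1 i2 by simp
    also have "\<dots> = (\<integral>x. g x * \<psi> x \<partial>sphere_measure)" by (simp add: \<psi>_def distrib_left)
    also have "\<dots> = (\<integral>t. (?c * \<omega> t) * \<psi> (Y t) \<partial>M)"
      by (rule zonal_moments_determine[OF gi idm _ _ _ Y1 mom \<psi>c]) (use \<omega>i in \<open>auto simp: \<psi>_def add.commute\<close>)
    \<comment> \<open>One factor c belongs to the function under test and one to its moments, so the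
      square removes the sign of c.\<close>
    finally have "(\<integral>x. (?c * g x) * \<phi> x \<partial>sphere_measure) = ?c * ?c * (\<integral>t. \<omega> t * \<psi> (Y t) \<partial>M)"
      by (simp add: mult.assoc)
    moreover have "(\<integral>t. \<omega> t * \<psi> (Y t) \<partial>M) \<ge> 0"
      using \<phi>(2) by (intro integral_nonneg_AE AE_I2 mult_nonneg_nonneg) (auto simp: \<omega>_def \<psi>_def)
    ultimately show "(\<integral>x. (?c * g x) * \<phi> x \<partial>sphere_measure) \<ge> 0" by simp
  qed measurable
qed

section \<open>The sign of the constant, and the equivalence\<close>

text \<open>Two factors have a doubtful sign. The moment at -p has the sign of Gamma(-p/2), which
  enters through C_p. And (-1)^k prod (q - 2i) is 2^k times the Pochhammer symbol of -q/2, that is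
  2^k Gamma(k - q/2)/Gamma(-q/2), where k - q/2 = (n + p)/2 is positive; Gamma(-q/2) enters through
  C_q.\<close>

lemma inversion_const_sign:
  fixes p q :: real
  assumes n: "n > 1" and p: "-1 < p" "p < 1" "p \<noteq> 0" "p = - real n - q + 2 * real k" and q: "q > 0" "q \<notin> \<int>"
  shows "(-1) ^ k / (C_const p * C_const q) * inversion_const n k p q > 0"
proof -
  have Gp: "Gamma (- p / 2) * gauss_moment (- p) > 0"
  proof (cases "p < 0")
    case True
    then show ?thesis by (intro mult_pos_pos Gamma_real_pos gauss_moment_pos) auto
  next
    case False
    \<comment> \<open>For 0 < p < 1 both values are continuations by one step, a positive number
      divided by a negative one.\<close>
    then have p0: "p > 0" using p by simp
    have "- p / 2 \<notin> \<int>\<^sub>\<le>\<^sub>0"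
    proof
      assume "- p / 2 \<in> \<int>\<^sub>\<le>\<^sub>0"
      then obtain i :: int where "- p / 2 = of_int i" by (auto elim!: nonpos_Ints_cases)
      then have "of_int (- 1) < real_of_int i" "real_of_int i < of_int 0" using p0 p(2) by simp_all
      then show False unfolding of_int_less_iff by simp
    qed
    then have "Gamma (- p / 2 + 1) = (- p / 2) * Gamma (- p / 2)"
      by (rule Gamma_plus1)
    moreover have "Gamma (- p / 2 + 1) > 0" using p(2) by (intro Gamma_real_pos) simp
    moreover have "gauss_moment (- p + 2) = (- p) * gauss_moment (- p)" using p(2,3) by (intro gauss_moment_rec) auto
    moreover have "gauss_moment (- p + 2) > 0" using p(2) by (intro gauss_moment_pos) simp
    ultimately have "Gamma (- p / 2) < 0" "gauss_moment (- p) < 0"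
      using p0 by (auto simp: zero_less_mult_iff mult_less_0_iff)
    then show ?thesis by (simp add: mult_neg_neg)
  qed
  have nq: "- q / 2 \<notin> \<int>\<^sub>\<le>\<^sub>0"
  proof
    assume "- q / 2 \<in> \<int>\<^sub>\<le>\<^sub>0"
    then obtain i :: int where "- q / 2 = of_int i" by (auto elim!: nonpos_Ints_cases)
    then have "q = of_int (- 2 * i)" by simp
    then show False using q(2) by (metis Ints_of_int)
  qed
  have "pochhammer (- q / 2) k = Gamma (- q / 2 + real k) / Gamma (- q / 2)"
    by (rule pochhammer_Gamma[OF nq])
  moreover have "Gamma (- q / 2) \<noteq> 0" using nq by (simp add: Gamma_eq_zero_iff)
  ultimately have "pochhammer (- q / 2) k * Gamma (- q / 2) = Gamma (- q / 2 + real k)" by simp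
  moreover have "Gamma (- q / 2 + real k) > 0"
    using p n by (intro Gamma_real_pos) (simp add: field_simps)
  moreover have "pochhammer (- q / 2) k = (-1) ^ k * (\<Prod>i<k. q - 2 * real i) / 2 ^ k"
  proof -
    have "pochhammer (- q / 2) k = (\<Prod>i<k. (-1/2) * (q - 2 * real i))"
      unfolding pochhammer_prod atLeast0LessThan by (rule prod.cong) (simp_all add: field_simps)
    also have "\<dots> = (-1/2) ^ k * (\<Prod>i<k. q - 2 * real i)" by (simp only: prod.distrib prod_constant card_lessThan)
    also have "(-1/2 :: real) ^ k = (-1) ^ k / 2 ^ k" by (rule power_divide)
    finally show ?thesis by simp
  qed
  ultimately have "(-1) ^ k * (\<Prod>i<k. q - 2 * real i) / 2 ^ k * Gamma (- q / 2) > 0" by simp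
  then have "2 ^ k * ((-1) ^ k * (\<Prod>i<k. q - 2 * real i) / 2 ^ k * Gamma (- q / 2)) > 0"
    by (rule mult_pos_pos[rotated]) simp
  then have Gq: "(-1) ^ k * (\<Prod>i<k. q - 2 * real i) * Gamma (- q / 2) > 0" by simp
  define a where "a r = 2 powr (r + 1) * sqrt pi * Gamma ((r + 1) / 2)" for r :: real
  have a: "a r > 0" if "r > -1" for r unfolding a_def using that by (intro mult_pos_pos Gamma_real_pos) auto
  have C: "C_const r = a r / Gamma (- r / 2)" for r by (simp add: C_const_def a_def)
  \<comment> \<open>The quotient is expanded by the moment at -p, so that this moment meets
    Gamma(-p/2) in the numerator and only its square stays below.\<close>
  have "(-1) ^ k / (C_const p * C_const q) * inversion_const n k p q
     = (((-1) ^ k * (\<Prod>i<k. q - 2 * real i) * Gamma (- q / 2)) * (Gamma (- p / 2) * gauss_moment (- p))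
        * (((2 * gauss_moment 1) ^ (n - 1))\<^sup>2 * (2 * gauss_moment (p + 1)) * (2 * gauss_moment (q + 1))))
       / (a p * a q * gauss_moment (n + p) * (gauss_moment (- p))\<^sup>2)"
    unfolding C inversion_const_def using Gp by (simp add: power2_eq_square mult_ac)
  also have "\<dots> > 0"
  proof (rule divide_pos_pos[OF mult_pos_pos[OF mult_pos_pos[OF Gq Gp]]])
    show "((2 * gauss_moment 1) ^ (n - 1))\<^sup>2 * (2 * gauss_moment (p + 1)) * (2 * gauss_moment (q + 1)) > 0"
      using p(1) q(1) by (intro mult_pos_pos zero_less_power gauss_moment_pos) auto
    have "(gauss_moment (- p))\<^sup>2 > 0" using Gp by auto
    moreover have "gauss_moment (n + p) > 0" using n p(1) by (intro gauss_moment_pos) simp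
    moreover have "a p > 0" "a q > 0" using p(1) q(1) by (auto intro: a)
    ultimately show "a p * a q * gauss_moment (n + p) * (gauss_moment (- p))\<^sup>2 > 0" by simp
  qed
  finally show ?thesis .
qed

theorem mainTheorem5:
  fixes N :: "real ^ 'n \<Rightarrow> real" and f :: "real ^ 'n \<Rightarrow> real" and q :: real and k :: nat
  assumes n: "CARD('n) > 1"
    and q: "q > 0" "q \<notin> \<int>"
    and k: "k = (if even (CARD('n) + nat \<lfloor>q\<rfloor>)
                 then (CARD('n) + nat \<lfloor>q\<rfloor>) div 2
                 else (CARD('n) + nat \<lfloor>q\<rfloor> + 1) div 2)"
    and N: "quasi_norm N" "continuous_on UNIV N"
    and f: "distr_laplacian_power k (- {0}) (\<lambda>x. N x powr q) f"
    and f_hom: "pos_homogeneous (q - 2 * real k) f"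
    and f_L1: "integrable surface_measure f"
  shows "(embeds_isometrically_Lq q N \<longleftrightarrow>
           (AE \<xi> in surface_measure.
              0 \<le> (-1) ^ k / (C_const (- real CARD('n) - q + 2 * real k) * C_const q) *
                  (LINT \<theta>|surface_measure.
                     \<bar>\<theta> \<bullet> \<xi>\<bar> powr (- real CARD('n) - q + 2 * real k) * f \<theta>)))
         \<and>
         ((AE \<theta> in surface_measure.
              0 \<le> (-1) ^ k / (C_const (- real CARD('n) - q + 2 * real k) * C_const q) * f \<theta>)
           \<longrightarrow> embeds_isometrically_Lq q N)"
proof -
  define p where "p = - real CARD('n) - q + 2 * real k"
  define K where "K = (-1) ^ k / (C_const p * C_const q)"
  define c where "c = inversion_const (CARD('n)) k p q"
  define u where "u x = N x powr q" for x
  have n': "DIM(real ^ 'n) > 1" using n by simp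
  \<comment> \<open>p is \<open>- frac q\<close> in the even case and \<open>1 - frac q\<close> in
    the odd case.\<close>
  have "0 < frac q" "frac q < 1"
    using q(2) by (simp_all add: frac_gt_0_iff frac_lt_1)
  moreover have "real (nat \<lfloor>q\<rfloor>) = q - frac q" using q(1) by (simp add: frac_def)
  moreover have "2 * k = CARD('n) + nat \<lfloor>q\<rfloor> \<or> 2 * k = CARD('n) + nat \<lfloor>q\<rfloor> + 1"
    using k by (auto split: if_splits)
  then have "2 * real k = real CARD('n) + real (nat \<lfloor>q\<rfloor>) \<or> 2 * real k = real CARD('n) + real (nat \<lfloor>q\<rfloor>) + 1"
    by (metis of_nat_1 of_nat_add of_nat_mult of_nat_numeral)
  ultimately have p: "-1 < p" "p < 1" "p \<noteq> 0" unfolding p_def by linarith+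
  have p': "p = - real DIM(real ^ 'n) - q + 2 * real k" by (simp add: p_def)
  have Kc: "K * c > 0"
    unfolding K_def c_def by (rule inversion_const_sign[OF n p p_def q])
  then have K0: "K \<noteq> 0" and c0: "c \<noteq> 0" by auto
  \<comment> \<open>Only the sign of the constant in the theorem matters, so it can be exchanged for
    the inversion constant c.\<close>
  have sgn: "0 \<le> K * z \<longleftrightarrow> 0 \<le> c * z" for z
    using Kc by (auto simp: zero_less_mult_iff zero_le_mult_iff)
  have Nnn: "N x \<ge> 0" and Nsc: "N (a *\<^sub>R x) = \<bar>a\<bar> * N x" and N0: "N 0 = 0" for a x
    using N(1) by (auto simp: quasi_norm_def)
  have uc: "continuous_on UNIV u"
    unfolding u_def using N(2) Nnn q by (intro continuous_on_powr') (auto intro!: continuous_intros)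
  have um [measurable]: "u \<in> borel_measurable borel" using uc by (rule borel_measurable_continuous_onI)
  have ue: "u (- x) = u x" for x using Nsc[of "-1" x] by (simp add: u_def)
  have uhom: "u (t *\<^sub>R x) = t powr q * u x" if "t > 0" for t x
    using that Nnn by (simp add: u_def Nsc powr_mult)
  have u0: "u 0 = 0" by (simp add: u_def N0)
  have ui: "integrable sphere_measure u" by (rule integrable_sphere_continuous(2)[OF uc])
  \<comment> \<open>f is measurable only for completed measures; the Borel function f0 replaces it
    both in the distributional identity and on the sphere.\<close>
  obtain f0 where f0 [measurable]: "f0 \<in> borel_measurable borel" and f0i: "integrable sphere_measure f0"
    and ff0: "AE x in sphere_measure. f x = f0 x"
    and f0hom: "\<And>t x. t > 0 \<Longrightarrow> x \<noteq> 0 \<Longrightarrow> f0 (t *\<^sub>R x) = t powr (q - 2 * real k) * f0 x"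
    and ff0': "AE x in lebesgue. f x = f0 x"
    using homogeneous_borel_representative[OF f_L1 f_hom] by blast
  have fm: "f \<in> borel_measurable (completion sphere_measure)"
    using f_L1 by (simp add: surface_measure_eq borel_measurable_integrable)
  have f0m: "f0 \<in> borel_measurable (completion sphere_measure)" by (rule measurable_completion) simp
  have distr: "(LINT x|lebesgue. u x * (laplacian ^^ k) \<phi> x) = (LINT x|lebesgue. f0 x * \<phi> x)"
    if \<phi>: "\<phi> \<in> test_functions (- {0})" for \<phi>
  proof -
    have "(LINT x|lebesgue. f x * \<phi> x) = (LINT x|lebesgue. f0 x * \<phi> x)"
    proof (rule integral_cong_AE)
      have "\<phi> \<in> borel_measurable borel"
        using \<phi> by (intro smooth_borel_measurable) (simp add: test_functions_def smooth_def)
      then have \<phi>m: "\<phi> \<in> borel_measurable lebesgue" by (intro measurable_completion) simp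
      have f0l: "f0 \<in> borel_measurable lebesgue" by (rule measurable_completion) simp
      then have fl: "f \<in> borel_measurable lebesgue"
        by (rule borel_measurable_AE) (use ff0' in \<open>auto elim: eventually_mono\<close>)
      show "(\<lambda>x. f x * \<phi> x) \<in> borel_measurable lebesgue" by (rule borel_measurable_times[OF fl \<phi>m])
      show "(\<lambda>x. f0 x * \<phi> x) \<in> borel_measurable lebesgue" by (rule borel_measurable_times[OF f0l \<phi>m])
      show "AE x in lebesgue. f x * \<phi> x = f0 x * \<phi> x"
        using ff0' by eventually_elim simp
    qed
    then show ?thesis using f \<phi> unfolding distr_laplacian_power_def u_def by auto
  qed
  have F: "(\<integral>x. f0 x * zonal b m x \<partial>sphere_measure)
      = lap_moment (DIM(real ^ 'n)) q ((norm b)\<^sup>2) (\<lambda>m. \<integral>x. u x * zonal b m x \<partial>sphere_measure) k m" for b m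
    by (rule laplacian_moments[OF um ui uhom f0 f0i f0hom distr])
  have g: "(LINT \<theta>|surface_measure. \<bar>\<theta> \<bullet> \<xi>\<bar> powr p * f \<theta>) = cosine_transform p f0 \<xi>" for \<xi>
  proof -
    have "(LINT \<theta>|surface_measure. \<bar>\<theta> \<bullet> \<xi>\<bar> powr p * f \<theta>) = (LINT \<theta>|completion sphere_measure. \<bar>\<theta> \<bullet> \<xi>\<bar> powr p * f0 \<theta>)"
      unfolding surface_measure_eq
    proof (rule integral_cong_AE)
      have m: "(\<lambda>\<theta>. \<bar>\<theta> \<bullet> \<xi>\<bar> powr p) \<in> borel_measurable (completion sphere_measure)"
        by (rule measurable_completion) simp
      show "(\<lambda>\<theta>. \<bar>\<theta> \<bullet> \<xi>\<bar> powr p * f \<theta>) \<in> borel_measurable (completion sphere_measure)"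
        "(\<lambda>\<theta>. \<bar>\<theta> \<bullet> \<xi>\<bar> powr p * f0 \<theta>) \<in> borel_measurable (completion sphere_measure)"
        by (rule borel_measurable_times[OF m fm], rule borel_measurable_times[OF m f0m])
      show "AE \<theta> in completion sphere_measure. \<bar>\<theta> \<bullet> \<xi>\<bar> powr p * f \<theta> = \<bar>\<theta> \<bullet> \<xi>\<bar> powr p * f0 \<theta>"
        by (rule AE_completion) (use ff0 in eventually_elim, simp)
    qed
    also have "\<dots> = (LINT \<theta>|sphere_measure. \<bar>\<theta> \<bullet> \<xi>\<bar> powr p * f0 \<theta>)"
      by (rule integral_completion) measurable
    finally show ?thesis by (simp add: cosine_transform_def inner_commute)
  qed
  have gm [measurable]: "cosine_transform p f0 \<in> borel_measurable borel" by measurable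
  have gi: "integrable sphere_measure (cosine_transform p f0)"
    using cosine_transform_swap(1)[OF n' p(1) f0 _ f0i, of "\<lambda>_. 1" 1] by simp
  have inv: "cosine_transform q (cosine_transform p f0) y = c * u y" for y
    using inversion_formula[OF n' p p' q f0 f0i uc ue uhom u0 F] by (simp add: c_def)
  have if_nonneg: "embeds_isometrically_Lq q N" if nn: "AE \<xi> in sphere_measure. 0 \<le> c * cosine_transform p f0 \<xi>"
  proof (rule embeds_if_representation[OF q(1) N(1)])
    let ?G = "\<lambda>\<theta>. cosine_transform p f0 \<theta> / c"
    show "integrable sphere_measure ?G" using gi by simp
    show "AE \<theta> in sphere_measure. 0 \<le> ?G \<theta>"
      using nn by eventually_elim (simp add: zero_le_mult_iff zero_le_divide_iff, auto)
    show "N y powr q = cosine_transform q ?G y" for y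
      using inv[of y] c0 by (simp add: cosine_transform_def[of q] u_def field_simps)
  qed measurable
  have main: "embeds_isometrically_Lq q N \<longleftrightarrow> (AE \<xi> in surface_measure. 0 \<le> K * cosine_transform p f0 \<xi>)"
  proof
    assume "embeds_isometrically_Lq q N"
    then obtain h :: "real \<Rightarrow> real ^ 'n" where h: "h \<in> borel_measurable (lebesgue_on {0..1})"
      "integrable (lebesgue_on {0..1}) (\<lambda>t. norm (h t) powr q)"
      "\<And>x. N x powr q = (LINT t|lebesgue_on {0..1}. \<bar>x \<bullet> h t\<bar> powr q)"
      using representation_if_embeds[OF q(1) N(1)] by blast
    have "finite_measure (lebesgue_on {0..1::real})" by (rule finite_measure_lebesgue_on) simp
    from nonneg_if_representation[OF n' p p' q f0 f0i F this h(1,2)] h(3)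
    have "AE \<xi> in sphere_measure. 0 \<le> c * cosine_transform p f0 \<xi>" by (simp add: c_def u_def)
    then show "AE \<xi> in surface_measure. 0 \<le> K * cosine_transform p f0 \<xi>"
      unfolding surface_measure_eq sgn by (rule AE_completion)
  next
    assume "AE \<xi> in surface_measure. 0 \<le> K * cosine_transform p f0 \<xi>"
    then show "embeds_isometrically_Lq q N"
      unfolding surface_measure_eq AE_completion_iff sgn by (rule if_nonneg)
  qed
  have second: "embeds_isometrically_Lq q N" if "AE \<theta> in surface_measure. 0 \<le> K * f \<theta>"
  proof -
    have "AE \<theta> in sphere_measure. 0 \<le> K * f \<theta>"
      using that unfolding surface_measure_eq AE_completion_iff .
    then have ae: "AE \<theta> in sphere_measure. 0 \<le> K * f0 \<theta>"
      using ff0 by eventually_elim simp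
    \<comment> \<open>The kernel is nonnegative, so positivity of K f passes to its transform at
      every point and the criterion just proved applies.\<close>
    have "0 \<le> K * cosine_transform p f0 \<xi>" for \<xi>
    proof -
      have "K * cosine_transform p f0 \<xi> = (\<integral>\<theta>. \<bar>\<xi> \<bullet> \<theta>\<bar> powr p * (K * f0 \<theta>) \<partial>sphere_measure)"
        unfolding cosine_transform_def by (simp add: mult.left_commute[of _ K])
      also have "\<dots> \<ge> 0"
        by (rule integral_nonneg_AE) (use ae in eventually_elim, simp)
      finally show ?thesis .
    qed
    then show ?thesis by (intro if_nonneg AE_I2) (simp add: sgn[symmetric])
  qed
  show ?thesis
    unfolding p_def[symmetric] K_def[symmetric] g using main second by blast
qed

end
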